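(* Let $N\ge2$, $1\le p\le\infty$, let $\Omega\subseteq\mathbb{R}^N$ be open, $T>0$ and $\Omega_T=\Omega\times(0,T)$. For a function $u\in C(\Omega_T)$ the following assertions are equivalent: (i) $u_t=\frac{N}{N+p-2}\,\Delta_p^nu$ in $\Omega_T$ in the viscosity sense; (ii) $u(x,t)=\pi_p(\varepsilon,u)(x,t)+o(\varepsilon^2)$ as $\varepsilon\to0$ in the viscosity sense for every $(x,t)\in\Omega_T$.
   Context: Heat ball: with $\Phi(y,s)=(4\pi s)^{-N/2}e^{-|y|^2/(4s)}$ for $s>0$ and $\Phi(y,s)=0$ for $s\le0$, set, for $\varepsilon>0$, $$E_\varepsilon(x,t)=\{(y,s)\in\mathbb{R}^{N+1}: s<t,\ \Phi(x-y,t-s)>\varepsilon^{-N}\},$$ equipped with the measure $d\nu(y,s)=\frac{|x-y|^2}{(t-s)^2}\,dy\,ds$. Heat $p$-mean: for $1\le p\le\infty$ and $u$ continuous on $\overline{E_\varepsilon(x,t)}$, $\pi_p(\varepsilon,u)(x,t)$ is the unique real number $\pi$ such that $\|u-\pi\|_{L^p(E_\varepsilon(x,t),\nu)}=\min_{\lambda\in\mathbb{R}}\|u-\lambda\|_{L^p(E_\varepsilon(x,t),\nu)}$. Normalized $p$-Laplacian (all derivatives $\nabla,\nabla^2,\Delta$ are in the space variable $x$), where $\nabla\phi\ne0$: $$\Delta_p^n\phi=\Delta\phi+(p-2)\frac{\langle\nabla^2\phi\,\nabla\phi,\nabla\phi\rangle}{|\nabla\phi|^2}\ (1\le p<\infty),\qquad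 \Delta_\infty^n\phi=\frac{\langle\nabla^2\phi\,\nabla\phi,\nabla\phi\rangle}{|\nabla\phi|^2}.$$ For $p=\infty$, the expression $\frac{N}{N+p-2}\Delta_p^n\phi$ is understood as its limit as $p\to\infty$, i.e. $N\,\Delta_\infty^n\phi$. Viscosity solution: $u\in C(\Omega_T)$ is a viscosity solution of $u_t=\frac{N}{N+p-2}\Delta_p^nu$ in $\Omega_T$ if at every $(x,t)\in\Omega_T$: for any $\phi$ of class $C^2$ near $(x,t)$ such that $u-\phi$ has a strict (local) minimum at $(x,t)$ with $u(x,t)=\phi(x,t)$ and $\nabla\phi(x,t)\ne0$, one has $\frac{N}{N+p-2}\Delta_p^n\phi(x,t)\le\phi_t(x,t)$; and for any $\phi$ of class $C^2$ near $(x,t)$ such that $u-\phi$ has a strict (local) maximum at $(x,t)$ with $u(x,t)=\phi(x,t)$ and $\nabla\phi(x,t)\ne0$, one has $\frac{N}{N+p-2}\Delta_p^n\phi(x,t)\ge\phi_t(x,t)$. Asymptotic mean value property in the viscosity sense: $u\in C(\Omega_T)$ satisfies $u(x,t)=\pi_p(\varepsilon,u)(x,t)+o(\varepsilon^2)$ as $\varepsilon\to0$ in the viscosity sense at $(x,t)$ if: for any $\phi$ of class $C^2$ near $(x,t)$ such that $u-\phi$ has a strict (local) minimum at $(x,t)$ with $u(x,t)=\phi(x,t)$ and $\nabla\phi(x,t)\neq0$, one has $\phi(x,t)\ge\pi_p(\varepsilon,\phi)(x,t)+o(\varepsilon^2)$ as $\varepsilon\to0$; and for any $\phi$ of class $C^2$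 near $(x,t)$ such that $u-\phi$ has a strict (local) maximum at $(x,t)$ with $u(x,t)=\phi(x,t)$ and $\nabla\phi(x,t)\ne0$, one has $\phi(x,t)\le\pi_p(\varepsilon,\phi)(x,t)+o(\varepsilon^2)$ as $\varepsilon\to0$. An inequality of the form $a(\varepsilon)\ge b(\varepsilon)+o(\varepsilon^2)$ means that $a(\varepsilon)\ge b(\varepsilon)+r(\varepsilon)$ for all small $\varepsilon>0$, for some function $r$ with $r(\varepsilon)/\varepsilon^2\to0$ as $\varepsilon\to 0$. *)

theory Defs
  imports "HOL-Analysis.Analysis" "HOL-Probability.Essential_Supremum"
begin

text \<open>
  Space-time points are pairs in \<open>(real ^ 'n) \<times> real\<close>; the dimension \<open>N\<close> is \<open>CARD('n)\<close>.
  Exponents \<open>1 \<le> p \<le> \<infinity>\<close> are of type \<^typ>\<open>ereal\<close>.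
\<close>

definition heat_kernel :: "real ^ 'n \<Rightarrow> real \<Rightarrow> real" where
  "heat_kernel y s =
     (if s > 0
      then (4 * pi * s) powr (- real CARD('n) / 2) * exp (- (norm y)\<^sup>2 / (4 * s))
      else 0)"

definition heat_ball :: "real \<Rightarrow> (real ^ 'n) \<times> real \<Rightarrow> ((real ^ 'n) \<times> real) set" where
  "heat_ball \<epsilon> = (\<lambda>(x, t).
     {(y, s). s < t \<and> heat_kernel (x - y) (t - s) > \<epsilon> powr (- real CARD('n))})"

definition heat_measure :: "real \<Rightarrow> (real ^ 'n) \<times> real \<Rightarrow> ((real ^ 'n) \<times> real) measure" where
  "heat_measure \<epsilon> z =
     restrict_space
       (density lborel
         (\<lambda>(y, s). ennreal ((norm (fst z - y))\<^sup>2 / (snd z - s)\<^sup>2)))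
       (heat_ball \<epsilon> z)"

definition Lp_norm :: "'a measure \<Rightarrow> ereal \<Rightarrow> ('a \<Rightarrow> real) \<Rightarrow> ennreal" where
  "Lp_norm M p f =
     (if p = \<infinity> then esssup M (\<lambda>z. ennreal \<bar>f z\<bar>)
      else let I = (\<integral>\<^sup>+ z. ennreal (\<bar>f z\<bar> powr real_of_ereal p) \<partial>M)
           in if I = \<infinity> then \<infinity> else ennreal (enn2real I powr (1 / real_of_ereal p)))"

text \<open>
  The heat mean is meaningful when \<open>u\<close> is continuous on the closure of the heat ball; for a
  function that is continuous only near \<open>z\<close> this is the case for all small \<open>\<epsilon> > 0\<close>.
\<close>

definition heat_mean :: "ereal \<Rightarrow> real \<Rightarrow> ((real ^ 'n) \<times> real \<Rightarrow> real) \<Rightarrow> (real ^ 'n) \<times> real \<Rightarrow> real"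
  where
  "heat_mean p \<epsilon> u z =
     (THE m. \<forall>l. Lp_norm (heat_measure \<epsilon> z) p (\<lambda>w. u w - m)
                 \<le> Lp_norm (heat_measure \<epsilon> z) p (\<lambda>w. u w - l))"

text \<open>\<open>C\<^sup>2\<close> jointly in space and time, in the Frechet sense.\<close>

definition C2_near :: "('a::real_normed_vector \<Rightarrow> real) \<Rightarrow> 'a \<Rightarrow> bool" where
  "C2_near f z \<longleftrightarrow>
     (\<exists>U (f' :: 'a \<Rightarrow> 'a \<Rightarrow>\<^sub>L real) (f'' :: 'a \<Rightarrow> 'a \<Rightarrow>\<^sub>L 'a \<Rightarrow>\<^sub>L real).
        open U \<and> z \<in> U \<and>
        (\<forall>w\<in>U. (f has_derivative blinfun_apply (f' w)) (at w)) \<and>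
        (\<forall>w\<in>U. (f' has_derivative blinfun_apply (f'' w)) (at w)) \<and>
        continuous_on U f'')"

definition grad :: "(real ^ 'n \<Rightarrow> real) \<Rightarrow> real ^ 'n \<Rightarrow> real ^ 'n" where
  "grad f x = (\<chi> i. frechet_derivative f (at x) (axis i 1))"

definition hess :: "(real ^ 'n \<Rightarrow> real) \<Rightarrow> real ^ 'n \<Rightarrow> real ^ 'n ^ 'n" where
  "hess f x = jacobian (grad f) (at x)"

definition laplacian :: "(real ^ 'n \<Rightarrow> real) \<Rightarrow> real ^ 'n \<Rightarrow> real" where
  "laplacian f x = trace (hess f x)"

definition space_grad :: "((real ^ 'n) \<times> real \<Rightarrow> real) \<Rightarrow> (real ^ 'n) \<times> real \<Rightarrow> real ^ 'n" where
  "space_grad \<phi> = (\<lambda>(x, t). grad (\<lambda>y. \<phi> (y, t)) x)"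

definition time_deriv :: "((real ^ 'n) \<times> real \<Rightarrow> real) \<Rightarrow> (real ^ 'n) \<times> real \<Rightarrow> real" where
  "time_deriv \<phi> = (\<lambda>(x, t). deriv (\<lambda>s. \<phi> (x, s)) t)"

definition infinity_laplacian_n :: "(real ^ 'n \<Rightarrow> real) \<Rightarrow> real ^ 'n \<Rightarrow> real" where
  "infinity_laplacian_n f x = ((hess f x *v grad f x) \<bullet> grad f x) / (norm (grad f x))\<^sup>2"

definition p_laplacian_n :: "ereal \<Rightarrow> (real ^ 'n \<Rightarrow> real) \<Rightarrow> real ^ 'n \<Rightarrow> real" where
  "p_laplacian_n p f x =
     (if p = \<infinity> then infinity_laplacian_n f x
      else laplacian f x
           + (real_of_ereal p - 2) * (((hess f x *v grad f x) \<bullet> grad f x) / (norm (grad f x))\<^sup>2))"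

text \<open>
  The right-hand side \<open>N / (N + p - 2) \<Delta>\<^sub>p\<^sup>n \<phi>\<close> of the equation; for \<open>p = \<infinity>\<close> it is understood
  as the limit for \<open>p \<rightarrow> \<infinity>\<close>, that is \<open>N \<Delta>\<^sub>\<infinity>\<^sup>n \<phi>\<close>.
\<close>

definition scaled_p_laplacian_n ::
  "ereal \<Rightarrow> ((real ^ 'n) \<times> real \<Rightarrow> real) \<Rightarrow> (real ^ 'n) \<times> real \<Rightarrow> real" where
  "scaled_p_laplacian_n p \<phi> = (\<lambda>(x, t).
     (if p = \<infinity> then real CARD('n)
      else real CARD('n) / (real CARD('n) + real_of_ereal p - 2))
     * p_laplacian_n p (\<lambda>y. \<phi> (y, t)) x)"

text \<open>
  The filter \<open>at z\<close> ranges over a full punctured neighbourhood; below, \<open>z\<close> always lies in the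
  open space-time domain of \<open>u\<close>.
\<close>

definition strict_local_min :: "('a::topological_space \<Rightarrow> real) \<Rightarrow> 'a \<Rightarrow> bool" where
  "strict_local_min g z \<longleftrightarrow> (\<forall>\<^sub>F w in at z. g z < g w)"

definition strict_local_max :: "('a::topological_space \<Rightarrow> real) \<Rightarrow> 'a \<Rightarrow> bool" where
  "strict_local_max g z \<longleftrightarrow> (\<forall>\<^sub>F w in at z. g w < g z)"

definition touches_below ::
  "((real ^ 'n) \<times> real \<Rightarrow> real) \<Rightarrow> ((real ^ 'n) \<times> real \<Rightarrow> real) \<Rightarrow> (real ^ 'n) \<times> real \<Rightarrow> bool" where
  "touches_below \<phi> u z \<longleftrightarrow>
     C2_near \<phi> z \<and> strict_local_min (\<lambda>w. u w - \<phi> w) z \<and> u z = \<phi> z \<and> space_grad \<phi> z \<noteq> 0"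

definition touches_above ::
  "((real ^ 'n) \<times> real \<Rightarrow> real) \<Rightarrow> ((real ^ 'n) \<times> real \<Rightarrow> real) \<Rightarrow> (real ^ 'n) \<times> real \<Rightarrow> bool" where
  "touches_above \<phi> u z \<longleftrightarrow>
     C2_near \<phi> z \<and> strict_local_max (\<lambda>w. u w - \<phi> w) z \<and> u z = \<phi> z \<and> space_grad \<phi> z \<noteq> 0"

definition viscosity_solution ::
  "ereal \<Rightarrow> ((real ^ 'n) \<times> real) set \<Rightarrow> ((real ^ 'n) \<times> real \<Rightarrow> real) \<Rightarrow> bool" where
  "viscosity_solution p Q u \<longleftrightarrow>
     (\<forall>z\<in>Q.
        (\<forall>\<phi>. touches_below \<phi> u z \<longrightarrow> scaled_p_laplacian_n p \<phi> z \<le> time_deriv \<phi> z) \<and>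
        (\<forall>\<phi>. touches_above \<phi> u z \<longrightarrow> scaled_p_laplacian_n p \<phi> z \<ge> time_deriv \<phi> z))"

text \<open>\<open>a(\<epsilon>) \<ge> b(\<epsilon>) + o(\<epsilon>\<^sup>2)\<close> and \<open>a(\<epsilon>) \<le> b(\<epsilon>) + o(\<epsilon>\<^sup>2)\<close> as \<open>\<epsilon> \<rightarrow> 0\<close>, \<open>\<epsilon> > 0\<close>.\<close>

definition ge_up_to_o_sq :: "(real \<Rightarrow> real) \<Rightarrow> (real \<Rightarrow> real) \<Rightarrow> bool" where
  "ge_up_to_o_sq a b \<longleftrightarrow>
     (\<exists>r. ((\<lambda>\<epsilon>. r \<epsilon> / \<epsilon>\<^sup>2) \<longlongrightarrow> 0) (at_right 0) \<and> (\<forall>\<^sub>F \<epsilon> in at_right 0. a \<epsilon> \<ge> b \<epsilon> + r \<epsilon>))"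

definition le_up_to_o_sq :: "(real \<Rightarrow> real) \<Rightarrow> (real \<Rightarrow> real) \<Rightarrow> bool" where
  "le_up_to_o_sq a b \<longleftrightarrow>
     (\<exists>r. ((\<lambda>\<epsilon>. r \<epsilon> / \<epsilon>\<^sup>2) \<longlongrightarrow> 0) (at_right 0) \<and> (\<forall>\<^sub>F \<epsilon> in at_right 0. a \<epsilon> \<le> b \<epsilon> + r \<epsilon>))"

definition viscosity_mean_value ::
  "ereal \<Rightarrow> ((real ^ 'n) \<times> real \<Rightarrow> real) \<Rightarrow> (real ^ 'n) \<times> real \<Rightarrow> bool" where
  "viscosity_mean_value p u z \<longleftrightarrow>
     (\<forall>\<phi>. touches_below \<phi> u z \<longrightarrow> ge_up_to_o_sq (\<lambda>_. \<phi> z) (\<lambda>\<epsilon>. heat_mean p \<epsilon> \<phi> z)) \<and>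
     (\<forall>\<phi>. touches_above \<phi> u z \<longrightarrow> le_up_to_o_sq (\<lambda>_. \<phi> z) (\<lambda>\<epsilon>. heat_mean p \<epsilon> \<phi> z))"

end

theory Submission
  imports Defs
begin

text \<open>
  Put \<open>x + \<epsilon> y, t - \<epsilon>\<^sup>2 s\<close> for the space-time variable and rotate \<open>y\<close> so that \<open>\<nabla>\<phi>\<close> points in the direction
  of a coordinate axis \<open>k\<close>. The heat ball becomes a fixed set, and uniformly on it
  \<open>\<phi> = \<phi>(x, t) + \<epsilon> (b y\<^sub>k + \<epsilon> h(y, s) + o(\<epsilon>))\<close> with \<open>b = |\<nabla>\<phi>|\<close>, \<open>h(y, s) = \<langle>D y, y\<rangle> / 2 - s \<phi>\<^sub>t\<close>.
  For finite \<open>p\<close> the mean is located by the sign of \<open>\<integral> sgn(\<phi> - m) |\<phi> - m|\<^sup>p\<^sup>-\<^sup>1 d\<nu>\<close>, whose expansion in \<open>\<epsilon>\<close>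
  starts with a multiple of \<open>\<integral> |y\<^sub>k|\<^sup>p\<^sup>-\<^sup>2 (h - \<kappa>) d\<nu>\<close> when \<open>m = \<phi>(x, t) + \<epsilon>\<^sup>2 \<kappa>\<close>; for \<open>p = 1\<close> the weight \<open>|y\<^sub>k|\<^sup>p\<^sup>-\<^sup>2\<close>
  degenerates to the surface measure on \<open>y\<^sub>k = 0\<close>. The second moments of this weighted measure combine to
  the normalized \<open>p\<close>-Laplacian, and for \<open>p = \<infinity>\<close> the mean is the midrange, governed by the values of \<open>h\<close>
  at the two points where \<open>|y\<^sub>k|\<close> is maximal. Hence \<open>(\<pi>\<^sub>p(\<epsilon>, \<phi>) - \<phi>) / \<epsilon>\<^sup>2\<close> tends to a positive multiple of
  \<open>N / (N + p - 2) \<Delta>\<^sub>p\<^sup>n \<phi> - \<phi>\<^sub>t\<close> for every admissible test function, and the two notions coincide test function by test function.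
\<close>

section \<open>Lebesgue measure on Euclidean spaces\<close>

text \<open>The heat weight |y|^2 / s^2 is singular at s = 0, and |y_k|^(p-2) on y_k = 0 when p < 2,
  so dominated convergence needs a majorant that separates them. Replacing |y|^2 by the squared
  slice radius R(s), and y by its projection along the k-th axis, removes y_k from the weight; the
  y_k-integral splits off, and the rest is of size R(s)^((N+1)/2) / s^2, integrable for N \<ge> 2
  since R(s) = O(s^(3/4)). The factor N / (N + p - 2) comes from two exact identities. Dilating one
  coordinate shows that the weighted second moment of y_k is p - 1 times that of any other y_j;
  integrating along lines of fixed y shows that |y|^2 has 2 N times the moment of s. No derivative
  of the mean is taken: the sign of one integral at the level \<phi>(x, t) + \<epsilon>^2 \<kappa>
  tells on which side of it the mean lies, and \<kappa> approaches the limit from both sides. For p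
  = 1 the median must also be unique, which connectedness of the heat ball provides.\<close>

lemma nn_integral_lborel_translate:
  fixes a :: "'a::euclidean_space"
  assumes [measurable]: "f \<in> borel_measurable borel"
  shows "(\<integral>\<^sup>+x. f (a + x) \<partial>lborel) = (\<integral>\<^sup>+x. f x \<partial>lborel)"
  by (subst (2) lborel_distr_plus[of a, symmetric]) (simp add: nn_integral_distr)

text \<open>Fubini along \<open>b\<close> without writing the space as a product. The hyperplane
  orthogonal to \<open>b\<close> is thickened to the slab over [0, 1]; since the slab has thickness
  one, integrating over it a function constant along \<open>b\<close> is integrating over the
  hyperplane.\<close>

lemma nn_integral_lborel_slice:
  fixes b :: "'a::euclidean_space"
  assumes [measurable]: "f \<in> borel_measurable borel" and b: "b \<in> Basis"
  shows "(\<integral>\<^sup>+x. f x \<partial>lborel) =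
    (\<integral>\<^sup>+x. indicator {0..1} (x \<bullet> b) * (\<integral>\<^sup>+\<tau>. f (x + (\<tau> - x \<bullet> b) *\<^sub>R b) \<partial>lborel) \<partial>lborel)"
proof -
  have "(\<integral>\<^sup>+\<tau>. f (x + (\<tau> - x \<bullet> b) *\<^sub>R b) \<partial>lborel) = (\<integral>\<^sup>+\<tau>. f (x + \<tau> *\<^sub>R b) \<partial>lborel)" for x
    using nn_integral_lborel_translate[of "\<lambda>\<tau>. f (x + (\<tau> - x \<bullet> b) *\<^sub>R b)" "x \<bullet> b"] by simp
  then have "(\<integral>\<^sup>+x. indicator {0..1} (x \<bullet> b) * (\<integral>\<^sup>+\<tau>. f (x + (\<tau> - x \<bullet> b) *\<^sub>R b) \<partial>lborel) \<partial>lborel)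
    = (\<integral>\<^sup>+x. (\<integral>\<^sup>+\<tau>. indicator {0..1} (x \<bullet> b) * f (x + \<tau> *\<^sub>R b) \<partial>lborel) \<partial>lborel)"
    by (simp add: nn_integral_cmult)
  also have "\<dots> = (\<integral>\<^sup>+\<tau>. (\<integral>\<^sup>+x. indicator {0..1} (x \<bullet> b) * f (x + \<tau> *\<^sub>R b) \<partial>lborel) \<partial>lborel)"
    by (rule lborel_pair.Fubini') simp
  \<comment> \<open>Shifting x by \<tau> b moves the dependence on \<tau> from \<open>f\<close> into
    the indicator, whose integral over \<tau> is 1.\<close>
  also have "\<dots> = (\<integral>\<^sup>+\<tau>. (\<integral>\<^sup>+x. indicator {0..1} (x \<bullet> b - \<tau>) * f x \<partial>lborel) \<partial>lborel)"
  proof (rule nn_integral_cong)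
    fix \<tau> :: real
    show "(\<integral>\<^sup>+x. indicator {0..1} (x \<bullet> b) * f (x + \<tau> *\<^sub>R b) \<partial>lborel)
      = (\<integral>\<^sup>+x. indicator {0..1} (x \<bullet> b - \<tau>) * f x \<partial>lborel)"
      using nn_integral_lborel_translate[of "\<lambda>x. indicator {0..1} (x \<bullet> b - \<tau>) * f x" "\<tau> *\<^sub>R b"] b
      by (simp add: inner_add_left add.commute)
  qed
  also have "\<dots> = (\<integral>\<^sup>+x. (\<integral>\<^sup>+\<tau>. indicator {0..1} (x \<bullet> b - \<tau>) * f x \<partial>lborel) \<partial>lborel)"
    by (rule lborel_pair.Fubini') simp
  also have "\<dots> = (\<integral>\<^sup>+x. f x \<partial>lborel)"
  proof (rule nn_integral_cong)
    fix x :: 'a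
    have "(\<integral>\<^sup>+\<tau>. indicator {0..1} (x \<bullet> b - \<tau>) \<partial>lborel) = (\<integral>\<^sup>+\<tau>. indicator {x \<bullet> b - 1..x \<bullet> b} \<tau> \<partial>(lborel :: real measure))"
      by (intro nn_integral_cong) (auto simp: indicator_def)
    then show "(\<integral>\<^sup>+\<tau>. indicator {0..1} (x \<bullet> b - \<tau>) * f x \<partial>lborel) = f x"
      by (simp add: nn_integral_multc)
  qed
  finally show ?thesis by simp
qed

text \<open>The slicing identity as an equality of measures, so that Bochner integrals of signed
  functions can be transported along it.\<close>

lemma lborel_slice:
  fixes b :: "'a::euclidean_space"
  assumes b: "b \<in> Basis"
  shows "distr (density lborel (\<lambda>x. indicator {0..1} (x \<bullet> b)) \<Otimes>\<^sub>M lborel) borel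
    (\<lambda>(x, \<tau>). x + (\<tau> - x \<bullet> b) *\<^sub>R b) = (lborel :: 'a measure)"
proof (rule measure_eqI)
  fix A :: "'a set" assume "A \<in> sets (distr (density lborel (\<lambda>x. indicator {0..1} (x \<bullet> b)) \<Otimes>\<^sub>M lborel) borel
    (\<lambda>(x, \<tau>). x + (\<tau> - x \<bullet> b) *\<^sub>R b))"
  then have [measurable]: "A \<in> sets borel" by simp
  have "emeasure lborel A = (\<integral>\<^sup>+x. indicator A x \<partial>lborel)" by simp
  also have "\<dots> = (\<integral>\<^sup>+x. indicator {0..1} (x \<bullet> b) * (\<integral>\<^sup>+\<tau>. indicator A (x + (\<tau> - x \<bullet> b) *\<^sub>R b) \<partial>lborel) \<partial>lborel)"
    by (rule nn_integral_lborel_slice) (simp_all add: b)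
  also have "\<dots> = (\<integral>\<^sup>+x. (\<integral>\<^sup>+\<tau>. indicator A (x + (\<tau> - x \<bullet> b) *\<^sub>R b) \<partial>lborel) \<partial>density lborel (\<lambda>x. indicator {0..1} (x \<bullet> b)))"
    by (simp add: nn_integral_density)
  also have "\<dots> = (\<integral>\<^sup>+z. indicator A ((\<lambda>(x, \<tau>). x + (\<tau> - x \<bullet> b) *\<^sub>R b) z) \<partial>(density lborel (\<lambda>x. indicator {0..1} (x \<bullet> b)) \<Otimes>\<^sub>M lborel))"
    by (subst lborel.nn_integral_fst[symmetric]) simp_all
  also have "\<dots> = emeasure (distr (density lborel (\<lambda>x. indicator {0..1} (x \<bullet> b)) \<Otimes>\<^sub>M lborel) borel
    (\<lambda>(x, \<tau>). x + (\<tau> - x \<bullet> b) *\<^sub>R b)) A"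
    by (subst nn_integral_indicator[symmetric], simp, subst nn_integral_distr) simp_all
  finally show "emeasure (distr (density lborel (\<lambda>x. indicator {0..1} (x \<bullet> b)) \<Otimes>\<^sub>M lborel) borel
    (\<lambda>(x, \<tau>). x + (\<tau> - x \<bullet> b) *\<^sub>R b)) A = emeasure lborel A" by simp
qed simp

lemma lborel_slice_integral:
  fixes b :: "'a::euclidean_space" and f :: "'a \<Rightarrow> real"
  assumes b: "b \<in> Basis" and f: "integrable lborel f"
  shows "(\<integral>x. f x \<partial>lborel) =
    (\<integral>x. indicator {0..1} (x \<bullet> b) * (\<integral>\<tau>. f (x + (\<tau> - x \<bullet> b) *\<^sub>R b) \<partial>lborel) \<partial>lborel)"
proof -
  let ?D = "density lborel (\<lambda>x::'a. indicator {0..1} (x \<bullet> b))"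
  let ?T = "\<lambda>(x::'a, \<tau>). x + (\<tau> - x \<bullet> b) *\<^sub>R b"
  have [measurable]: "f \<in> borel_measurable borel" using f by simp
  interpret D: sigma_finite_measure ?D
    by (subst sigma_finite_measure.sigma_finite_iff_density_finite[OF sigma_finite_lborel])
      (auto simp: indicator_def)
  interpret P: pair_sigma_finite ?D "lborel :: real measure" ..
  have "integrable (distr (?D \<Otimes>\<^sub>M lborel) borel ?T) f"
    using f by (simp add: lborel_slice[OF b])
  then have i: "integrable (?D \<Otimes>\<^sub>M lborel) (\<lambda>z. f (?T z))"
    by (subst (asm) integrable_distr_eq) auto
  have "(\<integral>x. f x \<partial>lborel) = (\<integral>x. f x \<partial>distr (?D \<Otimes>\<^sub>M lborel) borel ?T)"
    by (simp add: lborel_slice[OF b])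
  also have "\<dots> = (\<integral>z. f (?T z) \<partial>(?D \<Otimes>\<^sub>M lborel))"
    by (subst integral_distr) auto
  also have "\<dots> = (\<integral>x. (\<integral>\<tau>. f (?T (x, \<tau>)) \<partial>lborel) \<partial>?D)"
    by (rule P.integral_fst'[symmetric, OF i])
  also have "?D = density lborel (\<lambda>x. ennreal (indicator {0..1} (x \<bullet> b)))"
    by (simp add: ennreal_indicator)
  also have "(\<integral>x. (\<integral>\<tau>. f (?T (x, \<tau>)) \<partial>lborel) \<partial>\<dots>) =
    (\<integral>x. indicator {0..1} (x \<bullet> b) * (\<integral>\<tau>. f (x + (\<tau> - x \<bullet> b) *\<^sub>R b) \<partial>lborel) \<partial>lborel)"
    by (subst integral_density) auto
  finally show ?thesis .
qed

lemma lborel_scale_direction: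
  fixes b :: "'a::euclidean_space"
  assumes b: "b \<in> Basis" and s: "s \<noteq> 0"
  shows "lborel = density (distr lborel borel (\<lambda>x::'a. x + ((s - 1) * (x \<bullet> b)) *\<^sub>R b)) (\<lambda>_. ennreal \<bar>s\<bar>)"
proof -
  define c where "c j = (if j = b then s else 1)" for j :: 'a
  have "(\<Sum>j\<in>Basis. (c j * (x \<bullet> j)) *\<^sub>R j) = x + ((s - 1) * (x \<bullet> b)) *\<^sub>R b" for x
  proof -
    have "(\<Sum>j\<in>Basis. (c j * (x \<bullet> j)) *\<^sub>R j) =
      (\<Sum>j\<in>Basis. (x \<bullet> j) *\<^sub>R j + (if j = b then ((s - 1) * (x \<bullet> b)) *\<^sub>R b else 0))"
      by (intro sum.cong refl) (auto simp: c_def algebra_simps)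
    then show ?thesis using b by (simp add: sum.distrib euclidean_representation)
  qed
  moreover have "(\<Prod>j\<in>Basis. \<bar>c j\<bar>) = \<bar>s\<bar>"
    using b by (simp add: c_def if_distrib[of abs] cong: if_cong)
  ultimately show ?thesis
    using lborel_affine_euclidean[of c "0::'a"] s by (simp add: c_def)
qed

lemma integral_scale_direction:
  fixes b :: "'a::euclidean_space" and f :: "'a \<Rightarrow> real"
  assumes b: "b \<in> Basis" and s: "s \<noteq> 0" and [measurable]: "f \<in> borel_measurable borel"
  shows "(\<integral>x. f x \<partial>lborel) = \<bar>s\<bar> * (\<integral>x. f (x + ((s - 1) * (x \<bullet> b)) *\<^sub>R b) \<partial>lborel)"
  by (subst lborel_scale_direction[OF b s]) (simp add: integral_density integral_distr)

text \<open>Both measures are translation invariant, so they are proportional; comparing the unit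
  ball gives the factor.\<close>

lemma distr_lborel_orthogonal:
  fixes f :: "'a::euclidean_space \<Rightarrow> 'a"
  assumes f: "orthogonal_transformation f"
  shows "distr lborel borel f = lborel"
proof (rule measure_eqI)
  define \<mu> where "\<mu> = distr lborel borel f"
  have lin: "linear f" using f by (simp add: orthogonal_transformation_linear)
  then have fm [measurable]: "f \<in> borel_measurable borel"
    by (intro borel_measurable_continuous_onI linear_continuous_on linear_conv_bounded_linear[THEN iffD1])
  have bij: "bij f" using f by (rule orthogonal_transformation_bij)
  have ss [simp, measurable_cong]: "sets \<mu> = sets borel" by (simp add: \<mu>_def)
  have sp [simp]: "space \<mu> = UNIV" by (simp add: \<mu>_def)
  have ball: "emeasure \<mu> (ball 0 1) = emeasure lborel (ball (0::'a) 1)"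
  proof -
    have "f -` ball 0 1 = ball 0 1"
      using f by (auto simp: orthogonal_transformation_norm)
    then show ?thesis by (simp add: \<mu>_def emeasure_distr)
  qed
  \<comment> \<open>By linearity, translating by \<open>f y'\<close> after \<open>f\<close> is the
    same as translating by \<open>y'\<close> before it.\<close>
  have inv: "(\<integral>\<^sup>+x. g (x + y) \<partial>\<mu>) = (\<integral>\<^sup>+x. g x \<partial>\<mu>)" if [measurable]: "g \<in> borel_measurable borel"
    for g :: "'a \<Rightarrow> ennreal" and y
  proof -
    obtain y' where y: "y = f y'" using bij by (metis bij_pointE)
    have "(\<integral>\<^sup>+x. g (x + y) \<partial>\<mu>) = (\<integral>\<^sup>+x. g (f (y' + x)) \<partial>lborel)"
      unfolding \<mu>_def by (simp add: nn_integral_distr y linear_add[OF lin] add.commute)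
    also have "\<dots> = (\<integral>\<^sup>+x. g (f x) \<partial>lborel)"
      by (rule nn_integral_lborel_translate) simp
    finally show ?thesis unfolding \<mu>_def by (simp add: nn_integral_distr)
  qed
  have sf: "sigma_finite_measure \<mu>"
  proof
    show "\<exists>A. countable A \<and> A \<subseteq> sets \<mu> \<and> \<Union>A = space \<mu> \<and> (\<forall>a\<in>A. emeasure \<mu> a \<noteq> \<infinity>)"
    proof (intro exI conjI)
      show "countable (range (\<lambda>n::nat. cball (0::'a) (real n)))" by simp
      show "range (\<lambda>n::nat. cball (0::'a) (real n)) \<subseteq> sets \<mu>" by auto
      show "\<Union> (range (\<lambda>n::nat. cball (0::'a) (real n))) = space \<mu>"
        by (auto simp: real_arch_simple)
      show "\<forall>a\<in>range (\<lambda>n::nat. cball (0::'a) (real n)). emeasure \<mu> a \<noteq> \<infinity>"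
      proof
        fix a assume "a \<in> range (\<lambda>n::nat. cball (0::'a) (real n))"
        then obtain n where a: "a = cball 0 (real n)" by auto
        have "f -` a = a" using f by (auto simp: orthogonal_transformation_norm a)
        then have "emeasure \<mu> a = emeasure lborel a" by (simp add: \<mu>_def emeasure_distr a)
        then show "emeasure \<mu> a \<noteq> \<infinity>" using emeasure_lborel_cball_finite[of "0::'a" "real n"] by (simp add: a less_top[symmetric])
      qed
    qed
  qed
  then interpret P: pair_sigma_finite \<mu> "lborel :: 'a measure"
    by (simp add: pair_sigma_finite_def lborel.sigma_finite_measure_axioms)
  fix A assume "A \<in> sets (distr lborel borel f)"
  then have [measurable]: "A \<in> sets borel" by simp
  have bm [measurable]: "(indicator (ball 0 1) :: 'a \<Rightarrow> ennreal) \<in> borel_measurable borel"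
    by (rule borel_measurable_indicator) simp
  \<comment> \<open>The uniqueness argument for Haar measure: the double integral of 1_A(x + y)
    1_ball(y) is evaluated with either variable translated, which gives \<mu>(A) |ball| on one side
    and |A| \<mu>(ball) on the other.\<close>
  have "emeasure \<mu> A * emeasure lborel (ball (0::'a) 1)
    = (\<integral>\<^sup>+y. (\<integral>\<^sup>+x. indicator A x * indicator (ball (0::'a) 1) y \<partial>\<mu>) \<partial>lborel)"
    by (simp add: nn_integral_multc nn_integral_cmult_indicator)
  also have "\<dots> = (\<integral>\<^sup>+y. (\<integral>\<^sup>+x. indicator A (x + y) * indicator (ball 0 1) y \<partial>\<mu>) \<partial>lborel)"
    by (simp add: nn_integral_multc inv[of "indicator A"])
  also have "\<dots> = (\<integral>\<^sup>+x. (\<integral>\<^sup>+y. indicator A (x + y) * indicator (ball 0 1) y \<partial>lborel) \<partial>\<mu>)"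
    by (rule P.Fubini') simp
  also have "\<dots> = (\<integral>\<^sup>+x. (\<integral>\<^sup>+y. indicator A y * indicator (ball 0 1) (y - x) \<partial>lborel) \<partial>\<mu>)"
  proof (rule nn_integral_cong)
    fix x
    show "(\<integral>\<^sup>+y. indicator A (x + y) * indicator (ball 0 1) y \<partial>lborel)
      = (\<integral>\<^sup>+y. indicator A y * indicator (ball 0 1) (y - x) \<partial>lborel)"
      using nn_integral_lborel_translate[of "\<lambda>y. indicator A y * indicator (ball 0 1) (y - x)" x]
      by simp
  qed
  also have "\<dots> = (\<integral>\<^sup>+y. (\<integral>\<^sup>+x. indicator A y * indicator (ball 0 1) (y - x) \<partial>\<mu>) \<partial>lborel)"
    by (rule P.Fubini'[symmetric]) simp
  also have "\<dots> = (\<integral>\<^sup>+y. indicator A y * emeasure \<mu> (ball 0 1) \<partial>lborel)"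
  proof (rule nn_integral_cong)
    fix y
    have "(\<integral>\<^sup>+x. indicator (ball 0 1) (y - x) \<partial>\<mu>) = (\<integral>\<^sup>+x. indicator (ball 0 1) (y - (x + y)) \<partial>\<mu>)"
      by (rule inv[symmetric]) simp
    also have "\<dots> = (\<integral>\<^sup>+x. indicator (ball 0 1) x \<partial>\<mu>)"
      by (intro nn_integral_cong) (simp add: indicator_def)
    finally show "(\<integral>\<^sup>+x. indicator A y * indicator (ball 0 1) (y - x) \<partial>\<mu>) = indicator A y * emeasure \<mu> (ball 0 1)"
      by (simp add: nn_integral_cmult)
  qed
  also have "\<dots> = emeasure lborel A * emeasure lborel (ball (0::'a) 1)"
    by (simp add: nn_integral_multc ball)
  finally have "emeasure \<mu> A = emeasure lborel A"
    using emeasure_lborel_ball_finite[of "0::'a" 1] content_ball_pos[of 1 "0::'a"]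
      ennreal_mult_cancel_left[of "emeasure lborel (ball (0::'a) 1)" "emeasure \<mu> A" "emeasure lborel A"]
    by (auto simp: measure_def mult.commute)
  then show "emeasure (distr lborel borel f) A = emeasure lborel A" by (simp add: \<mu>_def)
qed simp

section \<open>The unit heat ball\<close>

text \<open>Obtained by solving \<open>heat_kernel y s > 1\<close> for |y|^2: the squared radius of
  the slice of the unit heat ball at depth s, where s runs backwards in time.\<close>

definition heat_radius_sq :: "real \<Rightarrow> real \<Rightarrow> real" where
  "heat_radius_sq N s = - 2 * N * s * ln (4 * pi * s)"

definition unit_heat_ball :: "((real ^ 'n) \<times> real) set" where
  "unit_heat_ball = {(y, s). 0 < s \<and> (norm y)\<^sup>2 < heat_radius_sq (real CARD('n)) s}"

lemma heat_radius_sq_pos_iff: "0 < N \<Longrightarrow> 0 < s \<Longrightarrow> 0 < heat_radius_sq N s \<longleftrightarrow> s < 1 / (4 * pi)"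
  by (auto simp: heat_radius_sq_def mult_less_0_iff ln_less_zero_iff field_simps)

lemma unit_heat_ball_time:
  assumes "(y, s) \<in> (unit_heat_ball :: ((real^'n) \<times> real) set)"
  shows "0 < s" "s < 1 / (4 * pi)" "s < 1"
proof -
  have "0 < s" "0 < heat_radius_sq (real CARD('n)) s"
    using assms le_less_trans[OF zero_le_power2[of "norm y"]] by (auto simp: unit_heat_ball_def)
  then show "0 < s" and *: "s < 1 / (4 * pi)" using heat_radius_sq_pos_iff[of "real CARD('n)" s] by auto
  have "1 < 4 * pi" using pi_gt3 by simp
  then have "1 / (4 * pi) < 1" by (subst divide_less_eq_1) auto
  with * show "s < 1" by (rule order.strict_trans)
qed

text \<open>\<open>ln x \<le> x - 1\<close> at x = 1 / (4 pi e s). Equality holds at x = 1, that is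
  at s = 1 / (4 pi e), so the bound is the maximal squared radius.\<close>

lemma heat_radius_sq_le:
  assumes "0 \<le> N" "0 < s"
  shows "heat_radius_sq N s \<le> N / (2 * pi * exp 1)"
proof -
  have "ln (1 / (4 * pi * s * exp 1)) \<le> 1 / (4 * pi * s * exp 1) - 1"
    using assms by (intro ln_le_minus_one) simp
  then have "- ln (4 * pi * s) \<le> 1 / (4 * pi * s * exp 1)"
    using assms by (simp add: ln_div ln_mult)
  then have "(2 * N * s) * (- ln (4 * pi * s)) \<le> (2 * N * s) * (1 / (4 * pi * s * exp 1))"
    using assms by (intro mult_left_mono) simp_all
  then show ?thesis using assms by (simp add: heat_radius_sq_def field_simps)
qed

lemma heat_radius_sq_max: "heat_radius_sq N (1 / (4 * pi * exp 1)) = N / (2 * pi * exp 1)"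
  by (simp add: heat_radius_sq_def ln_div field_simps)

lemma heat_radius_sq_le_dim:
  assumes "0 \<le> N" "0 < s"
  shows "heat_radius_sq N s \<le> N"
proof -
  have "1 \<le> 2 * pi * exp (1::real)"
    using pi_gt3 one_le_exp_iff[of 1] mult_mono[of 1 "2 * pi" 1 "exp (1::real)"] by simp
  then have "N / (2 * pi * exp 1) \<le> N / 1"
    using assms by (intro divide_left_mono) auto
  with heat_radius_sq_le[OF assms] show ?thesis by simp
qed

text \<open>Trades the logarithm for a quarter power of s. With exponent 3/4 the worst case N = 2,
  where R^(3/2) / s^2 must be integrable, still has room: 9/8 - 2 > -1.\<close>

lemma heat_radius_sq_le_powr:
  assumes "0 \<le> N" "0 < s"
  shows "heat_radius_sq N s \<le> 8 * N * s powr (3/4)"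
proof -
  have "ln ((4 * pi * s) powr (-1/4)) \<le> (4 * pi * s) powr (-1/4)"
    using assms by (intro ln_bound) simp
  then have "- ln (4 * pi * s) \<le> 4 * (4 * pi * s) powr (-1/4)"
    using assms by (simp add: ln_powr)
  also have "\<dots> \<le> 4 * s powr (-1/4)"
    using assms pi_gt3 by (intro mult_left_mono powr_mono2') auto
  finally have "(2 * N * s) * (- ln (4 * pi * s)) \<le> (2 * N * s) * (4 * s powr (-1/4))"
    using assms by (intro mult_left_mono) auto
  also have "\<dots> = 8 * N * (s powr 1 * s powr (-1/4))" using assms by simp
  also have "\<dots> = 8 * N * s powr (3/4)" by (subst powr_add[symmetric]) simp
  finally show ?thesis by (simp add: heat_radius_sq_def)
qed

lemma unit_heat_ball_norm:
  assumes "(y, s) \<in> (unit_heat_ball :: ((real^'n) \<times> real) set)"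
  shows "(norm y)\<^sup>2 \<le> real CARD('n)" "norm y \<le> real CARD('n)"
proof -
  show *: "(norm y)\<^sup>2 \<le> real CARD('n)"
    using assms heat_radius_sq_le_dim[of "real CARD('n)" s] by (auto simp: unit_heat_ball_def)
  have "1 \<le> real CARD('n)" using zero_less_card_finite[where 'a='n] by linarith
  then have "real CARD('n) \<le> (real CARD('n))\<^sup>2" by (simp add: power2_eq_square)
  with * show "norm y \<le> real CARD('n)"
    by (meson abs_le_square_iff of_nat_0_le_iff order_trans power2_le_imp_le)
qed

lemma open_unit_heat_ball: "open (unit_heat_ball :: ((real^'n) \<times> real) set)"
proof -
  let ?g = "\<lambda>w::(real^'n) \<times> real. heat_radius_sq (real CARD('n)) (snd w) - (norm (fst w))\<^sup>2"
  have "open ((UNIV \<times> {0<..}) \<inter> ?g -` {0<..})"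
    by (rule continuous_open_preimage)
       (auto simp: heat_radius_sq_def intro!: continuous_intros open_Times)
  also have "(UNIV \<times> {0<..}) \<inter> ?g -` {0<..} = unit_heat_ball"
    by (auto simp: unit_heat_ball_def)
  finally show ?thesis .
qed

lemma unit_heat_ball_borel [measurable]: "(unit_heat_ball :: ((real^'n) \<times> real) set) \<in> sets borel"
  by (rule borel_open[OF open_unit_heat_ball])

text \<open>A cylinder stretched slice by slice; connectedness of the ball is read off from this
  form.\<close>

lemma unit_heat_ball_image:
  "(unit_heat_ball :: ((real^'n) \<times> real) set) =
    (\<lambda>(y, s). (sqrt (heat_radius_sq (real CARD('n)) s) *\<^sub>R y, s)) ` (ball 0 1 \<times> {0<..<1 / (4 * pi)})"
    (is "_ = ?g ` ?S")
proof (intro equalityI subsetI)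
  fix w assume w: "w \<in> (unit_heat_ball :: ((real^'n) \<times> real) set)"
  obtain y s where ys: "w = (y, s)" by (cases w)
  define R where "R = sqrt (heat_radius_sq (real CARD('n)) s)"
  have s: "0 < s" "s < 1 / (4 * pi)" using unit_heat_ball_time w ys by blast+
  then have "0 < heat_radius_sq (real CARD('n)) s" using heat_radius_sq_pos_iff[of "real CARD('n)" s] by simp
  then have R: "0 < R" "(norm y)\<^sup>2 < R\<^sup>2"
    using w by (auto simp: R_def ys unit_heat_ball_def)
  then have "norm y < R" by (simp add: power2_less_imp_less)
  then have "(y /\<^sub>R R, s) \<in> ?S" using s R by (simp add: field_simps)
  moreover have "?g (y /\<^sub>R R, s) = w" using R by (simp add: ys R_def)
  ultimately show "w \<in> ?g ` ?S" by (metis (no_types, lifting) image_eqI)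
next
  fix w assume "w \<in> ?g ` ?S"
  then obtain v where v: "v \<in> ?S" "w = ?g v" by blast
  obtain y s where "v = (y, s)" by (cases v)
  with v have w: "w = (sqrt (heat_radius_sq (real CARD('n)) s) *\<^sub>R y, s)"
    and ys: "norm y < 1" "0 < s" "s < 1 / (4 * pi)" by auto
  have p: "0 < heat_radius_sq (real CARD('n)) s" using heat_radius_sq_pos_iff[of "real CARD('n)" s] ys by simp
  have "(norm y)\<^sup>2 < 1" using ys by (simp add: power_less_one_iff abs_square_less_1)
  then have "heat_radius_sq (real CARD('n)) s * (norm y)\<^sup>2 < heat_radius_sq (real CARD('n)) s * 1"
    using p by (intro mult_strict_left_mono)
  then show "w \<in> unit_heat_ball"
    using p ys by (simp add: w unit_heat_ball_def power_mult_distrib)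
qed

lemma connected_unit_heat_ball: "connected (unit_heat_ball :: ((real^'n) \<times> real) set)"
  unfolding unit_heat_ball_image
  by (intro connected_continuous_image)
     (auto simp: heat_radius_sq_def case_prod_beta intro!: continuous_intros connected_Times convex_connected)

lemma unit_heat_ball_nonempty: "((0::real^'n), 1 / (4 * pi * exp 1)) \<in> unit_heat_ball"
  by (simp add: unit_heat_ball_def heat_radius_sq_max)

text \<open>Parabolic scaling. After taking logarithms both sides contain - N ln \<epsilon>, which
  cancels, and the rotation enters only through preserving the norm.\<close>

lemma heat_ball_iff:
  fixes f :: "real^'n \<Rightarrow> real^'n"
  assumes e: "0 < \<epsilon>" and f: "orthogonal_transformation f"
  shows "(x + \<epsilon> *\<^sub>R f y, t - \<epsilon>\<^sup>2 * s) \<in> heat_ball \<epsilon> (x, t) \<longleftrightarrow> (y, s) \<in> unit_heat_ball"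
proof (cases "0 < s")
  case True
  let ?N = "real CARD('n)"
  have [simp]: "norm (f y) = norm y" using f by (simp add: orthogonal_transformation_norm)
  have pos: "0 < heat_kernel (- (\<epsilon> *\<^sub>R f y)) (\<epsilon>\<^sup>2 * s)"
    using e True by (simp add: heat_kernel_def)
  have "ln (heat_kernel (- (\<epsilon> *\<^sub>R f y)) (\<epsilon>\<^sup>2 * s)) =
    - ?N / 2 * ln (4 * pi * (\<epsilon>\<^sup>2 * s)) - (norm y)\<^sup>2 / (4 * s)"
    using e True by (simp add: heat_kernel_def ln_mult ln_powr power_mult_distrib)
  also have "ln (4 * pi * (\<epsilon>\<^sup>2 * s)) = 2 * ln \<epsilon> + ln (4 * pi * s)"
    using e True by (simp add: ln_mult ln_realpow)
  finally have l: "ln (heat_kernel (- (\<epsilon> *\<^sub>R f y)) (\<epsilon>\<^sup>2 * s)) =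
    - ?N * ln \<epsilon> - ?N / 2 * ln (4 * pi * s) - (norm y)\<^sup>2 / (4 * s)"
    by (simp add: algebra_simps)
  have "heat_kernel (- (\<epsilon> *\<^sub>R f y)) (\<epsilon>\<^sup>2 * s) > \<epsilon> powr (- ?N) \<longleftrightarrow>
    ln (\<epsilon> powr (- ?N)) < ln (heat_kernel (- (\<epsilon> *\<^sub>R f y)) (\<epsilon>\<^sup>2 * s))"
    using e pos by (intro ln_less_cancel_iff[symmetric]) auto
  also have "\<dots> \<longleftrightarrow> (norm y)\<^sup>2 / (4 * s) < - (?N / 2 * ln (4 * pi * s))"
    using e by (auto simp: l ln_powr)
  also have "\<dots> \<longleftrightarrow> (norm y)\<^sup>2 < heat_radius_sq ?N s"
    using True by (simp add: heat_radius_sq_def field_simps)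
  finally show ?thesis using e True by (simp add: heat_ball_def unit_heat_ball_def)
next
  case False
  then show ?thesis using e by (auto simp: heat_ball_def unit_heat_ball_def zero_less_mult_iff)
qed

lemma heat_ball_image:
  fixes f :: "real^'n \<Rightarrow> real^'n"
  assumes e: "0 < \<epsilon>" and f: "orthogonal_transformation f"
  shows "heat_ball \<epsilon> (x, t) = (\<lambda>(y, s). (x + \<epsilon> *\<^sub>R f y, t - \<epsilon>\<^sup>2 * s)) ` unit_heat_ball"
proof (intro equalityI subsetI)
  fix w assume w: "w \<in> heat_ball \<epsilon> (x, t)"
  obtain z r where zr: "w = (z, r)" by (cases w)
  obtain y where y: "f y = (z - x) /\<^sub>R \<epsilon>"
    using orthogonal_transformation_surj[OF f] by (metis surjD)
  define s where "s = (t - r) / \<epsilon>\<^sup>2"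
  have eq: "w = (x + \<epsilon> *\<^sub>R f y, t - \<epsilon>\<^sup>2 * s)" using e by (simp add: y zr s_def)
  then have "(y, s) \<in> unit_heat_ball" using w heat_ball_iff[OF e f, of x y t s] by simp
  then show "w \<in> (\<lambda>(y, s). (x + \<epsilon> *\<^sub>R f y, t - \<epsilon>\<^sup>2 * s)) ` unit_heat_ball"
    by (intro image_eqI[where x="(y, s)"]) (simp_all add: eq)
qed (use heat_ball_iff[OF e f] in auto)

section \<open>Means in \<open>L\<^sup>p\<close>\<close>

text \<open>Up to the factor r + 1 the derivative of |a|^(r+1), hence with r = q - 1 the first
  variation of the \<open>q\<close>-th power deviation. For r = 0 it is \<open>sgn\<close>.\<close>

definition signed_powr :: "real \<Rightarrow> real \<Rightarrow> real" where
  "signed_powr r a = sgn a * \<bar>a\<bar> powr r"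

lemma signed_powr_measurable [measurable]: "signed_powr r \<in> borel_measurable borel"
  unfolding signed_powr_def[abs_def] by measurable

lemma signed_powr_minus: "signed_powr r (- a) = - signed_powr r a"
  by (simp add: signed_powr_def sgn_minus)

lemma abs_signed_powr: "\<bar>signed_powr r a\<bar> = \<bar>a\<bar> powr r"
  by (auto simp: signed_powr_def abs_mult abs_sgn_eq)

text \<open>Convexity of the power on the closed half-line. At x = 0 the convention
  \<open>0 powr 0 = 0\<close> makes the slope term vanish even for q = 1.\<close>

lemma powr_above_tangent:
  fixes x y q :: real
  assumes "0 \<le> x" "0 \<le> y" "1 \<le> q"
  shows "x powr q + q * x powr (q - 1) * (y - x) \<le> y powr q"
proof (cases "x = 0")
  case False
  then have x: "0 < x" using assms by simp
  show ?thesis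
  proof (cases "y = 0")
    case True
    have "x powr q = x powr (q - 1) * x" using x by (simp add: powr_diff)
    then have "q * x powr (q - 1) * (0 - x) \<le> - 1 * x powr q"
      using assms mult_right_mono[of 1 q "x powr (q - 1) * x"] by (simp add: mult.assoc)
    then show ?thesis using True x assms by simp
  next
    case False
    then have y: "0 < y" using assms by simp
    have "(q * x powr (q - 1)) * (y - x) \<le> y powr q - x powr q"
    proof (rule convex_on_imp_above_tangent[where A = "{0<..}"])
      show "convex_on {0<..} (\<lambda>x. x powr q)" using assms by (intro powr_convex)
      show "((\<lambda>x. x powr q) has_field_derivative q * x powr (q - 1)) (at x within {0<..})"
        using x by (auto intro!: derivative_eq_intros simp: powr_diff)
      show "connected ({0<..} :: real set)" by (simp add: is_interval_connected)
    qed (use x y in \<open>auto simp: interior_open\<close>)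
    then show ?thesis by simp
  qed
qed (use assms in simp)

text \<open>The subgradient inequality, with no exception at a = 0 and q = 1, where
  \<open>signed_powr\<close> selects the subgradient 0. It lets the median run parallel to the case
  q > 1.\<close>

lemma abs_powr_above_tangent:
  fixes a d q :: real
  assumes "1 \<le> q"
  shows "\<bar>a\<bar> powr q + q * signed_powr (q - 1) a * d \<le> \<bar>a + d\<bar> powr q"
proof (cases "a = 0")
  case False
  have "sgn a * d \<le> \<bar>a + d\<bar> - \<bar>a\<bar>" by (auto simp: sgn_if abs_if)
  then have "q * \<bar>a\<bar> powr (q - 1) * (sgn a * d) \<le> q * \<bar>a\<bar> powr (q - 1) * (\<bar>a + d\<bar> - \<bar>a\<bar>)"
    using assms by (intro mult_left_mono) auto
  moreover have "q * signed_powr (q - 1) a * d = q * \<bar>a\<bar> powr (q - 1) * (sgn a * d)"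
    by (simp add: signed_powr_def)
  ultimately show ?thesis using powr_above_tangent[of "\<bar>a\<bar>" "\<bar>a + d\<bar>" q] assms by linarith
qed (simp add: signed_powr_def)

text \<open>Tangents at the midpoint, evaluated at a and at b: the linear terms cancel in the
  sum.\<close>

lemma abs_powr_midpoint:
  fixes a b q :: real
  assumes "1 \<le> q"
  shows "\<bar>(a + b) / 2\<bar> powr q \<le> (\<bar>a\<bar> powr q + \<bar>b\<bar> powr q) / 2"
proof -
  let ?c = "(a + b) / 2"
  have "?c + (a - b) / 2 = a" "?c + (b - a) / 2 = b" by (simp_all add: field_simps)
  with abs_powr_above_tangent[OF assms, of ?c "(a - b) / 2"]
       abs_powr_above_tangent[OF assms, of ?c "(b - a) / 2"]
  have "2 * \<bar>?c\<bar> powr q + q * signed_powr (q - 1) ?c * ((a - b) / 2 + (b - a) / 2) \<le> \<bar>a\<bar> powr q + \<bar>b\<bar> powr q"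
    by (simp only: distrib_left)
  then show ?thesis by (simp add: field_simps)
qed

definition Lp_mean :: "'a measure \<Rightarrow> ereal \<Rightarrow> ('a \<Rightarrow> real) \<Rightarrow> real" where
  "Lp_mean M p f = (THE m. \<forall>l. Lp_norm M p (\<lambda>w. f w - m) \<le> Lp_norm M p (\<lambda>w. f w - l))"

text \<open>The assumption \<open>unsplit\<close> is what makes medians unique; it holds when \<open>f\<close> is continuous on
  a connected set all of whose open subsets are charged by \<open>M\<close>.\<close>

locale unsplit_function = finite_measure M for M :: "'a measure" +
  fixes f :: "'a \<Rightarrow> real" and B q :: real
  assumes nonnull: "emeasure M (space M) \<noteq> 0"
    and f_measurable [measurable]: "f \<in> borel_measurable M"
    and f_bounded: "\<And>x. x \<in> space M \<Longrightarrow> \<bar>f x\<bar> \<le> B"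
    and unsplit: "\<And>a b. a < b \<Longrightarrow>
      (AE x in M. f x \<le> a) \<or> (AE x in M. b \<le> f x) \<or> \<not> (AE x in M. \<not> (a < f x \<and> f x < b))"
    and q: "1 \<le> q"
begin

definition deviation :: "real \<Rightarrow> real" where
  "deviation m = (\<integral>x. \<bar>f x - m\<bar> powr q \<partial>M)"

lemma deviation_integrable: "integrable M (\<lambda>x. \<bar>f x - m\<bar> powr q)"
proof (rule integrable_const_bound[where B="(B + \<bar>m\<bar>) powr q"])
  show "AE x in M. norm (\<bar>f x - m\<bar> powr q) \<le> (B + \<bar>m\<bar>) powr q"
  proof (rule AE_I2)
    fix x assume "x \<in> space M"
    then have "\<bar>f x - m\<bar> \<le> B + \<bar>m\<bar>" using f_bounded[of x] by linarith
    then show "norm (\<bar>f x - m\<bar> powr q) \<le> (B + \<bar>m\<bar>) powr q"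
      using q by (simp add: powr_mono2)
  qed
qed measurable

lemma signed_integrable: "integrable M (\<lambda>x. signed_powr (q - 1) (f x - m))"
proof (rule integrable_const_bound[where B="(B + \<bar>m\<bar>) powr (q - 1)"])
  show "AE x in M. norm (signed_powr (q - 1) (f x - m)) \<le> (B + \<bar>m\<bar>) powr (q - 1)"
  proof (rule AE_I2)
    fix x assume "x \<in> space M"
    then have "\<bar>f x - m\<bar> \<le> B + \<bar>m\<bar>" using f_bounded[of x] by linarith
    then show "norm (signed_powr (q - 1) (f x - m)) \<le> (B + \<bar>m\<bar>) powr (q - 1)"
      using q by (simp add: abs_signed_powr powr_mono2)
  qed
qed measurable

lemma AE_nonempty: "AE x in M. P x \<Longrightarrow> \<exists>x\<in>space M. P x"
proof (rule ccontr)
  assume P: "AE x in M. P x" "\<not> (\<exists>x\<in>space M. P x)"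
  have "AE x in M. False"
    using P(1) AE_space by eventually_elim (use P(2) in auto)
  then show False using nonnull ae_filter_eq_bot_iff[of M] by (simp add: eventually_False)
qed

lemma B_nonneg: "0 \<le> B"
proof -
  obtain x where "x \<in> space M" using AE_nonempty[of "\<lambda>_. True"] by auto
  then show ?thesis using f_bounded[of x] by linarith
qed

lemma deviation_continuous: "continuous_on UNIV deviation"
proof (rule continuous_at_imp_continuous_on, intro ballI, unfold continuous_at_sequentially comp_def, intro allI impI)
  fix m :: real and X assume X: "X \<longlonglongrightarrow> m"
  then obtain C where C: "\<And>n. \<bar>X n\<bar> \<le> C"
    using convergent_imp_Bseq[of X] unfolding convergent_def Bseq_def by auto
  show "(\<lambda>n. deviation (X n)) \<longlonglongrightarrow> deviation m"
    unfolding deviation_def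
  proof (rule integral_dominated_convergence[where w="\<lambda>_. (B + C) powr q"])
    show "AE x in M. (\<lambda>n. \<bar>f x - X n\<bar> powr q) \<longlonglongrightarrow> \<bar>f x - m\<bar> powr q"
      using q X by (intro AE_I2 tendsto_powr' tendsto_intros) auto
    show "AE x in M. norm (\<bar>f x - X n\<bar> powr q) \<le> (B + C) powr q" for n
    proof (rule AE_I2)
      fix x assume "x \<in> space M"
      then have "\<bar>f x - X n\<bar> \<le> B + C" using f_bounded[of x] C[of n] by linarith
      then show "norm (\<bar>f x - X n\<bar> powr q) \<le> (B + C) powr q"
        using q by (simp add: powr_mono2)
    qed
  qed (auto)
qed

text \<open>The subgradient inequality with increment m - l, integrated. The sign of the signed
  integral at m thus decides on which side of m the deviation can be smaller.\<close>

lemma deviation_tangent: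
  "deviation m + q * (\<integral>x. signed_powr (q - 1) (f x - m) \<partial>M) * (m - l) \<le> deviation l"
proof -
  have "deviation m + q * (\<integral>x. signed_powr (q - 1) (f x - m) \<partial>M) * (m - l) =
    (\<integral>x. \<bar>f x - m\<bar> powr q + q * signed_powr (q - 1) (f x - m) * (m - l) \<partial>M)"
    using deviation_integrable[of m] signed_integrable[of m] by (simp add: deviation_def)
  also have "\<dots> \<le> deviation l"
    unfolding deviation_def
  proof (rule integral_mono)
    fix x
    show "\<bar>f x - m\<bar> powr q + q * signed_powr (q - 1) (f x - m) * (m - l) \<le> \<bar>f x - l\<bar> powr q"
      using abs_powr_above_tangent[OF q, of "f x - m" "m - l"] by simp
  qed (use deviation_integrable[of m] signed_integrable[of m] deviation_integrable[of l] in auto)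
  finally show ?thesis .
qed

text \<open>Every value of \<open>f\<close> lies in [-B, B], and projecting m to that interval
  brings it no farther from any of them. A minimum over the compact interval is therefore
  global.\<close>

lemma deviation_clamp:
  "deviation (max (- B) (min B m)) \<le> deviation m"
  unfolding deviation_def
proof (rule integral_mono[OF deviation_integrable deviation_integrable])
  fix x assume "x \<in> space M"
  then have "\<bar>f x - max (- B) (min B m)\<bar> \<le> \<bar>f x - m\<bar>"
    using f_bounded[of x] B_nonneg by (auto simp: max_def min_def)
  then show "\<bar>f x - max (- B) (min B m)\<bar> powr q \<le> \<bar>f x - m\<bar> powr q"
    using q by (simp add: powr_mono2)
qed

lemma minimizer_exists: "\<exists>m. \<forall>l. deviation m \<le> deviation l"
proof -
  have "\<exists>m\<in>{-B..B}. \<forall>l\<in>{-B..B}. deviation m \<le> deviation l"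
    using B_nonneg by (intro continuous_attains_inf continuous_on_subset[OF deviation_continuous]) auto
  then obtain m where m: "\<And>l. l \<in> {-B..B} \<Longrightarrow> deviation m \<le> deviation l" by blast
  have "deviation m \<le> deviation l" for l
    using m[of "max (- B) (min B l)"] deviation_clamp[of l] B_nonneg by auto
  then show ?thesis by blast
qed

text \<open>If \<open>f\<close> stays a.e. on one side of (a, b), the integrand at the far end a.e.
  exceeds the one at the near end, so the two deviations would differ.\<close>

lemma minimizer_not_AE_outside:
  assumes ab: "a < b" and eq: "deviation a = deviation b"
  shows "\<not> (AE x in M. f x \<le> a)" "\<not> (AE x in M. b \<le> f x)"
proof -
  have *: "(\<integral>x. \<bar>f x - b\<bar> powr q - \<bar>f x - a\<bar> powr q \<partial>M) = 0"
    using eq deviation_integrable by (simp add: deviation_def)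
  have i: "integrable M (\<lambda>x. \<bar>f x - b\<bar> powr q - \<bar>f x - a\<bar> powr q)"
    using deviation_integrable by auto
  show "\<not> (AE x in M. f x \<le> a)"
  proof
    assume le: "AE x in M. f x \<le> a"
    have s: "\<bar>y - a\<bar> powr q < \<bar>y - b\<bar> powr q" if "y \<le> a" for y
      using that ab q by (intro powr_less_mono2) auto
    have "AE x in M. \<bar>f x - b\<bar> powr q - \<bar>f x - a\<bar> powr q = 0"
      using * by (subst integral_nonneg_eq_0_iff_AE[symmetric, OF i])
        (use le s in \<open>auto elim!: eventually_mono dest!: s less_imp_le\<close>)
    with le have "AE x in M. False" by eventually_elim (use s in fastforce)
    then show False using AE_nonempty by blast
  qed
  have *: "(\<integral>x. \<bar>f x - a\<bar> powr q - \<bar>f x - b\<bar> powr q \<partial>M) = 0"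
    using eq deviation_integrable by (simp add: deviation_def)
  have i: "integrable M (\<lambda>x. \<bar>f x - a\<bar> powr q - \<bar>f x - b\<bar> powr q)"
    using deviation_integrable by auto
  show "\<not> (AE x in M. b \<le> f x)"
  proof
    assume le: "AE x in M. b \<le> f x"
    have s: "\<bar>y - b\<bar> powr q < \<bar>y - a\<bar> powr q" if "b \<le> y" for y
      using that ab q by (intro powr_less_mono2) auto
    have "AE x in M. \<bar>f x - a\<bar> powr q - \<bar>f x - b\<bar> powr q = 0"
      using * by (subst integral_nonneg_eq_0_iff_AE[symmetric, OF i])
        (use le s in \<open>auto elim!: eventually_mono dest!: s less_imp_le\<close>)
    with le have "AE x in M. False" by eventually_elim (use s in fastforce)
    then show False using AE_nonempty by blast
  qed
qed

text \<open>For q = 1 there is no strict convexity. If a < b both minimise, then so does the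
  midpoint, and the midpoint inequality is an equality a.e.; it is strict wherever a < f < b. So
  \<open>f\<close> avoids this interval a.e., which \<open>unsplit\<close> permits only if
  \<open>f\<close> stays on one side of it.\<close>

lemma minimizer_unique:
  assumes a: "\<And>l. deviation a \<le> deviation l" and b: "\<And>l. deviation b \<le> deviation l"
  shows "a = b"
proof -
  have *: False if ab: "a < b" and a: "\<And>l. deviation a \<le> deviation l" and b: "\<And>l. deviation b \<le> deviation l" for a b
  proof -
    let ?c = "(a + b) / 2"
    let ?h = "\<lambda>x. (\<bar>f x - a\<bar> powr q + \<bar>f x - b\<bar> powr q) / 2 - \<bar>f x - ?c\<bar> powr q"
    have eq: "deviation a = deviation b" using a[of b] b[of a] by simp
    have i: "integrable M ?h" using deviation_integrable by auto
    have h0: "0 \<le> ?h x" for x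
      using abs_powr_midpoint[OF q, of "f x - a" "f x - b"] by (simp add: field_simps)
    have "(\<integral>x. ?h x \<partial>M) = (deviation a + deviation b) / 2 - deviation ?c"
      using deviation_integrable by (simp add: deviation_def)
    also have "\<dots> \<le> 0" using a[of ?c] eq by simp
    finally have "(\<integral>x. ?h x \<partial>M) = 0"
      using integral_nonneg_AE[of ?h M] h0 by (intro antisym) auto
    then have "AE x in M. ?h x = 0"
      using h0 integral_nonneg_eq_0_iff_AE[OF i] by auto
    moreover have "\<not> (a < f x \<and> f x < b)" if "?h x = 0" for x
    proof
      assume x: "a < f x \<and> f x < b"
      \<comment> \<open>Between a and b the two distances average to (b - a) / 2, while the distance
        to the midpoint is smaller; this gives strictness even when q = 1.\<close>
      have "\<bar>f x - ?c\<bar> < (b - a) / 2" using x by (auto simp: abs_less_iff field_simps)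
      then have "\<bar>f x - ?c\<bar> powr q < ((b - a) / 2) powr q"
        using q by (intro powr_less_mono2) auto
      also have "\<dots> = \<bar>((f x - a) + (b - f x)) / 2\<bar> powr q" using ab by simp
      also have "\<dots> \<le> (\<bar>f x - a\<bar> powr q + \<bar>b - f x\<bar> powr q) / 2"
        by (rule abs_powr_midpoint[OF q])
      finally show False using that by (simp add: abs_minus_commute)
    qed
    ultimately have "AE x in M. \<not> (a < f x \<and> f x < b)" by (auto elim!: eventually_mono)
    with unsplit[OF ab] minimizer_not_AE_outside[OF ab eq] show False by blast
  qed
  show ?thesis using *[of a b] *[of b a] a b by (meson linorder_less_linear)
qed

lemma Lp_norm_le_iff:
  "Lp_norm M (ereal q) (\<lambda>w. f w - m) \<le> Lp_norm M (ereal q) (\<lambda>w. f w - l) \<longleftrightarrow> deviation m \<le> deviation l"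
proof -
  have nn: "(\<integral>\<^sup>+ z. ennreal (\<bar>f z - m\<bar> powr q) \<partial>M) = ennreal (deviation m)" for m
    unfolding deviation_def by (rule nn_integral_eq_integral[OF deviation_integrable]) auto
  have d0: "0 \<le> deviation m" for m by (simp add: deviation_def)
  have "Lp_norm M (ereal q) (\<lambda>w. f w - m) = ennreal (deviation m powr (1 / q))" for m
    by (simp add: Lp_norm_def nn d0 Let_def)
  moreover have "deviation m powr (1 / q) \<le> deviation l powr (1 / q) \<longleftrightarrow> deviation m \<le> deviation l"
  proof
    assume *: "deviation m powr (1 / q) \<le> deviation l powr (1 / q)"
    show "deviation m \<le> deviation l"
    proof (rule ccontr)
      assume "\<not> deviation m \<le> deviation l"
      then have "deviation l powr (1 / q) < deviation m powr (1 / q)"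
        using d0 q by (intro powr_less_mono2) auto
      with * show False by simp
    qed
  qed (use d0 q in \<open>auto intro!: powr_mono2\<close>)
  ultimately show ?thesis by (simp add: ennreal_le_iff)
qed

lemma deviation_Lp_mean: "deviation (Lp_mean M (ereal q) f) \<le> deviation l"
proof -
  obtain m where m: "\<And>l. deviation m \<le> deviation l" using minimizer_exists by blast
  have "Lp_mean M (ereal q) f = m"
    unfolding Lp_mean_def Lp_norm_le_iff
    by (rule the_equality) (use m minimizer_unique in auto)
  then show ?thesis using m by simp
qed

text \<open>By \<open>deviation_tangent\<close> every l > m then has a larger deviation than m, so
  none of them is the minimiser.\<close>

lemma Lp_mean_le:
  assumes "(\<integral>x. signed_powr (q - 1) (f x - m) \<partial>M) < 0"
  shows "Lp_mean M (ereal q) f \<le> m"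
proof (rule ccontr)
  let ?l = "Lp_mean M (ereal q) f"
  assume "\<not> ?l \<le> m"
  then have "0 < q * ((\<integral>x. signed_powr (q - 1) (f x - m) \<partial>M) * (m - ?l))"
    using assms q by (intro mult_pos_pos mult_neg_neg) auto
  then show False using deviation_tangent[of m ?l] deviation_Lp_mean[of m] by (simp add: mult.assoc)
qed

lemma Lp_mean_ge:
  assumes "(\<integral>x. signed_powr (q - 1) (f x - m) \<partial>M) > 0"
  shows "m \<le> Lp_mean M (ereal q) f"
proof (rule ccontr)
  let ?l = "Lp_mean M (ereal q) f"
  assume "\<not> m \<le> ?l"
  then have "0 < q * ((\<integral>x. signed_powr (q - 1) (f x - m) \<partial>M) * (m - ?l))"
    using assms q by (intro mult_pos_pos) auto
  then show False using deviation_tangent[of m ?l] deviation_Lp_mean[of m] by (simp add: mult.assoc)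
qed

end

section \<open>The heat weight\<close>

definition heat_weight :: "(real ^ 'n) \<times> real \<Rightarrow> real" where
  "heat_weight w = indicator unit_heat_ball w * ((norm (fst w))\<^sup>2 / (snd w)\<^sup>2)"

text \<open>Here |y|^2 is replaced by its supremum over the time slice. On the ball the value
  depends on time alone, so it can only increase when a coordinate is set to 0;
  \<open>heat_weight\<close> itself lacks this monotonicity.\<close>

definition heat_majorant :: "(real ^ 'n) \<times> real \<Rightarrow> real" where
  "heat_majorant w = indicator unit_heat_ball w * (heat_radius_sq (real CARD('n)) (snd w) / (snd w)\<^sup>2)"

definition drop_coord :: "'n \<Rightarrow> real ^ 'n \<Rightarrow> real ^ 'n" where
  "drop_coord k y = y - (y $ k) *\<^sub>R axis k 1"

lemma drop_coord_nth [simp]: "drop_coord k y $ i = (if i = k then 0 else y $ i)"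
  by (simp add: drop_coord_def axis_def)

lemma norm_sq_cart: "(norm (y::real^'n))\<^sup>2 = (\<Sum>i\<in>UNIV. (y $ i)\<^sup>2)"
  by (simp add: norm_vec_def L2_set_def sum_nonneg)

lemma norm_drop_coord: "(norm y)\<^sup>2 = (norm (drop_coord k y))\<^sup>2 + (y $ k)\<^sup>2"
proof -
  have "(norm y)\<^sup>2 = (\<Sum>i\<in>UNIV. (drop_coord k y $ i)\<^sup>2 + (if i = k then (y $ k)\<^sup>2 else 0))"
    unfolding norm_sq_cart by (intro sum.cong) auto
  then show ?thesis by (simp add: sum.distrib norm_sq_cart)
qed

lemma drop_coord_unit_heat_ball: "(y, s) \<in> unit_heat_ball \<Longrightarrow> (drop_coord k y, s) \<in> unit_heat_ball"
  using norm_drop_coord[of y k] by (auto simp: unit_heat_ball_def intro: le_less_trans[rotated])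

lemma fst_nth_measurable [measurable]: "(\<lambda>w::(real^'n) \<times> real. fst w $ k) \<in> borel_measurable borel"
  by (intro borel_measurable_continuous_onI continuous_intros)

lemma nth_measurable [measurable]: "(\<lambda>y::real^'n. y $ k) \<in> borel_measurable borel"
  by (intro borel_measurable_continuous_onI continuous_intros)

lemma drop_coord_measurable [measurable]: "drop_coord k \<in> borel_measurable borel"
  unfolding drop_coord_def[abs_def] by (intro borel_measurable_continuous_onI continuous_intros)

lemma fst_borel [measurable]: "(fst :: (real^'n) \<times> real \<Rightarrow> _) \<in> borel_measurable borel"
  and snd_borel [measurable]: "(snd :: (real^'n) \<times> real \<Rightarrow> _) \<in> borel_measurable borel"
  by (intro borel_measurable_continuous_onI continuous_intros)+

lemma heat_weight_measurable [measurable]: "(heat_weight :: (real^'n) \<times> real \<Rightarrow> real) \<in> borel_measurable borel"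
  unfolding heat_weight_def[abs_def] by measurable

lemma heat_majorant_measurable [measurable]: "(heat_majorant :: (real^'n) \<times> real \<Rightarrow> real) \<in> borel_measurable borel"
  unfolding heat_majorant_def[abs_def] heat_radius_sq_def by measurable

lemma heat_weight_bounds: "0 \<le> heat_weight w" "heat_weight w \<le> heat_majorant w"
  by (cases w; auto simp: heat_weight_def heat_majorant_def unit_heat_ball_def indicator_def
        intro!: divide_right_mono)+

lemma heat_majorant_nonneg: "0 \<le> heat_majorant w"
  using heat_weight_bounds[of w] by linarith

lemma heat_majorant_drop_coord: "heat_majorant (y, s) \<le> heat_majorant (drop_coord k y, s)"
  using heat_majorant_nonneg[of "(drop_coord k y, s)"] drop_coord_unit_heat_ball[of y s k]
  by (auto simp: heat_majorant_def indicator_def)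

section \<open>Integrability of the heat majorant against singular weights in one coordinate\<close>

lemma integrable_powr_from_0:
  fixes a c :: real
  assumes "- 1 < a" "0 \<le> c"
  shows "integrable lborel (\<lambda>x. indicator {0..c} x * x powr a)"
proof -
  have "(\<lambda>x. x powr a) absolutely_integrable_on {0..c}"
    using integrable_on_powr_from_0[OF assms]
    by (intro nonnegative_absolutely_integrable_1) auto
  then have "integrable lebesgue (\<lambda>x. indicator {0..c} x * x powr a)"
    by (simp add: set_integrable_def)
  then show ?thesis by (subst (asm) integrable_completion) auto
qed

lemma integrable_abs_powr:
  fixes a c :: real
  assumes "- 1 < a" "0 \<le> c"
  shows "integrable lborel (\<lambda>x. indicator {- c..c} x * \<bar>x\<bar> powr a)"
proof -
  let ?f = "\<lambda>x::real. indicator {0..c} x * x powr a"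
  have i: "integrable lborel ?f" by (rule integrable_powr_from_0[OF assms])
  then have "integrable lborel (\<lambda>x. ?f (0 + (- 1) * x))"
    by (rule lborel_integrable_real_affine) simp
  with i have "integrable lborel (\<lambda>x. ?f x + ?f (0 + (- 1) * x))" by (rule Bochner_Integration.integrable_add)
  then show ?thesis
    by (rule Bochner_Integration.integrable_bound) (auto simp: indicator_def)
qed

text \<open>Enclosure in a box of side 1 along the k-th axis and 2 r along the others.\<close>

lemma emeasure_slab_le:
  fixes k :: "'n::finite"
  assumes "0 \<le> r"
  shows "emeasure lborel {y::real^'n. y $ k \<in> {0..1} \<and> norm (drop_coord k y) \<le> r} \<le> ennreal ((2 * r) ^ (CARD('n) - 1))"
proof -
  define a b :: "real^'n" where "a = (\<chi> i. if i = k then 0 else - r)" and "b = (\<chi> i. if i = k then 1 else r)"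
  have sub: "{y. y $ k \<in> {0..1} \<and> norm (drop_coord k y) \<le> r} \<subseteq> cbox a b"
  proof
    fix y assume y: "y \<in> {y. y $ k \<in> {0..1} \<and> norm (drop_coord k y) \<le> r}"
    have "\<bar>y $ i\<bar> \<le> r" if "i \<noteq> k" for i
      using component_le_norm_cart[of "drop_coord k y" i] y that by simp
    then show "y \<in> cbox a b" using y by (auto simp: mem_box_cart a_def b_def abs_le_iff minus_le_iff)
  qed
  have "measure lborel (cbox a b) = (\<Prod>i\<in>UNIV. b $ i - a $ i)"
    using assms by (intro content_cbox_cart) (auto simp: interval_ne_empty_cart a_def b_def)
  also have "\<dots> = (\<Prod>i\<in>UNIV - {k}. 2 * r)"
    by (subst prod.remove[of _ k]) (auto simp: a_def b_def intro!: prod.cong)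
  finally have "measure lborel (cbox a b) = (2 * r) ^ (CARD('n) - 1)" by (simp add: card_Diff_singleton)
  then have "emeasure lborel (cbox a b) = ennreal ((2 * r) ^ (CARD('n) - 1))"
    using emeasure_eq_ennreal_measure[of lborel "cbox a b"] emeasure_lborel_cbox_finite[of a b] by auto
  then show ?thesis using emeasure_mono[OF sub, of lborel] by simp
qed

text \<open>The dimension enters here. A slice of radius r = sqrt R contributes at most R / s^2
  times (2 r)^(N-1), and N \<ge> 2 provides at least one factor r; the resulting R^(3/2) / s^2 is
  bounded by a multiple of s^(-7/8).\<close>

lemma heat_majorant_slab_finite:
  fixes k :: "'n::finite"
  assumes N: "CARD('n) \<ge> 2"
  shows "(\<integral>\<^sup>+w. ennreal (indicator {0..1} (fst w $ k) * heat_majorant (drop_coord k (fst w), snd w)) \<partial>lborel) < \<infinity>"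
proof -
  let ?N = "real CARD('n)"
  let ?m = "CARD('n) - 2"
  \<comment> \<open>The factors 2 and (2 N)^(N-2) come from (2 r)^(N-1) with N - 2 of the radii
    bounded by N, and (8 N)^(3/2) comes from \<open>heat_radius_sq_le_powr\<close>.\<close>
  define C where "C = 2 * (8 * ?N) powr (3/2) * (2 * ?N) ^ ?m"
  have C0: "0 \<le> C" by (simp add: C_def)
  have inner: "(\<integral>\<^sup>+y. ennreal (indicator {0..1} (y $ k) * heat_majorant (drop_coord k y, s)) \<partial>lborel)
      \<le> ennreal (C * (indicator {0..1} s * s powr (-7/8)))" for s
  proof (cases "0 < s \<and> s < 1 / (4 * pi)")
    case False
    then have "(y, s) \<notin> unit_heat_ball" for y :: "real^'n" using unit_heat_ball_time by blast
    then show ?thesis by (simp add: heat_majorant_def)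
  next
    case True
    define R where "R = heat_radius_sq ?N s"
    define r where "r = sqrt R"
    have "0 < R" using heat_radius_sq_pos_iff[of ?N s] True by (simp add: R_def)
    then have r: "0 < r" "r\<^sup>2 = R" "r = R powr (1/2)" by (simp_all add: r_def powr_half_sqrt)
    have RN: "R \<le> ?N" using True by (auto simp: R_def intro!: heat_radius_sq_le_dim)
    have "1 \<le> ?N" using N by simp
    then have "?N \<le> ?N\<^sup>2" by (simp add: power2_eq_square)
    then have "r\<^sup>2 \<le> ?N\<^sup>2" using RN unfolding r(2) by linarith
    then have rN: "r \<le> ?N" by (rule power2_le_imp_le) simp
    have "1 < 4 * pi" using pi_gt3 by simp
    then have "1 / (4 * pi) < 1" by (subst divide_less_eq_1) auto
    then have s1: "s < 1" using True by linarith
    have "ennreal (indicator {0..1} (y $ k) * heat_majorant (drop_coord k y, s))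
      \<le> ennreal (R / s\<^sup>2) * indicator {y. y $ k \<in> {0..1} \<and> norm (drop_coord k y) \<le> r} y" for y :: "real^'n"
    proof (cases "y $ k \<in> {0..1} \<and> (drop_coord k y, s) \<in> unit_heat_ball")
      case True
      then have "(norm (drop_coord k y))\<^sup>2 \<le> r\<^sup>2" by (simp add: unit_heat_ball_def R_def r(2))
      then have "norm (drop_coord k y) \<le> r" by (rule power2_le_imp_le) (use r(1) in simp)
      then show ?thesis using True by (simp add: heat_majorant_def R_def)
    next
      case False
      then have "indicator {0..1} (y $ k) * heat_majorant (drop_coord k y, s) = 0"
        by (auto simp: heat_majorant_def indicator_def)
      then show ?thesis by (simp only: ennreal_0 zero_le)
    qed
    then have "(\<integral>\<^sup>+y. ennreal (indicator {0..1} (y $ k) * heat_majorant (drop_coord k y, s)) \<partial>lborel)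
      \<le> (\<integral>\<^sup>+y. ennreal (R / s\<^sup>2) * indicator {y. y $ k \<in> {0..1} \<and> norm (drop_coord k y) \<le> r} y \<partial>lborel)"
      by (intro nn_integral_mono)
    also have "\<dots> = ennreal (R / s\<^sup>2) * emeasure lborel {y::real^'n. y $ k \<in> {0..1} \<and> norm (drop_coord k y) \<le> r}"
      by (rule nn_integral_cmult_indicator) measurable
    also have "\<dots> \<le> ennreal (R / s\<^sup>2) * ennreal ((2 * r) ^ (CARD('n) - 1))"
      using r by (intro mult_left_mono emeasure_slab_le) auto
    also have "\<dots> = ennreal (R / s\<^sup>2 * (2 * r) ^ (CARD('n) - 1))"
      by (rule ennreal_mult[symmetric]) (use r \<open>0 < R\<close> in auto)
    also have "\<dots> \<le> ennreal (C * (indicator {0..1} s * s powr (-7/8)))"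
    proof (rule ennreal_leI)
      have "(2 * r) ^ (CARD('n) - 1) = 2 * r * (2 * r) ^ ?m"
        by (subst power_Suc[symmetric], intro arg_cong[where f="\<lambda>j. (2 * r) ^ j"]) (use N in linarith)
      also have "\<dots> \<le> 2 * r * (2 * ?N) ^ ?m"
        using r rN by (intro mult_left_mono power_mono) auto
      finally have "R / s\<^sup>2 * (2 * r) ^ (CARD('n) - 1) \<le> R / s\<^sup>2 * (2 * r * (2 * ?N) ^ ?m)"
        using \<open>0 < R\<close> by (intro mult_left_mono) auto
      also have "\<dots> = 2 * (2 * ?N) ^ ?m * (R * r / s\<^sup>2)" by simp
      also have "R * r = R powr (3/2)"
        using \<open>0 < R\<close> r powr_add[of R 1 "1/2"] by simp
      also have "\<dots> \<le> (8 * ?N * s powr (3/4)) powr (3/2)"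
        using heat_radius_sq_le_powr[of ?N s] True \<open>0 < R\<close> by (intro powr_mono2) (auto simp: R_def)
      also have "\<dots> = (8 * ?N) powr (3/2) * s powr (9/8)"
        by (simp add: powr_mult powr_powr)
      also have "2 * (2 * ?N) ^ ?m * ((8 * ?N) powr (3/2) * s powr (9/8) / s\<^sup>2) = C * (s powr (9/8) / s powr 2)"
        using True by (simp add: C_def powr_numeral)
      also have "s powr (9/8) / s powr 2 = s powr (-7/8)"
        by (subst powr_diff[symmetric]) simp
      finally show "R / s\<^sup>2 * (2 * r) ^ (CARD('n) - 1) \<le> C * (indicator {0..1} s * s powr (-7/8))"
        using True s1 by (simp add: divide_right_mono mult_left_mono)
    qed
    finally show ?thesis .
  qed
  have i: "integrable lborel (\<lambda>s::real. C * (indicator {0..1} s * s powr (-7/8)))"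
    by (intro integrable_mult_right integrable_powr_from_0) auto
  have "(\<integral>\<^sup>+w. ennreal (indicator {0..1} (fst w $ k) * heat_majorant (drop_coord k (fst w), snd w)) \<partial>lborel)
    = (\<integral>\<^sup>+s. (\<integral>\<^sup>+y. ennreal (indicator {0..1} (y $ k) * heat_majorant (drop_coord k y, s)) \<partial>lborel) \<partial>lborel)"
    by (subst lborel_prod[symmetric], subst lborel_pair.nn_integral_snd[symmetric]) simp_all
  also have "\<dots> \<le> (\<integral>\<^sup>+s. ennreal (C * (indicator {0..1} s * s powr (-7/8))) \<partial>lborel)"
    by (intro nn_integral_mono inner)
  also have "\<dots> < \<infinity>"
    using i C0 by (subst nn_integral_eq_integral) auto
  finally show ?thesis .
qed

text \<open>The majorant at the projected point does not involve y_k, so slicing along the k-th axis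
  turns the integral into the product of \<integral> V and the slab integral.\<close>

lemma integrable_heat_majorant:
  fixes k :: "'n::finite" and V :: "real \<Rightarrow> real"
  assumes N: "CARD('n) \<ge> 2" and V: "integrable lborel V" "\<And>\<tau>. 0 \<le> V \<tau>"
  shows "integrable lborel (\<lambda>w::(real^'n) \<times> real. V (fst w $ k) * heat_majorant (drop_coord k (fst w), snd w))"
proof (rule integrableI_nonneg)
  have [measurable]: "V \<in> borel_measurable borel" using V by simp
  show "(\<lambda>w::(real^'n) \<times> real. V (fst w $ k) * heat_majorant (drop_coord k (fst w), snd w)) \<in> borel_measurable lborel"
    by measurable
  show "AE w in lborel. 0 \<le> V (fst w $ k) * heat_majorant (drop_coord k (fst w), snd w)"
    by (intro AE_I2 mult_nonneg_nonneg V(2) heat_majorant_nonneg)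
  let ?b = "(axis k 1, 0) :: (real^'n) \<times> real"
  let ?F = "\<lambda>w::(real^'n) \<times> real. ennreal (V (fst w $ k) * heat_majorant (drop_coord k (fst w), snd w))"
  have b: "?b \<in> Basis" by (simp add: Basis_prod_def axis_in_Basis_iff)
  have ip: "w \<bullet> ?b = fst w $ k" for w by (cases w) (simp add: inner_axis)
  have "(\<integral>\<^sup>+w. ?F w \<partial>lborel) =
    (\<integral>\<^sup>+w. indicator {0..1} (w \<bullet> ?b) * (\<integral>\<^sup>+\<tau>. ?F (w + (\<tau> - w \<bullet> ?b) *\<^sub>R ?b) \<partial>lborel) \<partial>lborel)"
    by (rule nn_integral_lborel_slice[OF _ b]) measurable
  also have "\<dots> = (\<integral>\<^sup>+w. (\<integral>\<^sup>+\<tau>. ennreal (V \<tau>) \<partial>lborel) * ennreal (indicator {0..1} (fst w $ k) * heat_majorant (drop_coord k (fst w), snd w)) \<partial>lborel)"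
  proof (rule nn_integral_cong)
    fix w :: "(real^'n) \<times> real"
    have "?F (w + (\<tau> - w \<bullet> ?b) *\<^sub>R ?b) = ennreal (V \<tau>) * ennreal (heat_majorant (drop_coord k (fst w), snd w))" for \<tau>
    proof -
      have "drop_coord k (fst w + (\<tau> - fst w $ k) *\<^sub>R axis k 1) = drop_coord k (fst w)"
        by (simp add: vec_eq_iff axis_def)
      then show ?thesis
        unfolding ip by (simp add: ennreal_mult V(2) heat_majorant_nonneg axis_def)
    qed
    then show "indicator {0..1} (w \<bullet> ?b) * (\<integral>\<^sup>+\<tau>. ?F (w + (\<tau> - w \<bullet> ?b) *\<^sub>R ?b) \<partial>lborel)
      = (\<integral>\<^sup>+\<tau>. ennreal (V \<tau>) \<partial>lborel) * ennreal (indicator {0..1} (fst w $ k) * heat_majorant (drop_coord k (fst w), snd w))"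
      unfolding ip by (simp add: nn_integral_multc indicator_def)
  qed
  also have "\<dots> = (\<integral>\<^sup>+\<tau>. ennreal (V \<tau>) \<partial>lborel) *
    (\<integral>\<^sup>+w. ennreal (indicator {0..1} (fst w $ k) * heat_majorant (drop_coord k (fst w), snd w)) \<partial>lborel)"
    by (rule nn_integral_cmult) measurable
  also have "\<dots> < \<infinity>"
    using heat_majorant_slab_finite[OF N, of k] V
    by (auto simp: ennreal_mult_less_top nn_integral_eq_integral)
  finally show "(\<integral>\<^sup>+w. ?F w \<partial>lborel) < \<infinity>" .
qed

text \<open>The integrand is the derivative of \<open>- 2 N ln (4 \<pi> s) - a / s\<close>, which vanishes at both ends of the
  interval of integration.\<close>

lemma heat_ball_section_integral:
  fixes a N :: real
  assumes a: "0 < a" and N: "0 < N"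
  shows "(\<integral>s. indicator {s. 0 < s \<and> a < heat_radius_sq N s} s * (a / s\<^sup>2 - 2 * N / s) \<partial>lborel) = 0"
proof -
  \<comment> \<open>This equals (\<open>heat_radius_sq N s\<close> - a) / s, so v is an
    antiderivative of the integrand that is positive exactly on the domain of integration. It
    increases up to c = a / (2 N), the zero of its derivative, and decreases afterwards.\<close>
  define v where "v s = - 2 * N * ln (4 * pi * s) - a / s" for s
  define c where "c = a / (2 * N)"
  have c: "0 < c" using a N by (simp add: c_def)
  have sec: "a < heat_radius_sq N s \<longleftrightarrow> 0 < v s" if "0 < s" for s
  proof -
    have "s * v s = heat_radius_sq N s - a" using that by (simp add: v_def heat_radius_sq_def field_simps)
    then show ?thesis using zero_less_mult_pos[of s "v s"] that mult_pos_pos[of s "v s"] by auto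
  qed
  have deriv: "DERIV v s :> a / s\<^sup>2 - 2 * N / s" if "0 < s" for s
    unfolding v_def[abs_def] using that
    by (auto intro!: derivative_eq_intros simp: field_simps power2_eq_square)
  have cont: "continuous_on {x..y} v" if "0 < x" for x y
    unfolding v_def[abs_def] using that by (auto intro!: continuous_intros)
  have inc: "v x < v y" if "0 < x" "x < y" "y \<le> c" for x y
  proof (rule DERIV_pos_imp_increasing_open[OF that(2)])
    fix s assume "x < s" "s < y"
    then have "0 < s" "s < c" using that by auto
    then have "0 < a / s\<^sup>2 - 2 * N / s" using N by (simp add: c_def field_simps power2_eq_square)
    then show "\<exists>z. DERIV v s :> z \<and> 0 < z" using deriv[OF \<open>0 < s\<close>] by blast
  qed (use cont that in auto)
  have dec: "v y < v x" if "c \<le> x" "x < y" for x y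
  proof (rule DERIV_neg_imp_decreasing_open[OF that(2)])
    fix s assume "x < s" "s < y"
    then have "0 < s" "c < s" using that c by auto
    then have "a / s\<^sup>2 - 2 * N / s < 0" using N by (simp add: c_def field_simps power2_eq_square)
    then show "\<exists>z. DERIV v s :> z \<and> z < 0" using deriv[OF \<open>0 < s\<close>] by blast
  qed (use cont that c in auto)
  show ?thesis
  proof (cases "v c \<le> 0")
    case True
    have "v s \<le> 0" if "0 < s" for s
      using inc[of s c] dec[of c s] True that by (cases s c rule: linorder_cases) auto
    then have "indicator {s. 0 < s \<and> a < heat_radius_sq N s} s = (0::real)" for s
      using sec[of s] by (fastforce simp: indicator_def)
    then show ?thesis by (simp only: mult_zero_left Bochner_Integration.integral_zero)
  next
    case False
    \<comment> \<open>A point not beyond c with v \<le> 0, as needed for the intermediate value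
      theorem: the second term makes 8 N x^(3/4) at most a / 2, so the squared radius at x is below
      a.\<close>
    define x where "x = min c ((a / (16 * N)) powr (4/3))"
    have x: "0 < x" "x \<le> c" using c a N by (auto simp: x_def)
    have "heat_radius_sq N x \<le> 8 * N * x powr (3/4)"
      using N x by (intro heat_radius_sq_le_powr) auto
    also have "\<dots> \<le> 8 * N * ((a / (16 * N)) powr (4/3)) powr (3/4)"
      using N x(1) by (intro mult_left_mono powr_mono2) (auto simp: x_def)
    also have "\<dots> = a / 2" using a N by (simp add: powr_powr)
    also have "\<dots> < a" using a by simp
    finally have vx: "v x \<le> 0" using sec[OF x(1)] by simp
    have c4: "c < 1 / (4 * pi)"
    proof (rule ccontr)
      assume "\<not> c < 1 / (4 * pi)"
      then have "1 \<le> 4 * pi * c" by (simp add: field_simps not_less)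
      then have "0 \<le> ln (4 * pi * c)" by simp
      then have "0 \<le> 2 * N * ln (4 * pi * c)" using N by simp
      moreover have "0 < a / c" using a c by simp
      ultimately show False using False by (simp add: v_def)
    qed
    have v4: "v (1 / (4 * pi)) \<le> 0" using a by (simp add: v_def)
    obtain s1 where s1: "x \<le> s1" "s1 \<le> c" "v s1 = 0"
      using IVT'[of v x 0 c] vx False x cont[of x c] by auto
    obtain s2 where s2: "c \<le> s2" "s2 \<le> 1 / (4 * pi)" "v s2 = 0"
      using IVT2'[of v "1 / (4 * pi)" 0 c] v4 False c4 cont[of c "1 / (4 * pi)"] c by auto
    have lt: "s1 < c" "c < s2" using False s1 s2 by (auto simp: less_le)
    have s10: "0 < s1" using s1 x by simp
    have "0 < s \<and> a < heat_radius_sq N s \<longleftrightarrow> s \<in> {s1<..<s2}" for s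
    proof (cases "0 < s")
      case True
      have "0 < v s \<longleftrightarrow> s \<in> {s1<..<s2}"
      proof (cases "s \<le> c")
        case sc: True
        then show ?thesis
          using inc[of s s1] inc[of s1 s] s1 s10 lt True by (cases s s1 rule: linorder_cases) auto
      next
        case False
        then show ?thesis
          using dec[of s s2] dec[of s2 s] s2 lt by (cases s s2 rule: linorder_cases) auto
      qed
      then show ?thesis using sec True by simp
    qed (use s10 in auto)
    then have eq: "{s. 0 < s \<and> a < heat_radius_sq N s} = {s1<..<s2}" by blast
    have "(\<integral>s. indicator {s1<..<s2} s * (a / s\<^sup>2 - 2 * N / s) \<partial>lborel) =
      (\<integral>s. (a / s\<^sup>2 - 2 * N / s) * indicator {s1..s2} s \<partial>lborel)"
    proof (rule integral_cong_AE)
      have "AE s in lborel. s \<noteq> s1 \<and> s \<noteq> s2"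
        using AE_lborel_singleton[of s1] AE_lborel_singleton[of s2] by eventually_elim simp
      then show "AE s in lborel. indicator {s1<..<s2} s * (a / s\<^sup>2 - 2 * N / s) =
        (a / s\<^sup>2 - 2 * N / s) * indicator {s1..s2} s"
        by eventually_elim (auto simp: indicator_def)
    qed auto
    also have "\<dots> = v s2 - v s1"
    proof (rule integral_FTC_Icc_real)
      show "s1 \<le> s2" using lt by simp
      show "DERIV v s :> a / s\<^sup>2 - 2 * N / s" if "s1 \<le> s" "s \<le> s2" for s
        using deriv that s10 by simp
      show "isCont (\<lambda>s. a / s\<^sup>2 - 2 * N / s) s" if "s1 \<le> s" "s \<le> s2" for s
        using that s10 by (auto intro!: continuous_intros)
    qed
    finally show ?thesis using s1 s2 eq by simp
  qed
qed

section \<open>The limit functional and its integrands\<close>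

definition coord_weight :: "real \<Rightarrow> 'n \<Rightarrow> real ^ 'n \<Rightarrow> real" where
  "coord_weight q k y = (if q = 1 then indicator {0..1} (y $ k) else \<bar>y $ k\<bar> powr (q - 2))"

definition st_proj :: "real \<Rightarrow> 'n \<Rightarrow> (real ^ 'n) \<times> real \<Rightarrow> (real ^ 'n) \<times> real" where
  "st_proj q k w = ((if q = 1 then drop_coord k (fst w) else fst w), snd w)"

text \<open>The functional \<open>limit_integral q k g\<close> is, up to a positive factor, the derivative at
  \<open>\<epsilon> = 0\<close> of \<open>\<epsilon> \<mapsto> \<integral> signed_powr (q - 1) (b y\<^sub>k + \<epsilon> g)\<close> with respect to the heat weight. For
  \<open>q = 1\<close> the sign function jumps, and only the values of \<open>g\<close> on the hyperplane \<open>y\<^sub>k = 0\<close> count;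
  the indicator in \<open>coord_weight\<close> turns the integral over this hyperplane into one over the
  whole space.\<close>

definition limit_integral :: "real \<Rightarrow> 'n \<Rightarrow> ((real ^ 'n) \<times> real \<Rightarrow> real) \<Rightarrow> real" where
  "limit_integral q k g =
    (\<integral>w. coord_weight q k (fst w) * (heat_weight (st_proj q k w) * g (st_proj q k w)) \<partial>lborel)"

lemma st_proj_fst_nth: "fst (st_proj q k w) $ i = (if q = 1 \<and> i = k then 0 else fst w $ i)"
  by (simp add: st_proj_def)

lemma snd_st_proj [simp]: "snd (st_proj q k w) = snd w"
  by (simp add: st_proj_def)

lemma st_proj_measurable [measurable]: "st_proj q k \<in> borel_measurable borel"
  unfolding st_proj_def[abs_def] by measurable

lemma coord_weight_measurable [measurable]: "coord_weight q k \<in> borel_measurable borel"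
  unfolding coord_weight_def[abs_def] by measurable

lemma coord_weight_nonneg: "0 \<le> coord_weight q k y"
  by (simp add: coord_weight_def)

lemma st_proj_unit_heat_ball: "w \<in> unit_heat_ball \<Longrightarrow> st_proj q k w \<in> unit_heat_ball"
  by (cases w) (auto simp: st_proj_def intro: drop_coord_unit_heat_ball)

text \<open>Both cases are a weight in y_k times a function free of y_k. The weight is an indicator
  for q = 1; for q > 1 it is |\<tau>|^(q-2), integrable near 0 because q - 2 > -1, and it may be cut
  off at |\<tau>| = N since the ball lies within that range.\<close>

lemma limit_majorant_integrable:
  fixes k :: "'n::finite"
  assumes N: "CARD('n) \<ge> 2" and q: "1 \<le> q"
  shows "integrable lborel (\<lambda>w. coord_weight q k (fst w) * heat_majorant (st_proj q k w))"
proof (cases "q = 1")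
  case True
  have "integrable lborel (\<lambda>w. indicator {0..1::real} (fst w $ k) * heat_majorant (drop_coord k (fst w), snd w))"
    by (rule integrable_heat_majorant[OF N]) (auto simp: integrable_indicator_iff)
  then show ?thesis using True by (simp add: coord_weight_def st_proj_def)
next
  case False
  let ?V = "\<lambda>\<tau>. indicator {- real CARD('n)..real CARD('n)} \<tau> * \<bar>\<tau>\<bar> powr (q - 2)"
  have "integrable lborel (\<lambda>w. ?V (fst w $ k) * heat_majorant (drop_coord k (fst w), snd w))"
    by (rule integrable_heat_majorant[OF N]) (use False q in \<open>auto intro: integrable_abs_powr\<close>)
  then show ?thesis
  proof (rule Bochner_Integration.integrable_bound)
    show "AE w in lborel. norm (coord_weight q k (fst w) * heat_majorant (st_proj q k w))
      \<le> norm (?V (fst w $ k) * heat_majorant (drop_coord k (fst w), snd w))"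
    proof (rule AE_I2)
      fix w :: "(real^'n) \<times> real"
      obtain y s where w: "w = (y, s)" by (cases w)
      show "norm (coord_weight q k (fst w) * heat_majorant (st_proj q k w))
        \<le> norm (?V (fst w $ k) * heat_majorant (drop_coord k (fst w), snd w))"
      proof (cases "w \<in> unit_heat_ball")
        case True
        then have "\<bar>y $ k\<bar> \<le> real CARD('n)"
          using unit_heat_ball_norm(2)[of y s] component_le_norm_cart[of y k] by (simp add: w)
        then show ?thesis
          using False heat_majorant_drop_coord[of y s k] heat_majorant_nonneg[of "(y, s)"]
          by (simp add: w coord_weight_def st_proj_def abs_mult mult_left_mono abs_le_iff minus_le_iff)
      qed (use False in \<open>simp add: st_proj_def heat_majorant_def\<close>)
    qed
  qed measurable
qed

lemma limit_integrable_bound: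
  fixes k :: "'n::finite"
  assumes N: "CARD('n) \<ge> 2" and q: "1 \<le> q" and [measurable]: "h \<in> borel_measurable borel"
    and h: "\<And>w. \<bar>h w\<bar> \<le> C * (coord_weight q k (fst w) * heat_majorant (st_proj q k w))"
  shows "integrable lborel h"
proof (rule Bochner_Integration.integrable_bound)
  show "integrable lborel (\<lambda>w. C * (coord_weight q k (fst w) * heat_majorant (st_proj q k w)))"
    using limit_majorant_integrable[OF N q] by simp
  show "AE w in lborel. norm (h w) \<le> norm (C * (coord_weight q k (fst w) * heat_majorant (st_proj q k w)))"
    using h by (intro AE_I2) (metis abs_ge_self order_trans real_norm_def)
qed simp

lemma limit_integrable:
  fixes k :: "'n::finite"
  assumes N: "CARD('n) \<ge> 2" and q: "1 \<le> q" and [measurable]: "g \<in> borel_measurable borel"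
    and g: "\<And>w. w \<in> unit_heat_ball \<Longrightarrow> \<bar>g w\<bar> \<le> C"
  shows "integrable lborel (\<lambda>w. coord_weight q k (fst w) * (heat_weight (st_proj q k w) * g (st_proj q k w)))"
proof (rule limit_integrable_bound[OF N q])
  fix w :: "(real^'n) \<times> real"
  let ?v = "st_proj q k w"
  have "\<bar>heat_weight ?v * g ?v\<bar> \<le> heat_majorant ?v * C"
  proof (cases "?v \<in> unit_heat_ball")
    case True
    then show ?thesis
      unfolding abs_mult using heat_weight_bounds[of ?v] g[OF True] by (intro mult_mono) auto
  qed (simp add: heat_weight_def heat_majorant_def)
  then have "coord_weight q k (fst w) * \<bar>heat_weight ?v * g ?v\<bar> \<le> coord_weight q k (fst w) * (heat_majorant ?v * C)"
    by (rule mult_left_mono[OF _ coord_weight_nonneg])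
  then show "\<bar>coord_weight q k (fst w) * (heat_weight ?v * g ?v)\<bar> \<le> C * (coord_weight q k (fst w) * heat_majorant ?v)"
    by (simp only: abs_mult abs_of_nonneg[OF coord_weight_nonneg] mult_ac)
qed measurable

section \<open>Second moments of the heat weight\<close>

lemma st_dir_Basis: "((axis k 1, 0) :: (real^'n) \<times> real) \<in> Basis"
  by (simp add: Basis_prod_def axis_in_Basis_iff)

lemma inner_st_dir: "w \<bullet> ((axis k 1, 0) :: (real^'n) \<times> real) = fst w $ k"
  by (cases w) (simp add: inner_axis)

text \<open>One map in three roles: reflection (c = -1), the dilation that yields second moments (c
  near 1), and the zoom onto the hyperplane y_k = 0 in the median case (c tending to 0).\<close>

definition scale_coord :: "'n \<Rightarrow> real \<Rightarrow> (real ^ 'n) \<times> real \<Rightarrow> (real ^ 'n) \<times> real" where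
  "scale_coord j c w = w + ((c - 1) * (fst w $ j)) *\<^sub>R (axis j 1, 0)"

lemma fst_scale_coord_nth: "fst (scale_coord j c w) $ i = (if i = j then c * fst w $ j else fst w $ i)"
  by (simp add: scale_coord_def axis_def algebra_simps)

lemma snd_scale_coord [simp]: "snd (scale_coord j c w) = snd w"
  by (simp add: scale_coord_def)

lemma scale_coord_measurable [measurable]: "scale_coord j c \<in> borel_measurable borel"
  unfolding scale_coord_def[abs_def] by (intro borel_measurable_continuous_onI continuous_intros)

lemma integral_scale_coord:
  fixes f :: "(real ^ 'n) \<times> real \<Rightarrow> real"
  assumes "c \<noteq> 0" "f \<in> borel_measurable borel"
  shows "(\<integral>w. f w \<partial>lborel) = \<bar>c\<bar> * (\<integral>w. f (scale_coord j c w) \<partial>lborel)"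
  using integral_scale_direction[OF st_dir_Basis assms, of j] by (simp add: inner_st_dir scale_coord_def)

lemma norm_scale_coord: "(norm (fst (scale_coord j c w)))\<^sup>2 = (norm (fst w))\<^sup>2 + (c\<^sup>2 - 1) * (fst w $ j)\<^sup>2"
proof -
  have "(norm (fst (scale_coord j c w)))\<^sup>2 =
    (\<Sum>i\<in>UNIV. (fst w $ i)\<^sup>2 + (if i = j then (c\<^sup>2 - 1) * (fst w $ j)\<^sup>2 else 0))"
    unfolding norm_sq_cart
    by (intro sum.cong) (auto simp: fst_scale_coord_nth power_mult_distrib algebra_simps)
  then show ?thesis by (simp add: sum.distrib norm_sq_cart)
qed

lemma st_proj_scale_coord: "st_proj q k (scale_coord j c w) = scale_coord j c (st_proj q k w)"
  by (auto simp: prod_eq_iff vec_eq_iff st_proj_fst_nth fst_scale_coord_nth)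

lemma coord_weight_scale_coord: "j \<noteq> k \<Longrightarrow> coord_weight q k (fst (scale_coord j c w)) = coord_weight q k (fst w)"
  by (simp add: coord_weight_def fst_scale_coord_nth)

lemma heat_weight_reflect: "heat_weight (scale_coord j (- 1) w) = heat_weight w"
proof -
  have n: "norm (fst (scale_coord j (- 1) w)) = norm (fst w)"
    using norm_scale_coord[of j "- 1" w] by simp
  then have "scale_coord j (- 1) w \<in> unit_heat_ball \<longleftrightarrow> w \<in> unit_heat_ball"
    by (auto simp: unit_heat_ball_def case_prod_beta)
  then show ?thesis by (simp add: heat_weight_def n indicator_def)
qed

text \<open>The reflection in coordinate i preserves Lebesgue measure and both weights but flips
  \<open>g\<close>, so the integral equals its own negative.\<close>

lemma limit_integral_reflect:
  assumes "i \<noteq> k" and [measurable]: "g \<in> borel_measurable borel"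
    and g: "\<And>w. g (scale_coord i (- 1) w) = - g w"
  shows "limit_integral q k g = 0"
proof -
  let ?f = "\<lambda>w. coord_weight q k (fst w) * (heat_weight (st_proj q k w) * g (st_proj q k w))"
  have "(\<integral>w. ?f w \<partial>lborel) = \<bar>- 1\<bar> * (\<integral>w. ?f (scale_coord i (- 1) w) \<partial>lborel)"
    by (rule integral_scale_coord) auto
  also have "\<dots> = - (\<integral>w. ?f w \<partial>lborel)"
    using assms(1) by (simp add: coord_weight_scale_coord st_proj_scale_coord heat_weight_reflect g)
  finally show ?thesis by (simp add: limit_integral_def)
qed

lemma limit_integral_mixed:
  assumes "i \<noteq> j"
  shows "limit_integral q k (\<lambda>w. fst w $ i * fst w $ j) = 0"
proof (cases "i = k")
  case True
  then show ?thesis using assms by (intro limit_integral_reflect[where i=j]) (auto simp: fst_scale_coord_nth)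
next
  case False
  then show ?thesis using assms by (intro limit_integral_reflect[where i=i]) (auto simp: fst_scale_coord_nth)
qed

text \<open>A potential of the heat weight: its derivative in the direction \<open>y\<^sub>j\<close> is
  \<open>- y\<^sub>j \<cdot> heat_weight\<close>. Scaling the coordinate \<open>y\<^sub>j\<close> therefore evaluates the second moments.\<close>

definition heat_potential :: "(real ^ 'n) \<times> real \<Rightarrow> real" where
  "heat_potential w = indicator unit_heat_ball w *
    (((heat_radius_sq (real CARD('n)) (snd w))\<^sup>2 - (norm (fst w)) ^ 4) / (4 * (snd w)\<^sup>2))"

lemma heat_potential_measurable [measurable]: "(heat_potential :: (real^'n) \<times> real \<Rightarrow> real) \<in> borel_measurable borel"
  unfolding heat_potential_def[abs_def] heat_radius_sq_def by measurable

lemma heat_potential_bounds: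
  fixes w :: "(real^'n) \<times> real"
  shows "0 \<le> heat_potential w" "heat_potential w \<le> real CARD('n) * heat_majorant w"
proof -
  let ?N = "real CARD('n)"
  obtain y s where w: "w = (y, s)" by (cases w)
  have "0 \<le> heat_potential w \<and> heat_potential w \<le> ?N * heat_majorant w"
  proof (cases "w \<in> unit_heat_ball")
    case True
    define R where "R = heat_radius_sq ?N s"
    have s: "0 < s" using True unit_heat_ball_time w by blast
    have R: "(norm y)\<^sup>2 < R" using True by (simp add: w R_def unit_heat_ball_def)
    have R0: "0 < R" by (rule le_less_trans[OF zero_le_power2 R])
    have RN: "R \<le> ?N" unfolding R_def by (rule heat_radius_sq_le_dim) (use s in auto)
    have "((norm y)\<^sup>2)\<^sup>2 \<le> R\<^sup>2" using R by (intro power_mono) auto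
    then have n4: "(norm y) ^ 4 \<le> R\<^sup>2" by simp
    have "R\<^sup>2 \<le> ?N * R" using mult_right_mono[OF RN, of R] R0 by (simp add: power2_eq_square)
    moreover have "0 \<le> norm y ^ 4" by simp
    ultimately have "R\<^sup>2 - (norm y) ^ 4 \<le> ?N * R" by linarith
    then have "(R\<^sup>2 - (norm y) ^ 4) / (4 * s\<^sup>2) \<le> (?N * R) / (s\<^sup>2)"
      using s R0 by (intro frac_le) auto
    then show ?thesis using True n4 s by (simp add: heat_potential_def heat_majorant_def w R_def[symmetric])
  qed (simp add: heat_potential_def heat_majorant_def)
  then show "0 \<le> heat_potential w" "heat_potential w \<le> real CARD('n) * heat_majorant w" by auto
qed

text \<open>Supplies the dominating function for difference quotients in c. Taking c \<ge> 1 moves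
  points outwards only, so points outside the ball stay outside.\<close>

lemma heat_potential_decrease:
  fixes w :: "(real^'n) \<times> real"
  assumes c: "1 \<le> c" "c \<le> 2"
  shows "0 \<le> heat_potential w - heat_potential (scale_coord j c w)"
    "heat_potential w - heat_potential (scale_coord j c w) \<le> (c - 1) * (4 * real CARD('n) * heat_majorant w)"
proof -
  let ?N = "real CARD('n)"
  define v where "v = scale_coord j c w"
  obtain y s where w: "w = (y, s)" by (cases w)
  obtain z where v: "v = (z, s)" by (metis snd_scale_coord surj_pair snd_conv v_def w)
  define R where "R = heat_radius_sq ?N s"
  define a where "a = (norm y)\<^sup>2"
  have a0: "0 \<le> a" by (simp add: a_def)
  have z: "(norm z)\<^sup>2 = a + (c\<^sup>2 - 1) * (y $ j)\<^sup>2"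
    using norm_scale_coord[of j c w] unfolding v_def[symmetric] v by (simp add: w a_def)
  have c1: "0 \<le> c\<^sup>2 - 1" using c by (simp add: one_le_power)
  have za: "a \<le> (norm z)\<^sup>2" using z c1 by simp
  have yj: "(y $ j)\<^sup>2 \<le> a" unfolding a_def using norm_drop_coord[of y j] by simp
  have "(norm z)\<^sup>2 \<le> a + (c\<^sup>2 - 1) * a" using z c1 yj by (simp add: mult_left_mono)
  then have zc: "(norm z)\<^sup>2 \<le> c\<^sup>2 * a" by (simp add: algebra_simps)
  have "(norm z) ^ 4 = ((norm z)\<^sup>2)\<^sup>2" by simp
  also have "\<dots> \<le> (c\<^sup>2 * a)\<^sup>2" using zc by (intro power_mono) auto
  also have "\<dots> = c ^ 4 * a\<^sup>2" by (simp add: power_mult_distrib)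
  finally have z4: "(norm z) ^ 4 \<le> c ^ 4 * a\<^sup>2" .
  have y4: "(norm y) ^ 4 = a\<^sup>2" by (simp add: a_def)
  have az: "a\<^sup>2 \<le> (norm z) ^ 4" using power_mono[OF za a0, of 2] by simp
  \<comment> \<open>For 1 \<le> c \<le> 2 the cofactors c + 1 and c^2 + 1 are at most 3 and
    5.\<close>
  have "c ^ 4 - 1 = (c - 1) * ((c + 1) * (c\<^sup>2 + 1))" by (simp add: algebra_simps power2_eq_square eval_nat_numeral)
  also have "\<dots> \<le> (c - 1) * (3 * 5)"
    using c power_mono[of c 2 2] by (intro mult_left_mono mult_mono) auto
  finally have c4: "c ^ 4 - 1 \<le> (c - 1) * 15" by simp
  have "0 \<le> heat_potential w - heat_potential v \<and>
    heat_potential w - heat_potential v \<le> (c - 1) * (4 * ?N * heat_majorant w)"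
  proof (cases "w \<in> unit_heat_ball")
    case True
    have s: "0 < s" using True unit_heat_ball_time w by blast
    have R: "a < R" using True by (simp add: w R_def a_def unit_heat_ball_def)
    have RN: "R \<le> ?N" unfolding R_def by (rule heat_radius_sq_le_dim) (use s in auto)
    have hw: "heat_potential w = (R\<^sup>2 - a\<^sup>2) / (4 * s\<^sup>2)" "heat_majorant w = R / s\<^sup>2"
      using True by (simp_all add: heat_potential_def heat_majorant_def w R_def y4)
    have up: "(R\<^sup>2 - a\<^sup>2) - (R\<^sup>2 - (norm z) ^ 4) \<le> (c - 1) * (16 * ?N * R)"
    proof -
      have "(norm z) ^ 4 - a\<^sup>2 \<le> (c ^ 4 - 1) * a\<^sup>2" using z4 by (simp add: algebra_simps)
      also have "\<dots> \<le> ((c - 1) * 15) * a\<^sup>2" using c4 by (intro mult_right_mono) auto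
      also have "a\<^sup>2 \<le> ?N * R"
        unfolding power2_eq_square using R RN a0 by (intro mult_mono) auto
      finally have "(norm z) ^ 4 - a\<^sup>2 \<le> ((c - 1) * 15) * (?N * R)"
        using c by (simp add: mult_left_mono)
      \<comment> \<open>15 is rounded up to 16 so that it cancels the 4 in the denominator of the
        potential.\<close>
      also have "\<dots> \<le> ((c - 1) * 16) * (?N * R)"
        using c R a0 by (intro mult_right_mono) auto
      finally show ?thesis by (simp add: algebra_simps)
    qed
    show ?thesis
    proof (cases "v \<in> unit_heat_ball")
      case vin: True
      have hv: "heat_potential v = (R\<^sup>2 - (norm z) ^ 4) / (4 * s\<^sup>2)"
        using vin by (simp add: heat_potential_def v R_def)
      have "heat_potential w - heat_potential v = ((R\<^sup>2 - a\<^sup>2) - (R\<^sup>2 - (norm z) ^ 4)) / (4 * s\<^sup>2)"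
        unfolding hw hv by (simp only: diff_divide_distrib)
      also have "\<dots> \<le> ((c - 1) * (16 * ?N * R)) / (4 * s\<^sup>2)"
        using up s by (intro divide_right_mono) auto
      also have "\<dots> = (c - 1) * (4 * ?N * heat_majorant w)" by (simp add: hw)
      finally have "heat_potential w - heat_potential v \<le> (c - 1) * (4 * ?N * heat_majorant w)" .
      moreover have "0 \<le> heat_potential w - heat_potential v"
        unfolding hw hv using az s by (simp add: divide_right_mono)
      ultimately show ?thesis by simp
    next
      case False
      \<comment> \<open>The point has left the ball, so the whole value is lost; but then R^2 \<le>
        |z|^4, and the loss R^2 - a^2 is still covered by the estimate of |z|^4 - a^2.\<close>
      then have "R \<le> (norm z)\<^sup>2" using s by (simp add: v unit_heat_ball_def R_def)
      then have "R\<^sup>2 \<le> (norm z) ^ 4" using power_mono[of R "(norm z)\<^sup>2" 2] R a0 by simp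
      then have "R\<^sup>2 - a\<^sup>2 \<le> (c - 1) * (16 * ?N * R)" using up by simp
      then have "(R\<^sup>2 - a\<^sup>2) / (4 * s\<^sup>2) \<le> ((c - 1) * (16 * ?N * R)) / (4 * s\<^sup>2)"
        using s by (intro divide_right_mono) auto
      also have "\<dots> = (c - 1) * (4 * ?N * heat_majorant w)" by (simp add: hw)
      finally have "heat_potential w \<le> (c - 1) * (4 * ?N * heat_majorant w)" by (simp add: hw)
      moreover have "heat_potential v = 0" using False by (simp add: heat_potential_def)
      ultimately show ?thesis using heat_potential_bounds[of w] by simp
    qed
  next
    case False
    have "v \<notin> unit_heat_ball"
    proof
      assume "v \<in> unit_heat_ball"
      then have "0 < s \<and> a < heat_radius_sq ?N s" using le_less_trans[OF za] by (simp add: v unit_heat_ball_def)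
      with False show False by (simp add: w unit_heat_ball_def a_def)
    qed
    then show ?thesis using False by (simp add: heat_potential_def heat_majorant_def)
  qed
  then show "0 \<le> heat_potential w - heat_potential (scale_coord j c w)"
    "heat_potential w - heat_potential (scale_coord j c w) \<le> (c - 1) * (4 * real CARD('n) * heat_majorant w)"
    by (simp_all add: v_def)
qed

text \<open>The one-sided approach c > 1 avoids the boundary: points outside the open ball, boundary
  included, stay outside, and points inside stay inside once c is close to 1, where the quotient is
  a polynomial in c.\<close>

lemma heat_potential_derivative:
  fixes w :: "(real^'n) \<times> real"
  assumes c: "\<And>n. 1 < c n" "c \<longlonglongrightarrow> 1"
  shows "(\<lambda>n. (heat_potential w - heat_potential (scale_coord j (c n) w)) / (c n - 1))
    \<longlonglongrightarrow> heat_weight w * (fst w $ j)\<^sup>2"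
proof (cases "w \<in> unit_heat_ball")
  case False
  have "scale_coord j (c n) w \<notin> unit_heat_ball" for n
  proof -
    have "1 \<le> c n" using c(1)[of n] by simp
    then have le: "(norm (fst w))\<^sup>2 \<le> (norm (fst (scale_coord j (c n) w)))\<^sup>2"
      unfolding norm_scale_coord by (simp add: one_le_power)
    show ?thesis
    proof
      assume "scale_coord j (c n) w \<in> unit_heat_ball"
      then have "0 < snd w" "(norm (fst (scale_coord j (c n) w)))\<^sup>2 < heat_radius_sq (real CARD('n)) (snd w)"
        by (simp_all add: unit_heat_ball_def case_prod_beta)
      with le have "0 < snd w \<and> (norm (fst w))\<^sup>2 < heat_radius_sq (real CARD('n)) (snd w)" by linarith
      then have "w \<in> unit_heat_ball" by (simp only: unit_heat_ball_def case_prod_beta mem_Collect_eq)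
      with False show False by contradiction
    qed
  qed
  then show ?thesis using False by (simp add: heat_potential_def heat_weight_def)
next
  case True
  obtain y s where w: "w = (y, s)" by (cases w)
  have s: "0 < s" using True unit_heat_ball_time w by blast
  have "(\<lambda>n. scale_coord j (c n) w) \<longlonglongrightarrow> scale_coord j 1 w"
    unfolding scale_coord_def by (intro tendsto_intros c(2))
  then have "(\<lambda>n. scale_coord j (c n) w) \<longlonglongrightarrow> w" by (simp add: scale_coord_def zero_prod_def[symmetric])
  then have ev: "\<forall>\<^sub>F n in sequentially. scale_coord j (c n) w \<in> unit_heat_ball"
    using open_unit_heat_ball True by (rule topological_tendstoD)
  let ?a = "(norm y)\<^sup>2" and ?b = "(y $ j)\<^sup>2"
  have "(\<lambda>n. ((c n + 1) * ?b) * (2 * ?a + ((c n)\<^sup>2 - 1) * ?b) / (4 * s\<^sup>2))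
    \<longlonglongrightarrow> ((1 + 1) * ?b) * (2 * ?a + (1\<^sup>2 - 1) * ?b) / (4 * s\<^sup>2)"
    by (intro tendsto_intros c(2)) (use s in auto)
  also have "((1 + 1) * ?b) * (2 * ?a + (1\<^sup>2 - 1) * ?b) / (4 * s\<^sup>2) = heat_weight w * (fst w $ j)\<^sup>2"
    using True by (simp add: heat_weight_def w)
  finally show ?thesis
  proof (rule Lim_transform_eventually)
    show "\<forall>\<^sub>F n in sequentially. ((c n + 1) * ?b) * (2 * ?a + ((c n)\<^sup>2 - 1) * ?b) / (4 * s\<^sup>2) =
      (heat_potential w - heat_potential (scale_coord j (c n) w)) / (c n - 1)"
      using ev
    proof eventually_elim
      case (elim n)
      let ?R = "heat_radius_sq (real CARD('n)) s"
      have c1: "c n - 1 \<noteq> 0" using c(1)[of n] by simp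
      have "(norm (fst (scale_coord j (c n) w))) ^ 4 = ((norm (fst (scale_coord j (c n) w)))\<^sup>2)\<^sup>2" by simp
      also have "\<dots> = (?a + ((c n)\<^sup>2 - 1) * ?b)\<^sup>2" unfolding norm_scale_coord by (simp add: w)
      finally have n4: "(norm (fst (scale_coord j (c n) w))) ^ 4 = (?a + ((c n)\<^sup>2 - 1) * ?b)\<^sup>2" .
      have "heat_potential w - heat_potential (scale_coord j (c n) w) =
        ((?R\<^sup>2 - ?a\<^sup>2) - (?R\<^sup>2 - (?a + ((c n)\<^sup>2 - 1) * ?b)\<^sup>2)) / (4 * s\<^sup>2)"
        using elim True by (simp add: heat_potential_def n4[unfolded w] w diff_divide_distrib)
      also have "(?R\<^sup>2 - ?a\<^sup>2) - (?R\<^sup>2 - (?a + ((c n)\<^sup>2 - 1) * ?b)\<^sup>2) =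
        (c n - 1) * (((c n + 1) * ?b) * (2 * ?a + ((c n)\<^sup>2 - 1) * ?b))"
        by (simp add: algebra_simps power2_eq_square)
      finally show ?case using c1 by simp
    qed
  qed
qed

text \<open>By \<open>limit_integral_square\<close> this is the common second moment of the
  coordinates y_j with j \<noteq> k.\<close>

definition potential_integral :: "real \<Rightarrow> 'n::finite \<Rightarrow> real" where
  "potential_integral q k = (\<integral>w. coord_weight q k (fst w) * heat_potential (st_proj q k w) \<partial>lborel)"

lemma potential_integrable:
  fixes k :: "'n::finite"
  assumes "CARD('n) \<ge> 2" "1 \<le> q"
  shows "integrable lborel (\<lambda>w. coord_weight q k (fst w) * heat_potential (st_proj q k w))"
proof (rule limit_integrable_bound[OF assms])
  fix w :: "(real^'n) \<times> real"
  have "\<bar>coord_weight q k (fst w) * heat_potential (st_proj q k w)\<bar> = coord_weight q k (fst w) * heat_potential (st_proj q k w)"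
    by (simp add: abs_mult coord_weight_nonneg heat_potential_bounds(1))
  also have "\<dots> \<le> coord_weight q k (fst w) * (real CARD('n) * heat_majorant (st_proj q k w))"
    by (intro mult_left_mono heat_potential_bounds coord_weight_nonneg)
  finally show "\<bar>coord_weight q k (fst w) * heat_potential (st_proj q k w)\<bar>
    \<le> real CARD('n) * (coord_weight q k (fst w) * heat_majorant (st_proj q k w))" by (simp add: mult_ac)
qed measurable

lemma potential_integral_scale:
  fixes k :: "'n::finite"
  assumes c: "0 < c" and jk: "j = k \<Longrightarrow> q \<noteq> 1"
  shows "(\<integral>w. coord_weight q k (fst w) * heat_potential (st_proj q k (scale_coord j c w)) \<partial>lborel) =
    c powr (- (if j = k then q - 1 else 1)) * potential_integral q k"
proof -
  let ?f = "\<lambda>w. coord_weight q k (fst w) * heat_potential (st_proj q k w)"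
  \<comment> \<open>The degree of homogeneity of \<open>coord_weight\<close> in the dilated
    coordinate; the Jacobian contributes one more power of c.\<close>
  define e where "e = (if j = k then q - 2 else 0)"
  have cw: "coord_weight q k (fst (scale_coord j c w)) = c powr e * coord_weight q k (fst w)" for w
    using jk c by (auto simp: coord_weight_def fst_scale_coord_nth e_def abs_mult powr_mult)
  have "potential_integral q k = \<bar>c\<bar> * (\<integral>w. ?f (scale_coord j c w) \<partial>lborel)"
    unfolding potential_integral_def by (rule integral_scale_coord) (use c in auto)
  also have "\<dots> = (c * c powr e) * (\<integral>w. coord_weight q k (fst w) * heat_potential (st_proj q k (scale_coord j c w)) \<partial>lborel)"
    using c by (simp add: cw mult.assoc)
  also have "c * c powr e = c powr (if j = k then q - 1 else 1)"
    using c powr_add[of c 1 "q - 2"] by (simp add: e_def)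
  finally show ?thesis using c by (simp add: powr_minus field_simps)
qed

text \<open>Integration by parts, carried out by differentiating a change of variables: dilating y_j
  multiplies the potential integral by a power of c, and comparing derivatives at c = 1 gives the
  moment. No boundary term appears, and the singular weight |y_k|^(q-2) is never
  differentiated.\<close>

lemma limit_integral_square:
  fixes k :: "'n::finite"
  assumes N: "CARD('n) \<ge> 2" and q: "1 \<le> q"
  shows "limit_integral q k (\<lambda>w. (fst w $ j)\<^sup>2) = (if j = k then q - 1 else 1) * potential_integral q k"
proof (cases "j = k \<and> q = 1")
  case True
  \<comment> \<open>On the hyperplane y_k = 0 the moment of y_k vanishes, in agreement with the
    factor q - 1 = 0.\<close>
  then show ?thesis by (simp add: limit_integral_def st_proj_fst_nth)
next
  case False
  define e where "e = (if j = k then q - 1 else 1)"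
  define c where "c n = 1 + 1 / real (Suc n)" for n
  have c: "1 < c n" "1 \<le> c n" "c n \<le> 2" "0 < c n" for n by (simp_all add: c_def field_simps)
  have clim: "c \<longlonglongrightarrow> 1"
    unfolding c_def[abs_def] using tendsto_add[OF tendsto_const LIMSEQ_inverse_real_of_nat, of 1]
    by (simp add: inverse_eq_divide)
  let ?w = "\<lambda>w. coord_weight q k (fst w)" and ?P = "st_proj q k"
  let ?D = "\<lambda>n w. ?w w * ((heat_potential (?P w) - heat_potential (scale_coord j (c n) (?P w))) / (c n - 1))"
  have lim1: "(\<lambda>n. \<integral>w. ?D n w \<partial>lborel) \<longlonglongrightarrow> limit_integral q k (\<lambda>w. (fst w $ j)\<^sup>2)"
    unfolding limit_integral_def
  proof (rule integral_dominated_convergence[where w="\<lambda>w. (4 * real CARD('n)) * (?w w * heat_majorant (?P w))"])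
    show "integrable lborel (\<lambda>w. (4 * real CARD('n)) * (?w w * heat_majorant (?P w)))"
      using limit_majorant_integrable[OF N q, of k] by simp
    show "AE w in lborel. (\<lambda>n. ?D n w) \<longlonglongrightarrow> ?w w * (heat_weight (?P w) * (fst (?P w) $ j)\<^sup>2)"
      by (intro AE_I2 tendsto_mult tendsto_const heat_potential_derivative c clim)
    show "AE w in lborel. norm (?D n w) \<le> (4 * real CARD('n)) * (?w w * heat_majorant (?P w))" for n
    proof (rule AE_I2)
      fix w :: "(real^'n) \<times> real"
      let ?d = "heat_potential (?P w) - heat_potential (scale_coord j (c n) (?P w))"
      have d: "0 \<le> ?d" "?d \<le> (c n - 1) * (4 * real CARD('n) * heat_majorant (?P w))"
        using heat_potential_decrease[OF c(2,3)] by blast+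
      then have "0 \<le> ?d / (c n - 1)" "?d / (c n - 1) \<le> 4 * real CARD('n) * heat_majorant (?P w)"
        using c(1)[of n] by (simp_all add: field_simps)
      then have "0 \<le> ?D n w" "?D n w \<le> ?w w * (4 * real CARD('n) * heat_majorant (?P w))"
        by (auto intro!: mult_nonneg_nonneg mult_left_mono coord_weight_nonneg simp del: times_divide_eq_right)
      then show "norm (?D n w) \<le> (4 * real CARD('n)) * (?w w * heat_majorant (?P w))"
        by (simp only: real_norm_def abs_of_nonneg mult_ac)
    qed
  qed measurable
  have eq: "(\<integral>w. ?D n w \<partial>lborel) = (1 - c n powr (- e)) / (c n - 1) * potential_integral q k" for n
  proof -
    let ?g = "\<lambda>w. ?w w * heat_potential (?P (scale_coord j (c n) w))"
    have "integrable lborel ?g"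
    proof (rule limit_integrable_bound[OF N q])
      fix w :: "(real^'n) \<times> real"
      have "heat_potential (?P (scale_coord j (c n) w)) \<le> heat_potential (?P w)"
        using heat_potential_decrease(1)[OF c(2,3)[of n], of "?P w" j] by (simp add: st_proj_scale_coord)
      also have "\<dots> \<le> real CARD('n) * heat_majorant (?P w)" by (rule heat_potential_bounds)
      finally have "?g w \<le> ?w w * (real CARD('n) * heat_majorant (?P w))"
        by (intro mult_left_mono coord_weight_nonneg)
      moreover have "\<bar>?g w\<bar> = ?g w"
        by (intro abs_of_nonneg mult_nonneg_nonneg coord_weight_nonneg heat_potential_bounds)
      ultimately show "\<bar>?g w\<bar> \<le> real CARD('n) * (?w w * heat_majorant (?P w))"
        by (simp only: mult_ac)
    qed measurable
    then have "(\<integral>w. ?D n w \<partial>lborel) =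
      (potential_integral q k - (\<integral>w. ?g w \<partial>lborel)) / (c n - 1)"
      using potential_integrable[OF N q, of k]
      by (simp add: potential_integral_def st_proj_scale_coord right_diff_distrib)
    also have "(\<integral>w. ?g w \<partial>lborel) = c n powr (- e) * potential_integral q k"
      unfolding e_def by (rule potential_integral_scale) (use c False in auto)
    finally show ?thesis by (simp add: algebra_simps diff_divide_distrib)
  qed
  have "((\<lambda>x. (1 - x powr (- e)) / (x - 1)) \<longlongrightarrow> e) (at 1)"
  proof -
    have "((\<lambda>x::real. 1 - x powr (- e)) has_field_derivative e) (at 1)"
      by (auto intro!: derivative_eq_intros)
    then show ?thesis by (simp add: has_field_derivative_iff)
  qed
  moreover have "filterlim c (at 1) sequentially"
    unfolding filterlim_at using clim c(1) by (auto intro!: always_eventually simp: less_imp_neq[symmetric])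
  ultimately have "(\<lambda>n. (1 - c n powr (- e)) / (c n - 1)) \<longlonglongrightarrow> e"
    by (rule filterlim_compose)
  then have "(\<lambda>n. \<integral>w. ?D n w \<partial>lborel) \<longlonglongrightarrow> e * potential_integral q k"
    unfolding eq by (intro tendsto_mult tendsto_const)
  with lim1 show ?thesis unfolding e_def by (rule LIMSEQ_unique)
qed

lemma unit_heat_ball_snd_pos: "w \<in> unit_heat_ball \<Longrightarrow> 0 < snd w"
  by (auto simp: unit_heat_ball_def)

text \<open>On a line of fixed y the heat weight times |y|^2 - 2 N s is |y|^2 times |y|^2 / s^2 - 2
  N / s on the time section of the ball, and that integral vanishes. Since \<open>st_proj\<close>
  leaves time alone, the argument covers q = 1 too.\<close>

lemma limit_integral_time:
  fixes k :: "'n::finite"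
  assumes N: "CARD('n) \<ge> 2" and q: "1 \<le> q"
  shows "limit_integral q k (\<lambda>w. (norm (fst w))\<^sup>2) = 2 * real CARD('n) * limit_integral q k snd"
proof -
  let ?N = "real CARD('n)"
  let ?f = "\<lambda>g w. coord_weight q k (fst w) * (heat_weight (st_proj q k w) * g (st_proj q k w))"
  let ?g = "\<lambda>w. (norm (fst w))\<^sup>2 - 2 * ?N * snd w"
  have i1: "integrable lborel (?f (\<lambda>w. (norm (fst w))\<^sup>2))"
    by (rule limit_integrable[OF N q, where C="?N"]) (use unit_heat_ball_norm(1) in force)+
  have i2: "integrable lborel (?f snd)"
    by (rule limit_integrable[OF N q, where C=1]) (use unit_heat_ball_time in force)+
  have i3: "integrable lborel (?f ?g)"
    using Bochner_Integration.integrable_diff[OF i1 integrable_mult_right[OF i2, of "2 * ?N"]]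
    by (simp add: algebra_simps)
  have "(\<integral>w. ?f ?g w \<partial>lborel) = (\<integral>y. (\<integral>s. ?f ?g (y, s) \<partial>lborel) \<partial>lborel)"
    using lborel_pair.integral_fst'[of "?f ?g"] i3 by (simp add: lborel_prod)
  also have "(\<lambda>y. \<integral>s. ?f ?g (y, s) \<partial>lborel) = (\<lambda>y. 0)"
  proof
    fix y :: "real^'n"
    define z where "z = fst (st_proj q k (y, 0))"
    have z: "st_proj q k (y, s) = (z, s)" for s by (simp add: z_def st_proj_def)
    define a where "a = (norm z)\<^sup>2"
    have "(\<integral>s. ?f ?g (y, s) \<partial>lborel) =
      (\<integral>s. (coord_weight q k y * a) * (indicator {s. 0 < s \<and> a < heat_radius_sq ?N s} s * (a / s\<^sup>2 - 2 * ?N / s)) \<partial>lborel)"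
      by (intro Bochner_Integration.integral_cong refl)
         (simp add: z heat_weight_def unit_heat_ball_def a_def indicator_def power2_eq_square field_simps)
    also have "\<dots> = 0"
    proof (cases "a = 0")
      case False
      then have "0 < a" by (simp add: a_def)
      then show ?thesis
        by (subst integral_mult_right_zero) (simp only: heat_ball_section_integral of_nat_0_less_iff zero_less_card_finite mult_zero_right)
    qed simp
    finally show "(\<integral>s. ?f ?g (y, s) \<partial>lborel) = 0" .
  qed
  finally have "(\<integral>w. ?f ?g w \<partial>lborel) = 0" by simp
  moreover have "(\<integral>w. ?f ?g w \<partial>lborel) = limit_integral q k (\<lambda>w. (norm (fst w))\<^sup>2) - 2 * ?N * limit_integral q k snd"
  proof -
    have "(\<integral>w. ?f ?g w \<partial>lborel) = (\<integral>w. ?f (\<lambda>w. (norm (fst w))\<^sup>2) w - 2 * ?N * ?f snd w \<partial>lborel)"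
      by (intro Bochner_Integration.integral_cong refl) (simp add: algebra_simps)
    then show ?thesis using i1 i2 by (simp add: limit_integral_def)
  qed
  ultimately show ?thesis by simp
qed

lemma limit_integral_snd_pos:
  fixes k :: "'n::finite"
  assumes N: "CARD('n) \<ge> 2" and q: "1 \<le> q"
  shows "0 < limit_integral q k snd"
proof -
  let ?f = "\<lambda>w. coord_weight q k (fst w) * (heat_weight (st_proj q k w) * snd (st_proj q k w))"
  have i: "integrable lborel ?f"
    by (rule limit_integrable[OF N q, where C=1]) (use unit_heat_ball_time in force)+
  have nn: "0 \<le> ?f w" for w
  proof (cases "st_proj q k w \<in> unit_heat_ball")
    case True
    then have "0 \<le> snd (st_proj q k w)" by (rule less_imp_le[OF unit_heat_ball_snd_pos])
    then show ?thesis by (intro mult_nonneg_nonneg coord_weight_nonneg heat_weight_bounds)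
  qed (simp add: heat_weight_def)
  have "\<exists>j. j \<noteq> k"
  proof (rule ccontr)
    assume "\<nexists>j. j \<noteq> k"
    then have "(UNIV :: 'n set) = {k}" by auto
    then have "CARD('n) = card {k}" by (rule arg_cong)
    with N show False by simp
  qed
  then obtain j where j: "j \<noteq> k" by blast
  \<comment> \<open>An open set on which every factor is positive: 0 < y_k < 1 serves both forms of
    \<open>coord_weight\<close>, and y_j > 0 keeps the space part nonzero even after y_k is
    dropped.\<close>
  define U where "U = unit_heat_ball \<inter> {w::(real^'n) \<times> real. fst w $ k \<in> {0<..<1}} \<inter> {w. 0 < fst w $ j}"
  have pos: "0 < ?f w" if "w \<in> U" for w
  proof -
    have H: "st_proj q k w \<in> unit_heat_ball" using that by (auto simp: U_def intro: st_proj_unit_heat_ball)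
    then have s: "0 < snd (st_proj q k w)" by (rule unit_heat_ball_snd_pos)
    have "fst (st_proj q k w) $ j \<noteq> 0" using that j by (simp add: U_def st_proj_fst_nth)
    then have "fst (st_proj q k w) \<noteq> 0" by (metis zero_index)
    then have "0 < heat_weight (st_proj q k w)" using H s by (simp add: heat_weight_def)
    moreover have "0 < coord_weight q k (fst w)" using that by (auto simp: U_def coord_weight_def)
    ultimately show ?thesis using s by simp
  qed
  have "open U"
    unfolding U_def greaterThanLessThan_def
    by (intro open_Int open_unit_heat_ball)
       (auto intro!: open_Collect_conj open_Collect_less continuous_intros)
  moreover have "U \<noteq> {}"
  proof -
    let ?N = "real CARD('n)"
    define M where "M = ?N / (2 * pi * exp 1)"
    \<comment> \<open>The witness has two coordinates equal to d, so |y|^2 = 2 d^2 is at most half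
      the maximal squared radius M; the cap 1/2 keeps y_k below 1.\<close>
    define d where "d = min (1/2) (sqrt M / 2)"
    have M: "0 < M" by (simp add: M_def)
    have d: "0 < d" "d < 1" using M by (simp_all add: d_def min_less_iff_disj)
    have "d\<^sup>2 \<le> (sqrt M / 2)\<^sup>2" using d by (intro power_mono) (auto simp: d_def)
    then have d2: "d\<^sup>2 \<le> M / 4" using M by (simp add: power_divide)
    define y :: "real^'n" where "y = (\<chi> i. if i = k \<or> i = j then d else 0)"
    have "(norm y)\<^sup>2 = (\<Sum>i\<in>UNIV. (if i = k then d\<^sup>2 else 0) + (if i = j then d\<^sup>2 else 0))"
      unfolding norm_sq_cart using j by (intro sum.cong) (auto simp: y_def)
    then have "(norm y)\<^sup>2 = 2 * d\<^sup>2" by (simp add: sum.distrib)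
    then have "(norm y)\<^sup>2 < M" using d2 M by simp
    then have "(y, 1 / (4 * pi * exp 1)) \<in> U"
      using d by (simp add: U_def unit_heat_ball_def heat_radius_sq_max M_def y_def)
    then show ?thesis by blast
  qed
  ultimately have neg: "\<not> negligible U" by (rule open_not_negligible)
  have "limit_integral q k snd \<noteq> 0"
  proof
    assume "limit_integral q k snd = 0"
    then have "AE w in lborel. ?f w = 0"
      using integral_nonneg_eq_0_iff_AE[OF i] nn by (simp add: limit_integral_def)
    then have "AE w in lborel. w \<notin> U" by eventually_elim (use pos in force)
    then have "U \<in> null_sets lborel"
      using \<open>open U\<close> by (subst AE_iff_null_sets) auto
    then have "negligible U"
      by (simp add: negligible_iff_null_sets null_sets_completionI)
    with neg show False by contradiction
  qed
  moreover have "0 \<le> limit_integral q k snd"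
    unfolding limit_integral_def using nn by (intro integral_nonneg_AE AE_I2)
  ultimately show ?thesis by simp
qed

definition heat_quadratic :: "real ^ 'n ^ 'n \<Rightarrow> real \<Rightarrow> (real ^ 'n) \<times> real \<Rightarrow> real" where
  "heat_quadratic D c w = (fst w \<bullet> (D *v fst w)) / 2 - c * snd w"

lemma heat_quadratic_sum:
  "heat_quadratic D c w = (\<Sum>i\<in>UNIV. \<Sum>j\<in>UNIV. (D $ i $ j / 2) * (fst w $ i * fst w $ j)) - c * snd w"
  by (simp add: heat_quadratic_def inner_vec_def matrix_vector_mult_def sum_distrib_left sum_divide_distrib mult_ac)

text \<open>Mixed moments vanish, and the square moments are I, or (q - 1) I in direction k, which
  produces trace D + (q - 2) D_kk. Summing the same moments over all coordinates gives (N + q - 2) I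
  = 2 N L(s), which expresses I through the moment of s.\<close>

lemma limit_integral_quadratic:
  fixes k :: "'n::finite" and D :: "real^'n^'n"
  assumes N: "CARD('n) \<ge> 2" and q: "1 \<le> q"
  shows "limit_integral q k (\<lambda>w. heat_quadratic D c w - \<kappa>) =
    limit_integral q k snd * (real CARD('n) / (real CARD('n) + q - 2) * (trace D + (q - 2) * D $ k $ k) - c)
      - \<kappa> * limit_integral q k (\<lambda>_. 1)"
proof -
  let ?N = "real CARD('n)"
  let ?L = "limit_integral q k"
  let ?I = "potential_integral q k"
  let ?f = "\<lambda>g w. coord_weight q k (fst w) * (heat_weight (st_proj q k w) * g (st_proj q k w))"
  have i2: "integrable lborel (?f snd)"
    by (rule limit_integrable[OF N q, where C=1]) (use unit_heat_ball_time in force)+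
  have i1: "integrable lborel (?f (\<lambda>_. 1))"
    by (rule limit_integrable[OF N q, where C=1]) auto
  have iij: "integrable lborel (?f (\<lambda>w. fst w $ i * fst w $ j))" for i j
  proof (rule limit_integrable[OF N q, where C="?N * ?N"])
    fix w assume "w \<in> (unit_heat_ball :: ((real^'n) \<times> real) set)"
    then have "norm (fst w) \<le> ?N" using unit_heat_ball_norm(2)[of "fst w" "snd w"] by simp
    then have "\<bar>fst w $ i\<bar> \<le> ?N" for i using component_le_norm_cart[of "fst w" i] by linarith
    then show "\<bar>fst w $ i * fst w $ j\<bar> \<le> ?N * ?N" unfolding abs_mult by (intro mult_mono) auto
  qed measurable
  have Lij: "?L (\<lambda>w. fst w $ i * fst w $ j) = (if i = j then (if i = k then q - 1 else 1) * ?I else 0)" for i j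
    using limit_integral_square[OF N q, of k i] limit_integral_mixed[of i j q k]
    by (cases "i = j") (auto simp: power2_eq_square)
  have "?L (\<lambda>w. heat_quadratic D c w - \<kappa>) =
    (\<integral>w. (\<Sum>i\<in>UNIV. \<Sum>j\<in>UNIV. (D $ i $ j / 2) * ?f (\<lambda>w. fst w $ i * fst w $ j) w) - c * ?f snd w - \<kappa> * ?f (\<lambda>_. 1) w \<partial>lborel)"
    unfolding limit_integral_def
    by (intro Bochner_Integration.integral_cong refl)
       (simp add: heat_quadratic_sum right_diff_distrib sum_distrib_left mult_ac)
  also have "\<dots> = (\<Sum>i\<in>UNIV. \<Sum>j\<in>UNIV. (D $ i $ j / 2) * ?L (\<lambda>w. fst w $ i * fst w $ j)) - c * ?L snd - \<kappa> * ?L (\<lambda>_. 1)"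
    using i1 i2 iij
    by (simp add: limit_integral_def Bochner_Integration.integrable_sum Bochner_Integration.integral_sum
        Bochner_Integration.integral_diff Bochner_Integration.integrable_diff del: times_divide_eq_left)
  also have "(\<Sum>i\<in>UNIV. \<Sum>j\<in>UNIV. (D $ i $ j / 2) * ?L (\<lambda>w. fst w $ i * fst w $ j)) =
    (\<Sum>i\<in>UNIV. (D $ i $ i / 2) * ((if i = k then q - 1 else 1) * ?I))"
    unfolding Lij by (simp add: if_distrib[of "\<lambda>x. _ * x"] cong: if_cong)
  also have "\<dots> = (\<Sum>i\<in>UNIV. (?I / 2) * D $ i $ i + (if i = k then (?I / 2) * ((q - 2) * D $ k $ k) else 0))"
    by (intro sum.cong refl) (simp add: algebra_simps)
  also have "\<dots> = (?I / 2) * (trace D + (q - 2) * D $ k $ k)"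
    by (simp add: sum.distrib sum_distrib_left trace_def distrib_left)
  finally have eq: "?L (\<lambda>w. heat_quadratic D c w - \<kappa>) =
    (?I / 2) * (trace D + (q - 2) * D $ k $ k) - c * ?L snd - \<kappa> * ?L (\<lambda>_. 1)" .
  have "?L (\<lambda>w. (norm (fst w))\<^sup>2) = (\<integral>w. (\<Sum>i\<in>UNIV. ?f (\<lambda>w. fst w $ i * fst w $ i) w) \<partial>lborel)"
    unfolding limit_integral_def norm_sq_cart power2_eq_square[symmetric]
    by (intro Bochner_Integration.integral_cong refl) (simp add: sum_distrib_left)
  also have "\<dots> = (\<Sum>i\<in>UNIV. ?L (\<lambda>w. fst w $ i * fst w $ i))"
    using iij by (simp add: limit_integral_def Bochner_Integration.integral_sum)
  also have "\<dots> = (\<Sum>i\<in>UNIV. ?I + (if i = k then (q - 2) * ?I else 0))"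
    unfolding Lij by (intro sum.cong refl) (simp add: algebra_simps)
  also have "\<dots> = (?N + q - 2) * ?I"
    by (simp add: sum.distrib algebra_simps)
  finally have "(?N + q - 2) * ?I = 2 * ?N * ?L snd" using limit_integral_time[OF N q, of k] by simp
  moreover have "0 < ?N + q - 2" using N q by simp
  ultimately have I: "?I / 2 = ?L snd * (?N / (?N + q - 2))" by (simp add: field_simps)
  have "(L * F) * X - c * L - r = L * (F * X - c) - r" for L F X r :: real
    by (simp add: algebra_simps)
  then show ?thesis unfolding eq I by blast
qed

section \<open>First-order perturbation\<close>

lemma heat_majorant_integrable:
  assumes "CARD('n::finite) \<ge> 2"
  shows "integrable lborel (heat_majorant :: (real^'n) \<times> real \<Rightarrow> real)"
proof -
  fix k :: 'n
  let ?V = "indicator {- real CARD('n)..real CARD('n)} :: real \<Rightarrow> real"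
  have "integrable lborel (\<lambda>w. ?V (fst w $ k) * heat_majorant (drop_coord k (fst w), snd w))"
    by (rule integrable_heat_majorant[OF assms]) (auto simp: integrable_indicator_iff)
  then show ?thesis
  proof (rule Bochner_Integration.integrable_bound)
    show "AE w in lborel. norm (heat_majorant w) \<le> norm (?V (fst w $ k) * heat_majorant (drop_coord k (fst w), snd w))"
    proof (rule AE_I2)
      fix w :: "(real^'n) \<times> real"
      obtain y s where w: "w = (y, s)" by (cases w)
      show "norm (heat_majorant w) \<le> norm (?V (fst w $ k) * heat_majorant (drop_coord k (fst w), snd w))"
      proof (cases "w \<in> unit_heat_ball")
        case True
        then have "\<bar>y $ k\<bar> \<le> real CARD('n)"
          using unit_heat_ball_norm(2)[of y s] component_le_norm_cart[of y k] by (simp add: w)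
        then show ?thesis
          using heat_majorant_drop_coord[of y s k] heat_majorant_nonneg[of "(y, s)"]
          by (simp add: w abs_le_iff minus_le_iff)
      qed (simp add: heat_majorant_def)
    qed
  qed simp
qed

lemma heat_weight_integrable:
  assumes "CARD('n::finite) \<ge> 2"
  shows "integrable lborel (heat_weight :: (real^'n) \<times> real \<Rightarrow> real)"
  by (rule Bochner_Integration.integrable_bound[OF heat_majorant_integrable[OF assms]])
     (auto simp: heat_weight_bounds heat_majorant_nonneg intro!: AE_I2)

lemma axis_nth_same: "axis k (c::real) $ k = c"
  by (simp add: axis_def)

text \<open>A graph over the hyperplane meets each line parallel to the k-th axis in a single point,
  so it is null by slicing.\<close>

lemma AE_coord_neq:
  fixes k :: "'n::finite" and h :: "(real^'n) \<times> real \<Rightarrow> real"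
  assumes [measurable]: "h \<in> borel_measurable borel"
  shows "AE w in lborel. fst w $ k \<noteq> h (drop_coord k (fst w), snd w)"
proof -
  let ?A = "{w. fst w $ k = h (drop_coord k (fst w), snd w)}"
  let ?b = "(axis k 1, 0) :: (real^'n) \<times> real"
  have "{w \<in> space borel. fst w $ k = h (drop_coord k (fst w), snd w)} \<in> sets borel" by measurable
  then have [measurable]: "?A \<in> sets borel" by simp
  have "emeasure lborel ?A = (\<integral>\<^sup>+w. indicator ?A w \<partial>lborel)" by simp
  also have "\<dots> = (\<integral>\<^sup>+w. indicator {0..1} (w \<bullet> ?b) * (\<integral>\<^sup>+\<tau>. indicator ?A (w + (\<tau> - w \<bullet> ?b) *\<^sub>R ?b) \<partial>lborel) \<partial>lborel)"
    by (rule nn_integral_lborel_slice[OF _ st_dir_Basis]) simp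
  also have "\<dots> = (\<integral>\<^sup>+w. 0 \<partial>(lborel :: ((real^'n) \<times> real) measure))"
  proof (rule nn_integral_cong)
    fix w :: "(real^'n) \<times> real"
    have "drop_coord k (fst w + (\<tau> - fst w $ k) *\<^sub>R axis k 1) = drop_coord k (fst w)" for \<tau>
      by (simp add: vec_eq_iff axis_def)
    then have "(\<integral>\<^sup>+\<tau>. indicator ?A (w + (\<tau> - w \<bullet> ?b) *\<^sub>R ?b) \<partial>lborel) =
      (\<integral>\<^sup>+\<tau>. indicator {h (drop_coord k (fst w), snd w)} \<tau> \<partial>lborel)"
      by (intro nn_integral_cong) (simp only: inner_st_dir indicator_def fst_add snd_add fst_scaleR snd_scaleR
          vector_add_component vector_scaleR_component axis_nth_same fst_conv snd_conv mem_Collect_eq singleton_iff, simp)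
    also have "\<dots> = emeasure lborel {h (drop_coord k (fst w), snd w)}"
      by (rule nn_integral_indicator) simp
    finally show "indicator {0..1} (w \<bullet> ?b) * (\<integral>\<^sup>+\<tau>. indicator ?A (w + (\<tau> - w \<bullet> ?b) *\<^sub>R ?b) \<partial>lborel) = 0"
      by simp
  qed
  finally have "?A \<in> null_sets lborel" by (simp add: null_sets_def)
  then show ?thesis by (rule AE_I') auto
qed

text \<open>Dominates difference quotients of \<open>signed_powr\<close> also for r < 1, where the
  slope is unbounded at 0. If |d| \<le> |a| / 2, the mean value theorem applies at distance
  comparable to |a| from 0. Otherwise |a| < 2 |d| and the sizes of the two values suffice: |d|^(r-1)
  is controlled by |a|^(r-1) for r < 1, and by M^(r-1) for r \<ge> 1, which is why the summand 1 is
  there.\<close>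

lemma signed_powr_diff_bound:
  fixes r M :: real
  assumes r: "0 < r" and M: "0 \<le> M"
  obtains K where "0 \<le> K"
    "\<And>a d. a \<noteq> 0 \<Longrightarrow> \<bar>d\<bar> \<le> M \<Longrightarrow> \<bar>signed_powr r (a + d) - signed_powr r a\<bar> \<le> K * \<bar>d\<bar> * (\<bar>a\<bar> powr (r - 1) + 1)"
proof
  \<comment> \<open>\<open>K1\<close> serves |d| \<le> |a| / 2 and \<open>K2\<close> the opposite
    case. The power of 2 bounds (x / |a|)^(r-1) for x between |a| / 2 and 2 |a|, whatever the sign
    of r - 1.\<close>
  define K1 where "K1 = r * 2 powr \<bar>r - 1\<bar>"
  define K2 where "K2 = 2 * 3 powr r * (M powr (r - 1) + 2 powr \<bar>r - 1\<bar>)"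
  have K: "0 \<le> K1" "0 \<le> K2" using r by (simp_all add: K1_def K2_def)
  then show "0 \<le> K1 + K2" by simp
  fix a d :: real assume a: "a \<noteq> 0" and d: "\<bar>d\<bar> \<le> M"
  let ?D = "\<bar>signed_powr r (a + d) - signed_powr r a\<bar>"
  let ?A = "\<bar>a\<bar> powr (r - 1)"
  have p: "0 \<le> \<bar>d\<bar> * ?A" "0 \<le> \<bar>d\<bar>" by auto
  have "?D \<le> (K1 + K2) * (\<bar>d\<bar> * (?A + 1))"
  proof (cases "\<bar>d\<bar> \<le> \<bar>a\<bar> / 2")
    case True
    have sg: "sgn (a + d) = sgn a" using a True by (auto simp: sgn_if abs_if split: if_splits)
    have ab: "\<bar>\<bar>a + d\<bar> - \<bar>a\<bar>\<bar> \<le> \<bar>d\<bar>" by linarith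
    have adpos: "\<bar>a\<bar> / 2 \<le> \<bar>a + d\<bar>" "\<bar>a + d\<bar> \<le> 3 * \<bar>a\<bar> / 2" using True by linarith+
    have D: "?D = \<bar>\<bar>a + d\<bar> powr r - \<bar>a\<bar> powr r\<bar>"
      unfolding signed_powr_def sg right_diff_distrib[symmetric] abs_mult using a by (simp add: abs_sgn_eq)
    have "norm (\<bar>a + d\<bar> powr r - \<bar>a\<bar> powr r) \<le> (r * (?A * 2 powr \<bar>r - 1\<bar>)) * norm (\<bar>a + d\<bar> - \<bar>a\<bar>)"
    proof (rule field_differentiable_bound[where S="{\<bar>a\<bar> / 2..3 * \<bar>a\<bar> / 2}" and f'="\<lambda>x. r * x powr (r - 1)"])
      fix x assume x: "x \<in> {\<bar>a\<bar> / 2..3 * \<bar>a\<bar> / 2}"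
      have xp: "0 < x" using x a by auto
      show "((\<lambda>x. x powr r) has_field_derivative r * x powr (r - 1)) (at x within {\<bar>a\<bar> / 2..3 * \<bar>a\<bar> / 2})"
        using xp by (auto intro!: derivative_eq_intros simp: powr_diff)
      have t: "1 / 2 \<le> x / \<bar>a\<bar>" "x / \<bar>a\<bar> \<le> 2" using x a by (auto simp: field_simps)
      have "(x / \<bar>a\<bar>) powr (r - 1) \<le> 2 powr \<bar>r - 1\<bar>"
      proof (cases "1 \<le> r")
        case True
        then show ?thesis using t xp powr_mono2[of "r - 1" "x / \<bar>a\<bar>" 2] by simp
      next
        case False
        have "(x / \<bar>a\<bar>) powr (r - 1) \<le> (1 / 2) powr (r - 1)"
          using t False by (intro powr_mono2') auto
        also have "\<dots> = 2 powr \<bar>r - 1\<bar>" using False by (simp add: powr_divide powr_minus_divide[symmetric])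
        finally show ?thesis .
      qed
      then have "?A * (x / \<bar>a\<bar>) powr (r - 1) \<le> ?A * 2 powr \<bar>r - 1\<bar>" by (intro mult_left_mono) auto
      moreover have "?A * (x / \<bar>a\<bar>) powr (r - 1) = x powr (r - 1)"
        using a xp by (simp add: powr_mult[symmetric])
      ultimately show "norm (r * x powr (r - 1)) \<le> r * (?A * 2 powr \<bar>r - 1\<bar>)"
        using r by (simp add: abs_mult)
    qed (use adpos a in auto)
    also have "\<dots> \<le> (r * (?A * 2 powr \<bar>r - 1\<bar>)) * \<bar>d\<bar>" using ab r by (intro mult_left_mono) auto
    also have "\<dots> = K1 * (\<bar>d\<bar> * ?A)" by (simp add: K1_def)
    also have "\<dots> \<le> (K1 + K2) * (\<bar>d\<bar> * (?A + 1))" using K p by (intro mult_mono) (auto simp: distrib_left)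
    finally show ?thesis unfolding D by simp
  next
    case False
    then have d0: "0 < \<bar>d\<bar>" "\<bar>a\<bar> < 2 * \<bar>d\<bar>" by auto
    have "?D \<le> \<bar>a + d\<bar> powr r + \<bar>a\<bar> powr r" using abs_triangle_ineq4[of "signed_powr r (a + d)" "signed_powr r a"]
      by (simp add: abs_signed_powr)
    also have "\<dots> \<le> (3 * \<bar>d\<bar>) powr r + (3 * \<bar>d\<bar>) powr r"
      using d0 r by (intro add_mono powr_mono2) auto
    also have "\<dots> = 2 * 3 powr r * (\<bar>d\<bar> * \<bar>d\<bar> powr (r - 1))"
      using d0 powr_add[of "\<bar>d\<bar>" 1 "r - 1"] by (simp add: powr_mult)
    also have "\<bar>d\<bar> powr (r - 1) \<le> (M powr (r - 1) + 2 powr \<bar>r - 1\<bar>) * (?A + 1)"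
    proof (cases "1 \<le> r")
      case True
      then have "\<bar>d\<bar> powr (r - 1) \<le> M powr (r - 1)" using d by (intro powr_mono2) auto
      also have "\<dots> \<le> (M powr (r - 1) + 2 powr \<bar>r - 1\<bar>) * (?A + 1)"
        using mult_mono[of "M powr (r - 1)" "M powr (r - 1) + 2 powr \<bar>r - 1\<bar>" 1 "?A + 1"] by simp
      finally show ?thesis .
    next
      case False
      have "\<bar>d\<bar> powr (r - 1) \<le> (\<bar>a\<bar> / 2) powr (r - 1)"
        using d0 a False by (intro powr_mono2') auto
      also have "\<dots> = 2 powr \<bar>r - 1\<bar> * ?A"
        using False powr_add[of "2::real" "1 - r" "r - 1"] by (simp add: powr_divide field_simps)
      also have "\<dots> \<le> (M powr (r - 1) + 2 powr \<bar>r - 1\<bar>) * (?A + 1)"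
        by (intro mult_mono) auto
      finally show ?thesis .
    qed
    then have "2 * 3 powr r * (\<bar>d\<bar> * \<bar>d\<bar> powr (r - 1)) \<le> 2 * 3 powr r * (\<bar>d\<bar> * ((M powr (r - 1) + 2 powr \<bar>r - 1\<bar>) * (?A + 1)))"
      by (intro mult_left_mono) auto
    also have "\<dots> = K2 * (\<bar>d\<bar> * (?A + 1))" by (simp add: K2_def mult_ac)
    also have "\<dots> \<le> (K1 + K2) * (\<bar>d\<bar> * (?A + 1))" using K by (intro mult_right_mono) auto
    finally show ?thesis .
  qed
  then show "?D \<le> (K1 + K2) * \<bar>d\<bar> * (?A + 1)" by (simp add: mult.assoc)
qed

lemma signed_powr_derivative:
  assumes "a \<noteq> 0"
  shows "(signed_powr r has_field_derivative r * \<bar>a\<bar> powr (r - 1)) (at a)"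
proof (cases "0 < a")
  case True
  have "((\<lambda>x. x powr r) has_field_derivative r * \<bar>a\<bar> powr (r - 1)) (at a)"
    using True by (auto intro!: derivative_eq_intros simp: powr_diff)
  then show ?thesis
  proof (rule has_field_derivative_transform_within_open[where S="{0<..}"])
  qed (use True in \<open>auto simp: signed_powr_def\<close>)
next
  case False
  then have a: "a < 0" using assms by simp
  have "((\<lambda>x. - ((- x) powr r)) has_field_derivative r * \<bar>a\<bar> powr (r - 1)) (at a)"
    using a by (auto intro!: derivative_eq_intros simp: powr_diff)
  then show ?thesis
  proof (rule has_field_derivative_transform_within_open[where S="{..<0}"])
  qed (use a in \<open>auto simp: signed_powr_def\<close>)
qed

text \<open>Up to null sets the integrand is 2 sgn(c) between 0 and - c / b and zero elsewhere. It
  replaces the derivative when q = 1: the jump 2 of \<open>sgn\<close> over the slope b.\<close>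

lemma sgn_shift_integral:
  fixes b c :: real
  assumes b: "0 < b"
  shows "(\<integral>\<tau>. sgn (b * \<tau> + c) - sgn \<tau> \<partial>lborel) = 2 / b * c"
proof -
  have s: "sgn (b * \<tau> + c) = sgn (\<tau> + c / b)" for \<tau>
  proof -
    have "b * \<tau> + c = b * (\<tau> + c / b)" using b by (simp add: field_simps)
    then show ?thesis using b by (simp only: sgn_mult) simp
  qed
  have ae: "AE \<tau> in lborel. \<tau> \<noteq> 0 \<and> \<tau> \<noteq> - (c / b)"
    using AE_lborel_singleton[of 0] AE_lborel_singleton[of "- (c / b)"] by eventually_elim simp
  have "(\<integral>\<tau>. sgn (b * \<tau> + c) - sgn \<tau> \<partial>lborel) =
    (\<integral>\<tau>. 2 * indicator {- (c / b)..0} \<tau> - 2 * indicator {0..- (c / b)} \<tau> \<partial>lborel)"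
    unfolding s
  proof (rule integral_cong_AE)
    show "AE \<tau> in lborel. sgn (\<tau> + c / b) - sgn \<tau> = 2 * indicator {- (c / b)..0} \<tau> - 2 * indicator {0..- (c / b)} \<tau>"
      using ae by eventually_elim (auto simp: sgn_if indicator_def)
  qed auto
  also have "\<dots> = 2 * max 0 (c / b) - 2 * max 0 (- (c / b))"
    by (subst Bochner_Integration.integral_diff) (auto simp: integrable_indicator_iff max_def emeasure_lborel_Icc_eq)
  also have "\<dots> = 2 / b * c" by (auto simp: max_def)
  finally show ?thesis .
qed


text \<open>Null sequences stand in for \<epsilon> \<rightarrow> 0 because dominated convergence
  speaks of sequences. \<open>G n\<close> is the rescaled remainder of the test function; its
  convergence to \<open>g\<close> is uniform on the ball and asserts nothing outside.\<close>

locale perturbation =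
  fixes k :: "'n::finite" and q b C :: real
    and g :: "(real ^ 'n) \<times> real \<Rightarrow> real" and G :: "nat \<Rightarrow> (real ^ 'n) \<times> real \<Rightarrow> real"
    and e :: "nat \<Rightarrow> real"
  assumes dim: "CARD('n) \<ge> 2" and q: "1 \<le> q" and b: "0 < b"
    and g_cont: "continuous_on UNIV g"
    and G_measurable [measurable]: "\<And>n. G n \<in> borel_measurable borel"
    and g_bound: "\<And>w. w \<in> unit_heat_ball \<Longrightarrow> \<bar>g w\<bar> \<le> C"
    and G_bound: "\<And>n w. w \<in> unit_heat_ball \<Longrightarrow> \<bar>G n w\<bar> \<le> C"
    and G_uniform: "\<And>\<delta>. 0 < \<delta> \<Longrightarrow> \<forall>\<^sub>F n in sequentially. \<forall>w\<in>unit_heat_ball. \<bar>G n w - g w\<bar> \<le> \<delta>"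
    and e_pos: "\<And>n. 0 < e n" and e_le: "\<And>n. e n \<le> 1" and e_lim: "e \<longlonglongrightarrow> 0"
begin

lemma g_measurable [measurable]: "g \<in> borel_measurable borel"
  by (rule borel_measurable_continuous_onI[OF g_cont])

lemma C_nonneg: "0 \<le> C"
  using g_bound[OF unit_heat_ball_nonempty] by linarith

lemma heat_weight_mult_le:
  assumes "\<bar>u\<bar> \<le> v" "0 \<le> v"
  shows "\<bar>heat_weight w * u\<bar> \<le> heat_majorant w * v"
  unfolding abs_mult using assms heat_weight_bounds[of w] by (intro mult_mono) auto

text \<open>The unperturbed integral is zero by reflection in y_k, so the quotient is a true
  difference quotient under the integral; \<open>signed_powr_diff_bound\<close> dominates it and the
  derivative of \<open>signed_powr\<close> is its limit.\<close>

lemma limit_regular: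
  assumes q1: "q \<noteq> 1"
  shows "(\<lambda>n. (\<integral>w. heat_weight w * signed_powr (q - 1) (b * fst w $ k + e n * G n w) \<partial>lborel) / e n)
    \<longlonglongrightarrow> (q - 1) * b powr (q - 2) * limit_integral q k g"
proof -
  let ?N = "real CARD('n)"
  let ?S = "signed_powr (q - 1)"
  have q1': "0 < q - 1" using q1 q by simp
  have comp: "\<bar>fst w $ k\<bar> \<le> ?N" if "w \<in> unit_heat_ball" for w :: "(real^'n) \<times> real"
    using unit_heat_ball_norm(2)[of "fst w" "snd w"] component_le_norm_cart[of "fst w" k] that by simp
  obtain K where K: "0 \<le> K" "\<And>a d. a \<noteq> 0 \<Longrightarrow> \<bar>d\<bar> \<le> C \<Longrightarrow> \<bar>?S (a + d) - ?S a\<bar> \<le> K * \<bar>d\<bar> * (\<bar>a\<bar> powr (q - 1 - 1) + 1)"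
    using signed_powr_diff_bound[OF q1' C_nonneg] by blast
  have eG: "\<bar>e n * G n w\<bar> \<le> e n * C" if "w \<in> unit_heat_ball" for n w
    using G_bound[OF that] e_pos[of n] by (simp add: abs_mult)
  have eC: "e n * C \<le> C" for n using e_le[of n] C_nonneg by (simp add: mult_left_le_one_le e_pos less_imp_le)
  have hw: "integrable lborel (heat_weight :: (real^'n) \<times> real \<Rightarrow> real)" by (rule heat_weight_integrable[OF dim])
  have S_bound: "\<bar>?S a\<bar> \<le> M powr (q - 1)" if "\<bar>a\<bar> \<le> M" for a M
    using that q1' by (simp add: abs_signed_powr powr_mono2)
  have int: "integrable lborel (\<lambda>w. heat_weight w * ?S (b * fst w $ k + f w))"
    if [measurable]: "f \<in> borel_measurable borel" and f: "\<And>w. w \<in> unit_heat_ball \<Longrightarrow> \<bar>f w\<bar> \<le> C" for f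
  proof (rule Bochner_Integration.integrable_bound)
    show "integrable lborel (\<lambda>w::(real^'n) \<times> real. heat_weight w * (b * ?N + C) powr (q - 1))" using hw by simp
    show "AE w in lborel. norm (heat_weight w * ?S (b * fst w $ k + f w)) \<le> norm (heat_weight w * (b * ?N + C) powr (q - 1))"
    proof (rule AE_I2)
      fix w :: "(real^'n) \<times> real"
      show "norm (heat_weight w * ?S (b * fst w $ k + f w)) \<le> norm (heat_weight w * (b * ?N + C) powr (q - 1))"
      proof (cases "w \<in> unit_heat_ball")
        case True
        have "\<bar>b * fst w $ k\<bar> \<le> b * ?N" using comp[OF True] b by (simp add: abs_mult)
        then have "\<bar>b * fst w $ k + f w\<bar> \<le> b * ?N + C" using f[OF True] by linarith
        then show ?thesis using S_bound by (simp add: abs_mult mult_left_mono)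
      qed (simp add: heat_weight_def)
    qed
  qed measurable
  have zero: "(\<integral>w. heat_weight w * ?S (b * fst w $ k) \<partial>lborel) = 0"
  proof -
    let ?f = "\<lambda>w. heat_weight w * ?S (b * fst w $ k)"
    have "(\<integral>w. ?f w \<partial>lborel) = \<bar>- 1\<bar> * (\<integral>w. ?f (scale_coord k (- 1) w) \<partial>lborel)"
      by (rule integral_scale_coord) auto
    also have "\<dots> = - (\<integral>w. ?f w \<partial>lborel)"
      by (simp add: heat_weight_reflect fst_scale_coord_nth signed_powr_minus)
    finally show ?thesis by simp
  qed
  let ?Q = "\<lambda>n w. heat_weight w * ((?S (b * fst w $ k + e n * G n w) - ?S (b * fst w $ k)) / e n)"
  have ae: "AE w in (lborel :: ((real^'n) \<times> real) measure). fst w $ k \<noteq> 0"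
    using AE_coord_neq[of "\<lambda>_. 0" k] by simp
  have "(\<lambda>n. \<integral>w. ?Q n w \<partial>lborel) \<longlonglongrightarrow>
    (\<integral>w. heat_weight w * (((q - 1) * \<bar>b * fst w $ k\<bar> powr (q - 2)) * g w) \<partial>lborel)"
  proof (rule integral_dominated_convergence[where
        w="\<lambda>w. K * C * b powr (q - 2) * (coord_weight q k (fst w) * heat_majorant (st_proj q k w)) + K * C * heat_majorant w"])
    show "integrable lborel (\<lambda>w. K * C * b powr (q - 2) * (coord_weight q k (fst w) * heat_majorant (st_proj q k w)) + K * C * heat_majorant w)"
      by (intro Bochner_Integration.integrable_add integrable_mult_right limit_majorant_integrable dim q heat_majorant_integrable)
    show "AE w in lborel. norm (?Q n w) \<le>
      K * C * b powr (q - 2) * (coord_weight q k (fst w) * heat_majorant (st_proj q k w)) + K * C * heat_majorant w" for n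
      using ae
    proof eventually_elim
      case (elim w)
      have P: "st_proj q k w = w" using q1 by (simp add: st_proj_def)
      have cw: "coord_weight q k (fst w) = \<bar>fst w $ k\<bar> powr (q - 2)" using q1 by (simp add: coord_weight_def)
      let ?a = "b * fst w $ k"
      have nonneg: "0 \<le> K * C * (\<bar>?a\<bar> powr (q - 2) + 1)" using K C_nonneg by simp
      have "\<bar>?Q n w\<bar> \<le> heat_majorant w * (K * C * (\<bar>?a\<bar> powr (q - 2) + 1))"
      proof (cases "w \<in> unit_heat_ball")
        case True
        have "\<bar>?S (?a + e n * G n w) - ?S ?a\<bar> \<le> K * \<bar>e n * G n w\<bar> * (\<bar>?a\<bar> powr (q - 1 - 1) + 1)"
          using elim b eG[OF True, of n] eC[of n] by (intro K(2)) auto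
        also have "\<dots> \<le> K * (e n * C) * (\<bar>?a\<bar> powr (q - 1 - 1) + 1)"
          using eG[OF True] K by (intro mult_right_mono mult_left_mono) auto
        finally have "\<bar>(?S (?a + e n * G n w) - ?S ?a) / e n\<bar> \<le> K * C * (\<bar>?a\<bar> powr (q - 2) + 1)"
          using e_pos[of n] by (simp add: field_simps)
        then show ?thesis using nonneg by (rule heat_weight_mult_le)
      qed (simp add: heat_weight_def heat_majorant_def)
      also have "\<dots> = K * C * b powr (q - 2) * (coord_weight q k (fst w) * heat_majorant (st_proj q k w)) + K * C * heat_majorant w"
        using b unfolding P cw by (simp add: abs_mult powr_mult algebra_simps)
      finally show ?case by simp
    qed
    show "AE w in lborel. (\<lambda>n. ?Q n w) \<longlonglongrightarrow> heat_weight w * (((q - 1) * \<bar>b * fst w $ k\<bar> powr (q - 2)) * g w)"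
      using ae
    proof eventually_elim
      case (elim w)
      let ?a = "b * fst w $ k"
      have a0: "?a \<noteq> 0" using elim b by simp
      show ?case
      proof (cases "w \<in> unit_heat_ball")
        case True
        \<comment> \<open>The Caratheodory form of the derivative avoids dividing by the increment,
          which may vanish.\<close>
        obtain h where h: "\<And>z. ?S z - ?S ?a = h z * (z - ?a)" "isCont h ?a" "h ?a = (q - 1) * \<bar>?a\<bar> powr (q - 1 - 1)"
          using signed_powr_derivative[OF a0, of "q - 1"] unfolding CARAT_DERIV by blast
        have Glim: "(\<lambda>n. G n w) \<longlonglongrightarrow> g w"
        proof (rule LIMSEQ_I)
          fix r :: real assume "0 < r"
          then have "\<forall>\<^sub>F n in sequentially. \<bar>G n w - g w\<bar> \<le> r / 2"
            using G_uniform[of "r / 2"] True by (auto elim!: eventually_mono)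
          then have "\<forall>\<^sub>F n in sequentially. norm (G n w - g w) < r"
            by eventually_elim (use \<open>0 < r\<close> in auto)
          then show "\<exists>no. \<forall>n\<ge>no. norm (G n w - g w) < r" by (simp add: eventually_sequentially)
        qed
        have "(\<lambda>n. ?a + e n * G n w) \<longlonglongrightarrow> ?a + 0 * g w"
          by (intro tendsto_intros e_lim Glim)
        then have "(\<lambda>n. h (?a + e n * G n w)) \<longlonglongrightarrow> h ?a"
          by (intro isCont_tendsto_compose[OF h(2)]) simp
        then have "(\<lambda>n. heat_weight w * (h (?a + e n * G n w) * G n w)) \<longlonglongrightarrow> heat_weight w * (h ?a * g w)"
          by (intro tendsto_intros Glim)
        moreover have "h (?a + e n * G n w) * G n w = (?S (?a + e n * G n w) - ?S ?a) / e n" for n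
          unfolding h(1) using e_pos[of n] by simp
        ultimately show ?thesis by (simp add: h(3))
      qed (simp add: heat_weight_def)
    qed
  qed measurable
  moreover have "(\<integral>w. ?Q n w \<partial>lborel) = (\<integral>w. heat_weight w * ?S (b * fst w $ k + e n * G n w) \<partial>lborel) / e n" for n
  proof -
    have i1: "integrable lborel (\<lambda>w. heat_weight w * ?S (b * fst w $ k + e n * G n w))"
      by (rule int) (use order_trans[OF eG eC] in auto)
    have i2: "integrable lborel (\<lambda>w. heat_weight w * ?S (b * fst w $ k))"
      using int[of "\<lambda>_. 0"] C_nonneg by simp
    have "(\<integral>w. ?Q n w \<partial>lborel) = (\<integral>w. (heat_weight w * ?S (b * fst w $ k + e n * G n w) - heat_weight w * ?S (b * fst w $ k)) / e n \<partial>lborel)"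
      by (intro Bochner_Integration.integral_cong refl) (simp add: algebra_simps)
    then show ?thesis using i1 i2 zero by simp
  qed
  moreover have "(\<integral>w. heat_weight w * (((q - 1) * \<bar>b * fst w $ k\<bar> powr (q - 2)) * g w) \<partial>lborel) =
    (q - 1) * b powr (q - 2) * limit_integral q k g"
  proof -
    have "heat_weight w * (((q - 1) * \<bar>b * fst w $ k\<bar> powr (q - 2)) * g w) =
      (q - 1) * b powr (q - 2) * (coord_weight q k (fst w) * (heat_weight (st_proj q k w) * g (st_proj q k w)))" for w
      using b q1 by (simp add: st_proj_def coord_weight_def abs_mult powr_mult)
    then show ?thesis by (simp only: limit_integral_def integral_mult_right_zero)
  qed
  ultimately show ?thesis by (simp only:)
qed

text \<open>For q = 1 the sign changes only in a layer of thickness of order \<open>e n\<close>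
  around y_k = 0, so no pointwise derivative captures it. Dilating y_k by \<open>e n\<close> gives
  the layer a fixed thickness and absorbs the division by \<open>e n\<close>; in the limit all other
  data sit on the hyperplane, and slicing leaves the integral of
  \<open>sgn_shift_integral\<close>.\<close>

lemma limit_median:
  assumes q1: "q = 1"
  shows "(\<lambda>n. (\<integral>w. heat_weight w * signed_powr (q - 1) (b * fst w $ k + e n * G n w) \<partial>lborel) / e n)
    \<longlonglongrightarrow> 2 / b * limit_integral q k g"
proof -
  have S: "signed_powr (q - 1) = sgn" using q1 by (auto simp: signed_powr_def fun_eq_iff sgn_if)
  have P: "st_proj q k w = (drop_coord k (fst w), snd w)" for w using q1 by (simp add: st_proj_def)
  have hw: "integrable lborel (heat_weight :: (real^'n) \<times> real \<Rightarrow> real)" by (rule heat_weight_integrable[OF dim])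
  have int: "integrable lborel (\<lambda>w. heat_weight w * sgn (f w))"
    if [measurable]: "f \<in> borel_measurable borel" for f :: "(real^'n) \<times> real \<Rightarrow> real"
    by (rule Bochner_Integration.integrable_bound[OF hw]) (auto simp: abs_mult sgn_if intro!: AE_I2)
  have zero: "(\<integral>w. heat_weight w * sgn (fst w $ k) \<partial>lborel) = 0"
  proof -
    let ?f = "\<lambda>w. heat_weight w * sgn (fst w $ k)"
    have "(\<integral>w. ?f w \<partial>lborel) = \<bar>- 1\<bar> * (\<integral>w. ?f (scale_coord k (- 1) w) \<partial>lborel)"
      by (rule integral_scale_coord) auto
    also have "\<dots> = - (\<integral>w. ?f w \<partial>lborel)"
      by (simp add: heat_weight_reflect fst_scale_coord_nth sgn_minus)
    finally show ?thesis by simp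
  qed
  let ?T = "\<lambda>n. scale_coord k (e n)"
  have dropT: "drop_coord k (fst (?T n w)) = drop_coord k (fst w)" for n w
    by (simp add: vec_eq_iff fst_scale_coord_nth)
  have T_ball: "st_proj q k w \<in> unit_heat_ball" if "?T n w \<in> unit_heat_ball" for n w
    using drop_coord_unit_heat_ball[of "fst (?T n w)" "snd (?T n w)" k] that unfolding prod.collapse by (simp add: P dropT)
  let ?Q = "\<lambda>n w. heat_weight (?T n w) * (sgn (b * fst w $ k + G n (?T n w)) - sgn (fst w $ k))"
  let ?L = "\<lambda>w. heat_weight (st_proj q k w) * (sgn (b * fst w $ k + g (st_proj q k w)) - sgn (fst w $ k))"
  let ?M = "\<lambda>w. 2 * (indicator {- (C / b)..C / b} (fst w $ k) * heat_majorant (drop_coord k (fst w), snd w))"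
  have M: "integrable lborel ?M"
    by (intro integrable_mult_right integrable_heat_majorant dim)
       (auto simp: integrable_indicator_iff emeasure_lborel_Icc_eq)
  have M0: "0 \<le> ?M w" for w by (simp add: heat_majorant_nonneg)
  have bound: "\<bar>heat_weight v * (sgn (b * y + \<gamma>) - sgn y)\<bar> \<le> 2 * (indicator {- (C / b)..C / b} y * heat_majorant v)"
    if "v \<in> unit_heat_ball \<Longrightarrow> \<bar>\<gamma>\<bar> \<le> C" for v y \<gamma>
  proof (cases "v \<in> unit_heat_ball")
    case True
    have "\<bar>sgn (b * y + \<gamma>) - sgn y\<bar> \<le> 2 * indicator {- (C / b)..C / b} y"
    proof (cases "y \<in> {- (C / b)..C / b}")
      case True
      then show ?thesis by (simp add: sgn_if)
    next
      case False
      \<comment> \<open>Beyond |y| = C / b the linear term dominates the perturbation, so the sign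
        does not change.\<close>
      moreover have "0 \<le> C / b" using C_nonneg b by simp
      ultimately have "C / b < \<bar>y\<bar>" by (auto simp: abs_if)
      then have "C < b * \<bar>y\<bar>" using b by (simp add: pos_divide_less_eq mult.commute)
      then have "\<bar>\<gamma>\<bar> < \<bar>b * y\<bar>" using that[OF \<open>v \<in> unit_heat_ball\<close>] b by (simp add: abs_mult)
      then have "sgn (b * y + \<gamma>) = sgn (b * y)" by (auto simp: sgn_if abs_if split: if_splits)
      then show ?thesis using b False by (simp add: sgn_mult)
    qed
    then have "\<bar>heat_weight v * (sgn (b * y + \<gamma>) - sgn y)\<bar> \<le> heat_majorant v * (2 * indicator {- (C / b)..C / b} y)"
      by (rule heat_weight_mult_le) simp
    then show ?thesis by (simp add: mult_ac)
  qed (simp add: heat_weight_def heat_majorant_nonneg)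
  \<comment> \<open>Off this null graph the limiting argument of \<open>sgn\<close> is nonzero, so
    \<open>sgn\<close> is continuous there.\<close>
  have g_eq: "AE w in lborel. fst w $ k \<noteq> - (g (drop_coord k (fst w), snd w) / b)"
    using AE_coord_neq[of "\<lambda>v. - (g v / b)" k] by simp
  have "(\<lambda>n. \<integral>w. ?Q n w \<partial>lborel) \<longlonglongrightarrow> (\<integral>w. ?L w \<partial>lborel)"
  proof (rule integral_dominated_convergence[where w="?M"])
    show "AE w in lborel. norm (?Q n w) \<le> ?M w" for n
    proof (rule AE_I2)
      fix w :: "(real^'n) \<times> real"
      have "\<bar>?Q n w\<bar> \<le> 2 * (indicator {- (C / b)..C / b} (fst w $ k) * heat_majorant (?T n w))"
        by (rule bound) (rule G_bound)
      also have "\<dots> \<le> ?M w"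
        using heat_majorant_drop_coord[of "fst (?T n w)" "snd (?T n w)" k]
        unfolding prod.collapse dropT by (intro mult_left_mono) simp_all
      finally show "norm (?Q n w) \<le> ?M w" by simp
    qed
    show "AE w in lborel. (\<lambda>n. ?Q n w) \<longlonglongrightarrow> ?L w"
      using g_eq
    proof eventually_elim
      case (elim w)
      show ?case
      proof (cases "st_proj q k w \<in> unit_heat_ball")
        case False
        \<comment> \<open>The ball is stable under dropping y_k, so every point of the line over an
          exterior projection is exterior.\<close>
        then have "?T n w \<notin> unit_heat_ball" for n using T_ball by blast
        then show ?thesis using False by (simp add: heat_weight_def)
      next
        case True
        have "?T n w = st_proj q k w + (e n * fst w $ k) *\<^sub>R (axis k 1, 0)" for n
          by (simp add: P scale_coord_def drop_coord_def prod_eq_iff algebra_simps)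
        moreover have "(\<lambda>n. st_proj q k w + (e n * fst w $ k) *\<^sub>R (axis k 1, 0)) \<longlonglongrightarrow> st_proj q k w + (0 * fst w $ k) *\<^sub>R (axis k 1, 0)"
          by (intro tendsto_intros e_lim)
        ultimately have Tlim: "(\<lambda>n. ?T n w) \<longlonglongrightarrow> st_proj q k w" by (simp add: zero_prod_def[symmetric])
        then have ev: "\<forall>\<^sub>F n in sequentially. ?T n w \<in> unit_heat_ball"
          using open_unit_heat_ball True by (rule topological_tendstoD)
        have wlim: "(\<lambda>n. heat_weight (?T n w)) \<longlonglongrightarrow> heat_weight (st_proj q k w)"
        proof (rule Lim_transform_eventually)
          show "(\<lambda>n. (norm (fst (?T n w)))\<^sup>2 / (snd w)\<^sup>2) \<longlonglongrightarrow> heat_weight (st_proj q k w)"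
            using True unit_heat_ball_snd_pos[OF True] tendsto_fst[OF Tlim]
            by (auto simp: heat_weight_def intro!: tendsto_intros)
          show "\<forall>\<^sub>F n in sequentially. (norm (fst (?T n w)))\<^sup>2 / (snd w)\<^sup>2 = heat_weight (?T n w)"
            using ev by eventually_elim (simp add: heat_weight_def)
        qed
        have glim: "(\<lambda>n. g (?T n w)) \<longlonglongrightarrow> g (st_proj q k w)"
          by (rule isCont_tendsto_compose[OF _ Tlim])
             (use g_cont in \<open>simp only: continuous_on_eq_continuous_at[OF open_UNIV] UNIV_I\<close>)
        have "(\<lambda>n. G n (?T n w) - g (?T n w)) \<longlonglongrightarrow> 0"
        proof (rule LIMSEQ_I)
          fix r :: real assume "0 < r"
          have "\<forall>\<^sub>F n in sequentially. norm (G n (?T n w) - g (?T n w) - 0) < r"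
            using G_uniform[OF half_gt_zero[OF \<open>0 < r\<close>]] ev
            by eventually_elim (use \<open>0 < r\<close> in force)
          then show "\<exists>no. \<forall>n\<ge>no. norm (G n (?T n w) - g (?T n w) - 0) < r" by (simp add: eventually_sequentially)
        qed
        from tendsto_add[OF this glim] have Glim: "(\<lambda>n. G n (?T n w)) \<longlonglongrightarrow> g (st_proj q k w)" by simp
        have nz: "b * fst w $ k + g (st_proj q k w) \<noteq> 0" using elim b by (auto simp: P field_simps)
        have slim: "(\<lambda>n. sgn (b * fst w $ k + G n (?T n w))) \<longlonglongrightarrow> sgn (b * fst w $ k + g (st_proj q k w))"
          by (intro tendsto_sgn tendsto_intros Glim nz)
        show ?thesis by (intro tendsto_mult wlim tendsto_diff slim tendsto_const)
      qed
    qed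
  qed (use M in \<open>simp_all\<close>)
  moreover have "(\<integral>w. ?Q n w \<partial>lborel) = (\<integral>w. heat_weight w * signed_powr (q - 1) (b * fst w $ k + e n * G n w) \<partial>lborel) / e n" for n
  proof -
    let ?f = "\<lambda>w. heat_weight w * (sgn (b * fst w $ k + e n * G n w) - sgn (fst w $ k))"
    have "(\<integral>w. ?f w \<partial>lborel) = \<bar>e n\<bar> * (\<integral>w. ?f (?T n w) \<partial>lborel)"
      using e_pos[of n] by (intro integral_scale_coord) auto
    also have "(\<lambda>w. ?f (?T n w)) = ?Q n"
    proof
      fix w
      \<comment> \<open>After the dilation \<open>e n\<close> is a common positive factor, which
        \<open>sgn\<close> ignores.\<close>
      have 1: "b * (e n * fst w $ k) + e n * G n (?T n w) = e n * (b * fst w $ k + G n (?T n w))"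
        by (simp add: algebra_simps)
      show "?f (?T n w) = ?Q n w"
        using e_pos[of n] by (simp add: fst_scale_coord_nth 1 sgn_mult del: distrib_left)
    qed
    finally have "(\<integral>w. ?Q n w \<partial>lborel) = (\<integral>w. ?f w \<partial>lborel) / e n" using e_pos[of n] by simp
    also have "(\<integral>w. ?f w \<partial>lborel) = (\<integral>w. heat_weight w * sgn (b * fst w $ k + e n * G n w) \<partial>lborel) - (\<integral>w. heat_weight w * sgn (fst w $ k) \<partial>lborel)"
      unfolding right_diff_distrib by (intro Bochner_Integration.integral_diff int) measurable
    finally show ?thesis by (simp add: zero S)
  qed
  moreover have "(\<integral>w. ?L w \<partial>lborel) = 2 / b * limit_integral q k g"
  proof -
    let ?b = "(axis k 1, 0) :: (real^'n) \<times> real"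
    have "integrable lborel ?L"
    proof (rule Bochner_Integration.integrable_bound[OF M])
      show "AE w in lborel. norm (?L w) \<le> norm (?M w)"
      proof (rule AE_I2)
        fix w :: "(real^'n) \<times> real"
        have "\<bar>?L w\<bar> \<le> 2 * (indicator {- (C / b)..C / b} (fst w $ k) * heat_majorant (st_proj q k w))"
          by (rule bound) (rule g_bound)
        then show "norm (?L w) \<le> norm (?M w)" using M0[of w] by (simp add: P)
      qed
    qed measurable
    then have "(\<integral>w. ?L w \<partial>lborel) =
      (\<integral>w. indicator {0..1} (w \<bullet> ?b) * (\<integral>\<tau>. ?L (w + (\<tau> - w \<bullet> ?b) *\<^sub>R ?b) \<partial>lborel) \<partial>lborel)"
      by (rule lborel_slice_integral[OF st_dir_Basis])
    also have "\<dots> = (\<integral>w. 2 / b * (coord_weight q k (fst w) * (heat_weight (st_proj q k w) * g (st_proj q k w))) \<partial>lborel)"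
    proof (rule Bochner_Integration.integral_cong)
      fix w :: "(real^'n) \<times> real"
      have d: "drop_coord k (fst w + (\<tau> - fst w $ k) *\<^sub>R axis k 1) = drop_coord k (fst w)" for \<tau>
        by (simp add: vec_eq_iff axis_def)
      have "?L (w + (\<tau> - w \<bullet> ?b) *\<^sub>R ?b) = heat_weight (st_proj q k w) * (sgn (b * \<tau> + g (st_proj q k w)) - sgn \<tau>)" for \<tau>
        by (simp only: inner_st_dir P d fst_add snd_add fst_scaleR snd_scaleR fst_conv snd_conv
            vector_add_component vector_scaleR_component axis_nth_same) simp
      then have "(\<integral>\<tau>. ?L (w + (\<tau> - w \<bullet> ?b) *\<^sub>R ?b) \<partial>lborel) = heat_weight (st_proj q k w) * (2 / b * g (st_proj q k w))"
        by (simp only: integral_mult_right_zero sgn_shift_integral[OF b])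
      then show "indicator {0..1} (w \<bullet> ?b) * (\<integral>\<tau>. ?L (w + (\<tau> - w \<bullet> ?b) *\<^sub>R ?b) \<partial>lborel) =
        2 / b * (coord_weight q k (fst w) * (heat_weight (st_proj q k w) * g (st_proj q k w)))"
        unfolding inner_st_dir using q1 by (simp add: coord_weight_def)
    qed simp
    also have "\<dots> = 2 / b * limit_integral q k g" by (simp add: limit_integral_def)
    finally show ?thesis .
  qed
  ultimately show ?thesis by (simp only:)
qed

text \<open>The constant depends on q and b, but only its positivity is used afterwards.\<close>

lemma limit_signed:
  "\<exists>c>0. (\<lambda>n. (\<integral>w. heat_weight w * signed_powr (q - 1) (b * fst w $ k + e n * G n w) \<partial>lborel) / e n)
    \<longlonglongrightarrow> c * limit_integral q k g"
proof (cases "q = 1")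
  case True
  then show ?thesis using limit_median b by (intro exI[of _ "2 / b"]) simp
next
  case False
  then show ?thesis using limit_regular b q by (intro exI[of _ "(q - 1) * b powr (q - 2)"]) simp
qed

end

section \<open>Second-order expansion of test functions\<close>

lemma grad_inner:
  assumes "(f has_derivative D) (at x)"
  shows "grad f x \<bullet> a = D a"
proof -
  have lin: "linear D" using assms by (rule has_derivative_linear)
  have D: "frechet_derivative f (at x) = D" using frechet_derivative_at[OF assms] by simp
  have "D a = D (\<Sum>i\<in>UNIV. (a $ i) *\<^sub>R axis i 1)"
    using basis_expansion[of a] by (simp add: scalar_mult_eq_scaleR)
  also have "\<dots> = (\<Sum>i\<in>UNIV. a $ i * D (axis i 1))"
    by (simp add: linear_sum[OF lin] linear_scale[OF lin])
  finally show ?thesis by (simp add: grad_def D inner_vec_def mult.commute)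
qed

lemma space_slice_derivative:
  assumes "(\<phi> has_derivative D) (at (y, t))"
  shows "((\<lambda>y. \<phi> (y, t)) has_derivative (\<lambda>h. D (h, 0))) (at y)"
proof -
  have "((\<lambda>y. (y, t)) has_derivative (\<lambda>h. (h, 0))) (at y)"
    by (auto intro!: derivative_eq_intros)
  from has_derivative_compose[OF this, of \<phi> D] assms show ?thesis by simp
qed

lemma space_grad_inner:
  assumes "(\<phi> has_derivative D) (at (x, t))"
  shows "space_grad \<phi> (x, t) \<bullet> a = D (a, 0)"
  using grad_inner[OF space_slice_derivative[OF assms]] by (simp add: space_grad_def)

lemma time_deriv_eq:
  assumes "(\<phi> has_derivative blinfun_apply D) (at (x, t))"
  shows "time_deriv \<phi> (x, t) = blinfun_apply D (0, 1)"
proof -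
  have "((\<lambda>s. (x, s)) has_derivative (\<lambda>h. (0, h))) (at t)"
    by (auto intro!: derivative_eq_intros)
  from has_derivative_compose[OF this, of \<phi> "blinfun_apply D"] assms
  have "((\<lambda>s. \<phi> (x, s)) has_derivative (\<lambda>h. blinfun_apply D (0, h))) (at t)" by simp
  moreover have "(\<lambda>h. blinfun_apply D (0, h)) = (*) (blinfun_apply D (0, 1))"
  proof
    fix h :: real
    show "blinfun_apply D (0, h) = blinfun_apply D (0, 1) * h"
      using blinfun.scaleR_right[of D h "(0, 1)"] by simp
  qed
  ultimately have "DERIV (\<lambda>s. \<phi> (x, s)) t :> blinfun_apply D (0, 1)"
    by (simp add: has_field_derivative_def)
  then show ?thesis by (simp add: time_deriv_def DERIV_imp_deriv)
qed

text \<open>Links the matrix \<open>hess\<close>, a Jacobian of the gradient built from coordinate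
  derivatives, with the second Frechet derivative along purely spatial directions.\<close>

lemma hess_quadratic:
  fixes \<phi> :: "(real ^ 'n) \<times> real \<Rightarrow> real"
  assumes U: "open U" "(x, t) \<in> U"
    and f': "\<And>w. w \<in> U \<Longrightarrow> (\<phi> has_derivative blinfun_apply (f' w)) (at w)"
    and f'': "(f' has_derivative blinfun_apply F) (at (x, t))"
  shows "a \<bullet> (hess (\<lambda>y. \<phi> (y, t)) x *v a) = blinfun_apply (blinfun_apply F (a, 0)) (a, 0)"
proof -
  let ?g = "grad (\<lambda>y. \<phi> (y, t))"
  define H where "H h = (\<chi> i. blinfun_apply (blinfun_apply F (h, 0)) (axis i 1, 0))" for h :: "real^'n"
  have "((\<lambda>y. \<chi> i. blinfun_apply (f' (y, t)) (axis i 1, 0)) has_derivative H) (at x)"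
  proof (subst has_derivative_componentwise_within, intro ballI)
    fix b :: "real^'n" assume "b \<in> Basis"
    then obtain i where b: "b = axis i 1" by (auto simp: Basis_vec_def)
    have "((\<lambda>y. (y, t)) has_derivative (\<lambda>h. (h, 0))) (at x)"
      by (auto intro!: derivative_eq_intros)
    from has_derivative_compose[OF this, of f' "blinfun_apply F"] f''
    have "((\<lambda>y. f' (y, t)) has_derivative (\<lambda>h. blinfun_apply F (h, 0))) (at x)" by simp
    from bounded_linear.has_derivative[OF blinfun.bounded_linear_left[of "(axis i 1, 0)"] this]
    show "((\<lambda>y. (\<chi> i. blinfun_apply (f' (y, t)) (axis i 1, 0)) \<bullet> b) has_derivative (\<lambda>h. H h \<bullet> b)) (at x)"
      by (simp add: b inner_axis H_def)
  qed
  then have "(?g has_derivative H) (at x)"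
  proof (rule has_derivative_transform_within_open)
    show "open ((\<lambda>y. (y, t)) -` U)" by (intro open_vimage U continuous_intros)
    show "x \<in> (\<lambda>y. (y, t)) -` U" using U by simp
    fix y assume "y \<in> (\<lambda>y. (y, t)) -` U"
    then have d: "((\<lambda>y. \<phi> (y, t)) has_derivative (\<lambda>h. blinfun_apply (f' (y, t)) (h, 0))) (at y)"
      by (intro space_slice_derivative f') simp
    show "(\<chi> i. blinfun_apply (f' (y, t)) (axis i 1, 0)) = ?g y"
      unfolding grad_def using frechet_derivative_at[OF d] by (simp add: vec_eq_iff fun_eq_iff)
  qed
  then have "hess (\<lambda>y. \<phi> (y, t)) x *v a = H a"
    unfolding hess_def using frechet_derivative_at[of ?g H x]
    by (simp add: jacobian_def matrix_works has_derivative_linear)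
  moreover have "a \<bullet> H a = blinfun_apply (blinfun_apply F (a, 0)) (a, 0)"
  proof -
    let ?D = "\<lambda>h. blinfun_apply (blinfun_apply F (a, 0)) (h, 0)"
    have lin: "linear ?D"
    proof (rule linearI)
      fix b1 b2 :: "real^'n" and c :: real
      show "?D (b1 + b2) = ?D b1 + ?D b2"
        using blinfun.add_right[of "blinfun_apply F (a, 0)" "(b1, 0)" "(b2, 0)"] by simp
      show "?D (c *\<^sub>R b1) = c *\<^sub>R ?D b1"
        using blinfun.scaleR_right[of "blinfun_apply F (a, 0)" c "(b1, 0)"] by simp
    qed
    have "?D a = ?D (\<Sum>i\<in>UNIV. (a $ i) *\<^sub>R axis i 1)"
      using basis_expansion[of a] by (simp add: scalar_mult_eq_scaleR)
    also have "\<dots> = (\<Sum>i\<in>UNIV. a $ i * ?D (axis i 1))"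
      by (simp add: linear_sum[OF lin] linear_scale[OF lin])
    finally show ?thesis by (simp add: H_def inner_vec_def)
  qed
  ultimately show ?thesis by simp
qed

text \<open>One-variable Taylor formula with Lagrange remainder along the segment from z to z + v.
  Keeping \<open>f''\<close> at an intermediate point lets its continuity at z control the error
  uniformly in v.\<close>

lemma C2_Taylor:
  fixes \<phi> :: "'a::real_normed_vector \<Rightarrow> real"
  assumes ball: "ball z r \<subseteq> U" and v: "norm v < r"
    and f': "\<And>w. w \<in> U \<Longrightarrow> (\<phi> has_derivative blinfun_apply (f' w)) (at w)"
    and f'': "\<And>w. w \<in> U \<Longrightarrow> (f' has_derivative blinfun_apply (f'' w)) (at w)"
  shows "\<exists>\<theta>\<in>{0..1}. \<phi> (z + v) = \<phi> z + blinfun_apply (f' z) v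
    + blinfun_apply (blinfun_apply (f'' (z + \<theta> *\<^sub>R v)) v) v / 2"
proof -
  define d where "d m s = (if m = 0 then \<phi> (z + s *\<^sub>R v) else if m = 1 then blinfun_apply (f' (z + s *\<^sub>R v)) v
     else blinfun_apply (blinfun_apply (f'' (z + s *\<^sub>R v)) v) v)" for m :: nat and s :: real
  have inU: "z + s *\<^sub>R v \<in> U" if "0 \<le> s" "s \<le> 1" for s
  proof -
    have "norm (s *\<^sub>R v) \<le> norm v" using that by (simp add: mult_left_le_one_le)
    then show ?thesis using v ball by (auto simp: dist_norm)
  qed
  have line: "((\<lambda>s. z + s *\<^sub>R v) has_derivative (\<lambda>h. h *\<^sub>R v)) (at s)" for s
    by (auto intro!: derivative_eq_intros)
  have d0: "DERIV (d 0) s :> d 1 s" if "0 \<le> s" "s \<le> 1" for s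
  proof -
    have "((\<lambda>s. \<phi> (z + s *\<^sub>R v)) has_derivative (\<lambda>h. blinfun_apply (f' (z + s *\<^sub>R v)) (h *\<^sub>R v))) (at s)"
      using has_derivative_compose[OF line f'[OF inU[OF that]]] .
    then show ?thesis by (simp add: d_def[abs_def] has_field_derivative_def blinfun.scaleR_right mult.commute[of _ "blinfun_apply _ _"])
  qed
  have d1: "DERIV (d 1) s :> d 2 s" if "0 \<le> s" "s \<le> 1" for s
  proof -
    have "((\<lambda>s. f' (z + s *\<^sub>R v)) has_derivative (\<lambda>h. blinfun_apply (f'' (z + s *\<^sub>R v)) (h *\<^sub>R v))) (at s)"
      using has_derivative_compose[OF line f''[OF inU[OF that]]] .
    from bounded_linear.has_derivative[OF blinfun.bounded_linear_left[of v] this]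
    show ?thesis by (simp add: d_def[abs_def] has_field_derivative_def blinfun.scaleR_right blinfun.scaleR_left mult.commute[of _ "blinfun_apply _ _"])
  qed
  have "\<exists>s. 0 < s \<and> s < 1 \<and> d 0 1 = (\<Sum>m<2. (d m 0 / fact m) * (1 - 0) ^ m) + (d 2 s / fact 2) * (1 - 0)\<^sup>2"
  proof (rule Taylor_up[where a=0])
    show "\<forall>m s. m < 2 \<and> 0 \<le> s \<and> s \<le> 1 \<longrightarrow> DERIV (d m) s :> d (Suc m) s"
    proof (intro allI impI, elim conjE)
      fix m :: nat and s :: real assume "m < 2" and s: "0 \<le> s" "s \<le> 1"
      then consider "m = 0" | "m = 1" by linarith
      then show "DERIV (d m) s :> d (Suc m) s"
        by cases (use d0[OF s] d1[OF s] in \<open>simp_all add: numeral_2_eq_2\<close>)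
    qed
  qed auto
  then obtain s where "0 < s" "s < 1" "d 0 1 = d 0 0 + d 1 0 + d 2 s / 2"
    by (auto simp: numeral_2_eq_2)
  then show ?thesis by (intro bexI[of _ s]) (auto simp: d_def)
qed

text \<open>The displacement is v = \<epsilon> \<alpha> + \<epsilon>^2 \<beta> with \<alpha> spatial
  and \<beta> temporal. In the second-order term only \<epsilon>^2 F(\<alpha>, \<alpha>) survives:
  every entry containing \<beta> carries at least \<epsilon>^3, and moving the base point of
  \<open>f''\<close> costs little by continuity.\<close>

lemma heat_expansion:
  fixes \<phi> :: "(real ^ 'n) \<times> real \<Rightarrow> real" and f :: "real ^ 'n \<Rightarrow> real ^ 'n"
  assumes C2: "C2_near \<phi> (x, t)" and f: "orthogonal_transformation f" and \<delta>: "0 < \<delta>"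
  shows "\<forall>\<^sub>F \<epsilon> in at_right 0. \<forall>(y, s)\<in>unit_heat_ball.
    \<bar>\<phi> (x + \<epsilon> *\<^sub>R f y, t - \<epsilon>\<^sup>2 * s) - (\<phi> (x, t) + \<epsilon> * (space_grad \<phi> (x, t) \<bullet> f y)
      + \<epsilon>\<^sup>2 * ((f y \<bullet> (hess (\<lambda>y. \<phi> (y, t)) x *v f y)) / 2 - time_deriv \<phi> (x, t) * s))\<bar> \<le> \<delta> * \<epsilon>\<^sup>2"
proof -
  obtain U f' f'' where U: "open U" "(x, t) \<in> U"
    and f': "\<And>w. w \<in> U \<Longrightarrow> (\<phi> has_derivative blinfun_apply (f' w)) (at w)"
    and f'': "\<And>w. w \<in> U \<Longrightarrow> (f' has_derivative blinfun_apply (f'' w)) (at w)"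
    and cont: "continuous_on U f''"
    using C2 unfolding C2_near_def by blast
  let ?z = "(x, t)"
  let ?F = "\<lambda>v w. blinfun_apply (blinfun_apply (f'' ?z) v) w"
  define M where "M = real CARD('n) + 1"
  have M: "1 \<le> M" by (simp add: M_def)
  \<comment> \<open>Chosen so that an oscillation \<eta> of \<open>f''\<close>, tested on |v| \<le>
    \<epsilon> M, costs \<delta> \<epsilon>^2.\<close>
  define \<eta> where "\<eta> = \<delta> / M\<^sup>2"
  have \<eta>: "0 < \<eta>" using \<delta> M by (simp add: \<eta>_def)
  have "isCont f'' ?z" using cont U continuous_on_eq_continuous_at by blast
  then obtain r1 where r1: "0 < r1" "\<And>w. dist w ?z < r1 \<Longrightarrow> dist (f'' w) (f'' ?z) < \<eta>"
    using \<eta> unfolding continuous_at_eps_delta by blast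
  obtain r2 where r2: "0 < r2" "ball ?z r2 \<subseteq> U" using U open_contains_ball by blast
  define r where "r = min r1 r2"
  have r: "0 < r" "ball ?z r \<subseteq> U" using r1 r2 by (auto simp: r_def)
  let ?B = "norm (f'' ?z)"
  \<comment> \<open>r / (2 M) keeps v inside the ball of radius r, and the last term makes the three
    contributions containing \<beta> at most \<delta> \<epsilon>^2.\<close>
  define \<epsilon>0 where "\<epsilon>0 = min 1 (min (r / (2 * M)) (\<delta> / (3 * M\<^sup>2 * (?B + 1))))"
  have \<epsilon>0: "0 < \<epsilon>0" using r M \<delta> by (auto simp: \<epsilon>0_def intro!: divide_pos_pos mult_pos_pos add_nonneg_pos)
  have "\<bar>\<phi> (x + \<epsilon> *\<^sub>R f y, t - \<epsilon>\<^sup>2 * s) - (\<phi> (x, t) + \<epsilon> * (space_grad \<phi> (x, t) \<bullet> f y)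
      + \<epsilon>\<^sup>2 * ((f y \<bullet> (hess (\<lambda>y. \<phi> (y, t)) x *v f y)) / 2 - time_deriv \<phi> (x, t) * s))\<bar> \<le> \<delta> * \<epsilon>\<^sup>2"
    if e: "0 < \<epsilon>" "\<epsilon> < \<epsilon>0" and ys: "(y, s) \<in> unit_heat_ball" for \<epsilon> y s
  proof -
    have e1: "\<epsilon> \<le> 1" and er: "\<epsilon> < r / (2 * M)" and eB: "\<epsilon> < \<delta> / (3 * M\<^sup>2 * (?B + 1))"
      using e by (auto simp: \<epsilon>0_def)
    define \<alpha> where "\<alpha> = (f y, 0 :: real)"
    define \<beta> where "\<beta> = (0 :: real^'n, - s)"
    define v where "v = \<epsilon> *\<^sub>R \<alpha> + \<epsilon>\<^sup>2 *\<^sub>R \<beta>"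
    have nf: "norm (f y) = norm y" using f by (simp add: orthogonal_transformation_norm)
    have s: "0 < s" "s < 1" using unit_heat_ball_time ys by blast+
    have a: "norm \<alpha> \<le> M" using unit_heat_ball_norm(2)[OF ys] by (simp add: \<alpha>_def M_def nf)
    have b: "norm \<beta> \<le> M" using s M by (simp add: \<beta>_def)
    have "norm v \<le> \<epsilon> * norm \<alpha> + \<epsilon>\<^sup>2 * norm \<beta>"
      unfolding v_def using norm_triangle_ineq[of "\<epsilon> *\<^sub>R \<alpha>" "\<epsilon>\<^sup>2 *\<^sub>R \<beta>"] e by simp
    also have "\<epsilon>\<^sup>2 * norm \<beta> \<le> \<epsilon> * 1"
      using s e e1 by (intro mult_mono) (auto simp: \<beta>_def power2_eq_square mult_left_le)
    also have "\<epsilon> * norm \<alpha> + \<epsilon> * 1 \<le> \<epsilon> * M"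
      using unit_heat_ball_norm(2)[OF ys] e unfolding distrib_left[symmetric]
      by (intro mult_left_mono) (simp_all add: \<alpha>_def M_def nf)
    finally have nv: "norm v \<le> \<epsilon> * M" by simp
    have "\<epsilon> * M < r" using er M r by (simp add: field_simps)
    then have nvr: "norm v < r" using nv by simp
    obtain \<theta> where \<theta>: "\<theta> \<in> {0..1}" "\<phi> (?z + v) = \<phi> ?z + blinfun_apply (f' ?z) v
      + blinfun_apply (blinfun_apply (f'' (?z + \<theta> *\<^sub>R v)) v) v / 2"
      using C2_Taylor[OF r(2) nvr f' f''] by blast
    have zv: "?z + v = (x + \<epsilon> *\<^sub>R f y, t - \<epsilon>\<^sup>2 * s)" by (simp add: v_def \<alpha>_def \<beta>_def)
    have "norm (\<theta> *\<^sub>R v) \<le> norm v" using \<theta> by (simp add: mult_left_le_one_le)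
    then have "dist (?z + \<theta> *\<^sub>R v) ?z < r1" using nvr by (simp add: dist_norm r_def)
    then have n2: "norm (f'' (?z + \<theta> *\<^sub>R v) - f'' ?z) \<le> \<eta>"
      using r1(2) by (simp add: dist_norm less_imp_le)
    have bil: "\<bar>blinfun_apply (blinfun_apply G v) w\<bar> \<le> norm G * norm v * norm w"
      for G :: "((real^'n) \<times> real) \<Rightarrow>\<^sub>L ((real^'n) \<times> real) \<Rightarrow>\<^sub>L real" and v w
    proof -
      have "norm (blinfun_apply (blinfun_apply G v) w) \<le> norm (blinfun_apply G v) * norm w"
        by (rule norm_blinfun)
      also have "\<dots> \<le> (norm G * norm v) * norm w" by (intro mult_right_mono norm_blinfun) simp
      finally show ?thesis by simp
    qed
    have E1: "\<bar>blinfun_apply (blinfun_apply (f'' (?z + \<theta> *\<^sub>R v)) v) v - ?F v v\<bar> \<le> \<delta> * \<epsilon>\<^sup>2"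
    proof -
      have "\<bar>blinfun_apply (blinfun_apply (f'' (?z + \<theta> *\<^sub>R v)) v) v - ?F v v\<bar> \<le> norm (f'' (?z + \<theta> *\<^sub>R v) - f'' ?z) * norm v * norm v"
        using bil[of "f'' (?z + \<theta> *\<^sub>R v) - f'' ?z" v v] by (simp add: blinfun.diff_left)
      also have "\<dots> \<le> \<eta> * (\<epsilon> * M) * (\<epsilon> * M)"
        using n2 nv \<eta> e M by (intro mult_mono) auto
      also have "\<dots> = \<delta> * \<epsilon>\<^sup>2" using M by (simp add: \<eta>_def power2_eq_square)
      finally show ?thesis .
    qed
    have F: "?F v v = \<epsilon>\<^sup>2 * ?F \<alpha> \<alpha> + \<epsilon> ^ 3 * (?F \<alpha> \<beta> + ?F \<beta> \<alpha> + \<epsilon> * ?F \<beta> \<beta>)"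
      unfolding v_def
      by (simp add: blinfun.add_left blinfun.add_right blinfun.scaleR_left blinfun.scaleR_right
          power2_eq_square power3_eq_cube algebra_simps)
    have E2: "\<bar>?F v v - \<epsilon>\<^sup>2 * ?F \<alpha> \<alpha>\<bar> \<le> \<delta> * \<epsilon>\<^sup>2"
    proof -
      have FM: "\<bar>?F u w\<bar> \<le> ?B * M\<^sup>2" if "norm u \<le> M" "norm w \<le> M" for u w
      proof -
        have "\<bar>?F u w\<bar> \<le> ?B * norm u * norm w" by (rule bil)
        also have "\<dots> \<le> ?B * M * M" using that M by (intro mult_mono) auto
        finally show ?thesis by (simp add: power2_eq_square mult.assoc)
      qed
      have "\<bar>\<epsilon> * ?F \<beta> \<beta>\<bar> \<le> 1 * (?B * M\<^sup>2)"
        unfolding abs_mult using e e1 FM[OF b b] by (intro mult_mono) auto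
      then have "\<bar>?F \<alpha> \<beta> + ?F \<beta> \<alpha> + \<epsilon> * ?F \<beta> \<beta>\<bar> \<le> 3 * (?B * M\<^sup>2)"
        using FM[OF a b] FM[OF b a] by linarith
      also have "\<dots> \<le> 3 * M\<^sup>2 * (?B + 1)" by (simp add: algebra_simps)
      finally have "\<epsilon> * \<bar>?F \<alpha> \<beta> + ?F \<beta> \<alpha> + \<epsilon> * ?F \<beta> \<beta>\<bar> \<le> \<epsilon> * (3 * M\<^sup>2 * (?B + 1))"
        using e by (intro mult_left_mono) auto
      also have "\<dots> \<le> \<delta>" using eB M by (simp add: pos_less_divide_eq add_nonneg_pos less_imp_le)
      finally have "\<epsilon>\<^sup>2 * (\<epsilon> * \<bar>?F \<alpha> \<beta> + ?F \<beta> \<alpha> + \<epsilon> * ?F \<beta> \<beta>\<bar>) \<le> \<epsilon>\<^sup>2 * \<delta>"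
        by (intro mult_left_mono) auto
      moreover have "\<bar>?F v v - \<epsilon>\<^sup>2 * ?F \<alpha> \<alpha>\<bar> = \<epsilon>\<^sup>2 * (\<epsilon> * \<bar>?F \<alpha> \<beta> + ?F \<beta> \<alpha> + \<epsilon> * ?F \<beta> \<beta>\<bar>)"
        unfolding F using e by (simp add: abs_mult power2_eq_square power3_eq_cube)
      ultimately show ?thesis by (simp add: mult.commute)
    qed
    have g1: "blinfun_apply (f' ?z) v = \<epsilon> * (space_grad \<phi> ?z \<bullet> f y) - \<epsilon>\<^sup>2 * (time_deriv \<phi> ?z * s)"
    proof -
      have "blinfun_apply (f' ?z) \<beta> = - (time_deriv \<phi> ?z * s)"
        using blinfun.scaleR_right[of "f' ?z" "- s" "(0, 1)"] time_deriv_eq[OF f'[OF U(2)]]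
        by (simp add: \<beta>_def)
      moreover have "blinfun_apply (f' ?z) \<alpha> = space_grad \<phi> ?z \<bullet> f y"
        unfolding \<alpha>_def by (rule space_grad_inner[OF f'[OF U(2)], symmetric])
      ultimately show ?thesis
        by (simp only: v_def blinfun.add_right blinfun.scaleR_right real_scaleR_def)
    qed
    have g2: "f y \<bullet> (hess (\<lambda>y. \<phi> (y, t)) x *v f y) = ?F \<alpha> \<alpha>"
      unfolding \<alpha>_def by (rule hess_quadratic[OF U f' f''[OF U(2)]])
    \<comment> \<open>The two errors of size \<delta> \<epsilon>^2 enter through the factor 1/2 of
      the remainder, so together they use exactly the allowance.\<close>
    show ?thesis
      unfolding zv[symmetric] \<theta>(2) g1 g2 using E1 E2 by (simp add: algebra_simps abs_le_iff)
  qed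
  then show ?thesis
    using \<epsilon>0 unfolding eventually_at_right_field by (intro exI[of _ \<epsilon>0]) auto
qed

section \<open>Blow-up of the heat ball\<close>

definition blow_up :: "(real ^ 'n \<Rightarrow> real ^ 'n) \<Rightarrow> (real ^ 'n) \<times> real \<Rightarrow> real \<Rightarrow> (real ^ 'n) \<times> real \<Rightarrow> (real ^ 'n) \<times> real" where
  "blow_up f z \<epsilon> w = (fst z + \<epsilon> *\<^sub>R f (fst w), snd z - \<epsilon>\<^sup>2 * snd w)"

lemma blow_up_heat_ball:
  fixes f :: "real^'n \<Rightarrow> real^'n"
  assumes "0 < \<epsilon>" "orthogonal_transformation f"
  shows "blow_up f z \<epsilon> w \<in> heat_ball \<epsilon> z \<longleftrightarrow> w \<in> unit_heat_ball"
    and "heat_ball \<epsilon> z = blow_up f z \<epsilon> ` unit_heat_ball"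
  using heat_ball_iff[OF assms, of "fst z" "fst w" "snd z" "snd w"] heat_ball_image[OF assms, of "fst z" "snd z"]
  by (simp_all add: blow_up_def case_prod_beta')

lemma linear_borel_measurable:
  fixes f :: "'a::euclidean_space \<Rightarrow> 'b::euclidean_space"
  assumes "linear f"
  shows "f \<in> borel_measurable borel"
  using assms by (intro borel_measurable_continuous_onI linear_continuous_on)
    (simp add: linear_conv_bounded_linear)

lemma blow_up_continuous:
  assumes "orthogonal_transformation f"
  shows "continuous_on S (blow_up f z \<epsilon>)"
proof -
  have "bounded_linear f"
    using assms by (simp add: orthogonal_transformation_linear linear_conv_bounded_linear[symmetric])
  then have "continuous_on S (\<lambda>w. f (fst w))"
    by (rule bounded_linear.continuous_on) (intro continuous_intros)
  then show ?thesis
    unfolding blow_up_def[abs_def] by (intro continuous_intros)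
qed

text \<open>The blow-up is a rotation of the space variables followed by a diagonal affine map. The
  Jacobian factor stays an anonymous positive K because only signs of integrals are needed.\<close>

lemma blow_up_lborel:
  fixes f :: "real^'n \<Rightarrow> real^'n"
  assumes e: "0 < \<epsilon>" and f: "orthogonal_transformation f"
  obtains K where "0 < K" "lborel = density (distr lborel borel (blow_up f z \<epsilon>)) (\<lambda>_. ennreal K)"
proof
  define c :: "(real^'n) \<times> real \<Rightarrow> real" where "c j = (if snd j = 0 then \<epsilon> else - (\<epsilon>\<^sup>2))" for j
  define T where "T w = z + (\<Sum>j\<in>Basis. (c j * (w \<bullet> j)) *\<^sub>R j)" for w
  have c0: "c j \<noteq> 0" for j using e by (simp add: c_def)
  have T: "T w = (fst z + \<epsilon> *\<^sub>R fst w, snd z - \<epsilon>\<^sup>2 * snd w)" for w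
  proof -
    have "(\<Sum>j\<in>Basis. (c j * (w \<bullet> j)) *\<^sub>R j) =
      (\<Sum>i\<in>Basis. (\<epsilon> * (fst w \<bullet> i)) *\<^sub>R (i, 0)) + (\<Sum>i\<in>Basis. (- (\<epsilon>\<^sup>2) * (snd w \<bullet> i)) *\<^sub>R (0, i))"
      unfolding sum_Basis_prod_eq by (cases w) (auto simp: c_def intro!: sum.cong arg_cong2[where f="(+)"])
    also have "(\<Sum>i\<in>Basis. (\<epsilon> * (fst w \<bullet> i)) *\<^sub>R (i, 0::real)) = (\<epsilon> *\<^sub>R fst w, 0)"
    proof -
      have "(\<Sum>i\<in>Basis. (\<epsilon> * (fst w \<bullet> i)) *\<^sub>R i) = \<epsilon> *\<^sub>R (\<Sum>i\<in>Basis. (fst w \<bullet> i) *\<^sub>R i)"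
        by (simp add: scaleR_sum_right)
      then show ?thesis by (simp add: prod_eq_iff fst_sum snd_sum euclidean_representation)
    qed
    finally show ?thesis by (simp add: T_def prod_eq_iff)
  qed
  define K where "K = (\<Prod>j\<in>(Basis :: ((real^'n) \<times> real) set). \<bar>c j\<bar>)"
  show "0 < K" unfolding K_def using c0 by (intro prod_pos) simp
  define R where "R w = (f (fst w), snd w)" for w :: "(real^'n) \<times> real"
  have "linear f" using f by (simp add: orthogonal_transformation_linear)
  then have "linear R"
    unfolding R_def by (intro linearI) (simp_all add: linear_add linear_scale)
  then have R: "orthogonal_transformation R"
    unfolding orthogonal_transformation by (simp add: R_def norm_prod_def orthogonal_transformation_norm[OF f])
  have Rm: "R \<in> borel_measurable borel" by (rule linear_borel_measurable[OF \<open>linear R\<close>])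
  have Tm: "T \<in> borel_measurable borel"
    unfolding T by (intro borel_measurable_continuous_onI continuous_intros)
  have "blow_up f z \<epsilon> = T \<circ> R" by (simp add: fun_eq_iff blow_up_def T R_def)
  then have "distr lborel borel (blow_up f z \<epsilon>) = distr (distr lborel borel R) borel T"
    using distr_distr[of T borel borel R lborel] Rm Tm by simp
  also have "\<dots> = distr lborel borel T" by (simp only: distr_lborel_orthogonal[OF R])
  finally show "lborel = density (distr lborel borel (blow_up f z \<epsilon>)) (\<lambda>_. ennreal K)"
    using lborel_affine_euclidean[of c z] c0 by (simp add: T_def[abs_def] K_def prod_ennreal)
qed

section \<open>The heat measure: change of variables, finiteness, positivity on open sets\<close>

lemma heat_ball_open: "0 < \<epsilon> \<Longrightarrow> open (heat_ball \<epsilon> z)"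
  for z :: "(real^'n) \<times> real"
proof -
  assume e: "0 < \<epsilon>"
  define g where "g w = ((fst w - fst z) /\<^sub>R \<epsilon>, (snd z - snd w) / \<epsilon>\<^sup>2)" for w
  have id: "orthogonal_transformation (id :: real^'n \<Rightarrow> real^'n)" by (simp add: id_def)
  have inv: "blow_up id z \<epsilon> (g w) = w" for w using e by (simp add: blow_up_def g_def prod_eq_iff)
  have "w \<in> heat_ball \<epsilon> z \<longleftrightarrow> g w \<in> unit_heat_ball" for w
    using blow_up_heat_ball(1)[OF e id, of z "g w"] by (simp only: inv)
  then have "heat_ball \<epsilon> z = g -` unit_heat_ball" by auto
  moreover have "continuous_on UNIV g" unfolding g_def using e by (intro continuous_intros) auto
  ultimately show ?thesis using open_vimage[OF open_unit_heat_ball] by simp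
qed

lemma space_heat_measure [simp]: "space (heat_measure \<epsilon> z) = heat_ball \<epsilon> z"
  by (simp add: heat_measure_def space_restrict_space)

lemma heat_density_measurable [measurable]:
  "(\<lambda>(y, s). ennreal ((norm (fst z - y))\<^sup>2 / (snd z - s)\<^sup>2)) \<in> borel_measurable (borel :: ((real^'n) \<times> real) measure)"
  unfolding case_prod_beta by measurable

lemma heat_measure_continuous_measurable:
  fixes z :: "(real^'n) \<times> real" and \<phi> :: "(real^'n) \<times> real \<Rightarrow> real"
  assumes "continuous_on (heat_ball \<epsilon> z) \<phi>"
  shows "\<phi> \<in> borel_measurable (heat_measure \<epsilon> z)"
proof -
  have "sets (heat_measure \<epsilon> z) = sets (restrict_space borel (heat_ball \<epsilon> z))"
    unfolding heat_measure_def by (intro sets_restrict_space_cong) simp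
  from measurable_cong_sets[OF this refl] show ?thesis
    using borel_measurable_continuous_on_restrict[OF assms] by blast
qed

lemma heat_measure_nn_integral:
  fixes z :: "(real^'n) \<times> real" and F :: "(real^'n) \<times> real \<Rightarrow> ennreal"
  assumes e: "0 < \<epsilon>" and F [measurable]: "F \<in> borel_measurable borel"
  shows "(\<integral>\<^sup>+w. F w \<partial>heat_measure \<epsilon> z) =
    (\<integral>\<^sup>+w. ennreal ((norm (fst z - fst w))\<^sup>2 / (snd z - snd w)\<^sup>2) * (F w * indicator (heat_ball \<epsilon> z) w) \<partial>lborel)"
proof -
  have [measurable]: "heat_ball \<epsilon> z \<in> sets borel" using heat_ball_open[OF e] by (rule borel_open)
  have "heat_measure \<epsilon> z = restrict_space
    (density lborel (\<lambda>w. ennreal ((norm (fst z - fst w))\<^sup>2 / (snd z - snd w)\<^sup>2))) (heat_ball \<epsilon> z)"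
    (is "_ = restrict_space (density lborel ?\<rho>) ?E")
    unfolding heat_measure_def case_prod_unfold by (rule refl)
  then have "(\<integral>\<^sup>+w. F w \<partial>heat_measure \<epsilon> z) = (\<integral>\<^sup>+w. F w * indicator ?E w \<partial>density lborel ?\<rho>)"
    by (simp only:) (rule nn_integral_restrict_space, simp)
  also have "\<dots> = (\<integral>\<^sup>+w. ?\<rho> w * (F w * indicator ?E w) \<partial>lborel)"
    by (rule nn_integral_density) measurable
  finally show ?thesis .
qed

text \<open>Measurability is asked of \<open>F\<close> cut off to the heat ball, since a test
  function is controlled only near the base point.\<close>

lemma heat_measure_integral:
  fixes z :: "(real^'n) \<times> real" and f :: "real^'n \<Rightarrow> real^'n"
  assumes e: "0 < \<epsilon>" and f: "orthogonal_transformation f"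
  obtains K where "0 < K"
    "\<And>F. (\<lambda>w. indicator (heat_ball \<epsilon> z) w * F w) \<in> borel_measurable borel \<Longrightarrow>
      (\<integral>w. F w \<partial>heat_measure \<epsilon> z) = K * (\<integral>w. heat_weight w * F (blow_up f z \<epsilon> w) \<partial>lborel)"
proof -
  obtain K where K: "0 < K" and lb: "lborel = density (distr lborel borel (blow_up f z \<epsilon>)) (\<lambda>_. ennreal K)"
    using blow_up_lborel[OF e f] by blast
  have [measurable]: "heat_ball \<epsilon> z \<in> sets borel" using heat_ball_open[OF e] by (rule borel_open)
  have [measurable]: "blow_up f z \<epsilon> \<in> borel_measurable borel"
    by (rule borel_measurable_continuous_onI[OF blow_up_continuous[OF f]])
  have cv: "(\<integral>w. G w \<partial>lborel) = K * (\<integral>w. G (blow_up f z \<epsilon> w) \<partial>lborel)"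
    if [measurable]: "G \<in> borel_measurable borel" for G :: "(real^'n) \<times> real \<Rightarrow> real"
    using K by (subst lb) (simp add: integral_density integral_distr)
  have "(\<integral>w. F w \<partial>heat_measure \<epsilon> z) = (K / \<epsilon>\<^sup>2) * (\<integral>w. heat_weight w * F (blow_up f z \<epsilon> w) \<partial>lborel)"
    if [measurable]: "(\<lambda>w. indicator (heat_ball \<epsilon> z) w * F w) \<in> borel_measurable borel" for F :: "(real^'n) \<times> real \<Rightarrow> real"
  proof -
    let ?\<rho> = "\<lambda>w. (norm (fst z - fst w))\<^sup>2 / (snd z - snd w)\<^sup>2"
    let ?G = "\<lambda>w. ?\<rho> w * (indicator (heat_ball \<epsilon> z) w * F w)"
    have "(\<integral>w. F w \<partial>heat_measure \<epsilon> z) = (\<integral>w. indicator (heat_ball \<epsilon> z) w * F w \<partial>density lborel (\<lambda>w. ennreal (?\<rho> w)))"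
      unfolding heat_measure_def by (subst integral_restrict_space) (simp_all add: case_prod_beta')
    also have "\<dots> = (\<integral>w. ?G w \<partial>lborel)"
      by (subst integral_density) auto
    also have "\<dots> = K * (\<integral>w. ?G (blow_up f z \<epsilon> w) \<partial>lborel)"
      by (rule cv) measurable
    also have "(\<lambda>w. ?G (blow_up f z \<epsilon> w)) = (\<lambda>w. (1 / \<epsilon>\<^sup>2) * (heat_weight w * F (blow_up f z \<epsilon> w)))"
    proof
      fix w
      have "?\<rho> (blow_up f z \<epsilon> w) = (1 / \<epsilon>\<^sup>2) * ((norm (fst w))\<^sup>2 / (snd w)\<^sup>2)"
        using e orthogonal_transformation_norm[OF f, of "fst w"]
        by (simp add: blow_up_def power_mult_distrib power2_eq_square)
      then show "?G (blow_up f z \<epsilon> w) = (1 / \<epsilon>\<^sup>2) * (heat_weight w * F (blow_up f z \<epsilon> w))"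
        by (simp add: heat_weight_def indicator_def blow_up_heat_ball(1)[OF e f])
    qed
    finally show ?thesis by simp
  qed
  with that[of "K / \<epsilon>\<^sup>2"] K e show thesis by simp
qed

lemma heat_measure_finite:
  fixes z :: "(real^'n) \<times> real"
  assumes N: "CARD('n) \<ge> 2" and e: "0 < \<epsilon>"
  shows "finite_measure (heat_measure \<epsilon> z)"
proof
  have id: "orthogonal_transformation (id :: real^'n \<Rightarrow> real^'n)" by (simp add: id_def)
  obtain K where K: "0 < K" and lb: "lborel = density (distr lborel borel (blow_up id z \<epsilon>)) (\<lambda>_. ennreal K)"
    using blow_up_lborel[OF e id] by blast
  have [measurable]: "heat_ball \<epsilon> z \<in> sets borel" using heat_ball_open[OF e] by (rule borel_open)
  have [measurable]: "blow_up id z \<epsilon> \<in> borel_measurable borel"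
    by (rule borel_measurable_continuous_onI[OF blow_up_continuous[OF id]])
  let ?G = "\<lambda>w. ennreal ((norm (fst z - fst w))\<^sup>2 / (snd z - snd w)\<^sup>2) * indicator (heat_ball \<epsilon> z) w"
  have "emeasure (heat_measure \<epsilon> z) (space (heat_measure \<epsilon> z)) = (\<integral>\<^sup>+w. 1 \<partial>heat_measure \<epsilon> z)" by simp
  also have "\<dots> = (\<integral>\<^sup>+w. ?G w \<partial>lborel)"
    by (subst heat_measure_nn_integral[OF e]) simp_all
  also have "\<dots> = ennreal K * (\<integral>\<^sup>+w. ?G (blow_up id z \<epsilon> w) \<partial>lborel)"
    by (subst lb) (simp add: nn_integral_density nn_integral_distr nn_integral_cmult)
  also have "(\<lambda>w. ?G (blow_up id z \<epsilon> w)) = (\<lambda>w. ennreal ((1 / \<epsilon>\<^sup>2) * heat_weight w))"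
  proof
    fix w
    have "(norm (fst z - fst (blow_up id z \<epsilon> w)))\<^sup>2 / (snd z - snd (blow_up id z \<epsilon> w))\<^sup>2 = (1 / \<epsilon>\<^sup>2) * ((norm (fst w))\<^sup>2 / (snd w)\<^sup>2)"
      using e by (simp add: blow_up_def power_mult_distrib power2_eq_square)
    then show "?G (blow_up id z \<epsilon> w) = ennreal ((1 / \<epsilon>\<^sup>2) * heat_weight w)"
      by (simp add: heat_weight_def indicator_def blow_up_heat_ball(1)[OF e id])
  qed
  finally have eq: "emeasure (heat_measure \<epsilon> z) (space (heat_measure \<epsilon> z)) =
    ennreal K * (\<integral>\<^sup>+w. ennreal ((1 / \<epsilon>\<^sup>2) * heat_weight w) \<partial>(lborel :: ((real^'n) \<times> real) measure))" .
  have "integrable lborel (\<lambda>w::(real^'n) \<times> real. (1 / \<epsilon>\<^sup>2) * heat_weight w)"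
    by (rule integrable_mult_right) (rule heat_weight_integrable[OF N])
  then have "(\<integral>\<^sup>+w. ennreal ((1 / \<epsilon>\<^sup>2) * heat_weight w) \<partial>(lborel :: ((real^'n) \<times> real) measure)) < \<infinity>"
    by (subst nn_integral_eq_integral) (auto simp: heat_weight_bounds)
  with eq show "emeasure (heat_measure \<epsilon> z) (space (heat_measure \<epsilon> z)) \<noteq> \<infinity>"
    by (simp add: ennreal_mult_less_top ennreal_mult_eq_top_iff less_top)
qed

text \<open>On the heat ball the density vanishes only for y = x, which lies in a hyperplane. An
  open subset that is null for the heat measure is thus Lebesgue negligible, hence empty.\<close>

lemma heat_measure_charges_open:
  fixes z :: "(real^'n) \<times> real"
  assumes e: "0 < \<epsilon>" and V: "open V" "V \<subseteq> heat_ball \<epsilon> z" and ae: "AE w in heat_measure \<epsilon> z. w \<notin> V"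
  shows "V = {}"
proof (rule ccontr)
  assume "V \<noteq> {}"
  have [measurable]: "heat_ball \<epsilon> z \<in> sets borel" using heat_ball_open[OF e] by (rule borel_open)
  fix k :: 'n
  let ?H = "{w. w \<bullet> ((axis k 1, 0) :: (real^'n) \<times> real) = fst z $ k}"
  have "AE w in density lborel (\<lambda>(y, s). ennreal ((norm (fst z - y))\<^sup>2 / (snd z - s)\<^sup>2)). w \<in> heat_ball \<epsilon> z \<longrightarrow> w \<notin> V"
    using ae unfolding heat_measure_def by (subst (asm) AE_restrict_space_iff) simp_all
  then have "AE w in lborel. 0 < (case w of (y, s) \<Rightarrow> ennreal ((norm (fst z - y))\<^sup>2 / (snd z - s)\<^sup>2)) \<longrightarrow> w \<in> heat_ball \<epsilon> z \<longrightarrow> w \<notin> V"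
    by (subst (asm) AE_density) simp_all
  then have "AE w in lborel. w \<notin> V - ?H"
  proof (rule eventually_mono, intro notI)
    fix w
    assume imp: "0 < (case w of (y, s) \<Rightarrow> ennreal ((norm (fst z - y))\<^sup>2 / (snd z - s)\<^sup>2)) \<longrightarrow> w \<in> heat_ball \<epsilon> z \<longrightarrow> w \<notin> V"
      and w: "w \<in> V - ?H"
    have "fst w \<noteq> fst z" using w by (auto simp: inner_st_dir)
    moreover have "snd w < snd z" using w V by (auto simp: heat_ball_def case_prod_beta)
    ultimately show False using imp w V by (auto simp: case_prod_beta)
  qed
  moreover have Hm: "?H \<in> sets borel" by (intro borel_closed closed_hyperplane[of _ _, simplified inner_commute])
  ultimately have "V - ?H \<in> null_sets lborel" using V by (subst AE_iff_null_sets) auto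
  then have "negligible (V - ?H)" by (simp add: negligible_iff_null_sets null_sets_completionI)
  moreover have "negligible ?H" by (rule negligible_standard_hyperplane[OF st_dir_Basis])
  ultimately have "negligible ((V - ?H) \<union> ?H)" by (rule negligible_Un)
  then have "negligible V" by (rule negligible_subset) auto
  then show False using open_not_negligible[OF V(1) \<open>V \<noteq> {}\<close>] by contradiction
qed

lemma connected_heat_ball:
  fixes z :: "(real^'n) \<times> real"
  assumes e: "0 < \<epsilon>"
  shows "connected (heat_ball \<epsilon> z)"
proof -
  have id: "orthogonal_transformation (id :: real^'n \<Rightarrow> real^'n)" by (simp add: id_def)
  show ?thesis
    unfolding blow_up_heat_ball(2)[OF e id]
    by (intro connected_continuous_image blow_up_continuous id connected_unit_heat_ball)
qed

text \<open>The preimage of (a, b) is open and null, hence empty; values on both sides of the gap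
  would then contradict connectedness. This verifies \<open>unsplit\<close> for test
  functions.\<close>

lemma heat_ball_unsplit:
  fixes z :: "(real^'n) \<times> real" and \<phi> :: "(real^'n) \<times> real \<Rightarrow> real"
  assumes e: "0 < \<epsilon>" and \<phi>: "continuous_on (heat_ball \<epsilon> z) \<phi>" and ab: "a < b"
    and ae: "AE w in heat_measure \<epsilon> z. \<not> (a < \<phi> w \<and> \<phi> w < b)"
  shows "(\<forall>w\<in>heat_ball \<epsilon> z. \<phi> w \<le> a) \<or> (\<forall>w\<in>heat_ball \<epsilon> z. b \<le> \<phi> w)"
proof -
  let ?E = "heat_ball \<epsilon> z"
  have "open (?E \<inter> \<phi> -` {a<..<b})"
    by (rule continuous_open_preimage[OF \<phi> heat_ball_open[OF e]]) simp
  moreover have "AE w in heat_measure \<epsilon> z. w \<notin> ?E \<inter> \<phi> -` {a<..<b}"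
    using ae by eventually_elim auto
  ultimately have empty: "?E \<inter> \<phi> -` {a<..<b} = {}"
    by (intro heat_measure_charges_open[OF e]) auto
  show ?thesis
  proof (rule ccontr)
    assume "\<not> ?thesis"
    then obtain u v where uv: "u \<in> ?E" "a < \<phi> u" "v \<in> ?E" "\<phi> v < b" by (auto simp: not_le)
    have "b \<le> \<phi> u"
    proof (rule ccontr)
      assume "\<not> b \<le> \<phi> u"
      then have "u \<in> ?E \<inter> \<phi> -` {a<..<b}" using uv by simp
      then show False using empty by blast
    qed
    have "\<phi> v \<le> a"
    proof (rule ccontr)
      assume "\<not> \<phi> v \<le> a"
      then have "v \<in> ?E \<inter> \<phi> -` {a<..<b}" using uv by simp
      then show False using empty by blast
    qed
    have "connected (\<phi> ` ?E)" by (rule connected_continuous_image[OF \<phi> connected_heat_ball[OF e]])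
    moreover have "\<phi> v \<in> \<phi> ` ?E" "\<phi> u \<in> \<phi> ` ?E" using uv by blast+
    moreover have "\<phi> v \<le> (a + b) / 2" using \<open>\<phi> v \<le> a\<close> ab by simp
    moreover have "(a + b) / 2 \<le> \<phi> u" using \<open>b \<le> \<phi> u\<close> ab by simp
    ultimately have "(a + b) / 2 \<in> \<phi> ` ?E" by (rule connectedD_interval)
    then obtain w where "w \<in> ?E" "\<phi> w = (a + b) / 2" by auto
    then have "w \<in> ?E \<inter> \<phi> -` {a<..<b}" using ab by simp
    then show False using empty by simp
  qed
qed

text \<open>The rotation sends the k-th axis to the gradient direction, and D is the spatial Hessian
  conjugated by it. Conjugation keeps the trace, and the k-th diagonal entry becomes the second
  derivative along the gradient.\<close>

lemma heat_blow_up_limit: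
  fixes \<phi> :: "(real ^ 'n) \<times> real \<Rightarrow> real" and k :: 'n
  assumes C2: "C2_near \<phi> (x, t)" and g: "space_grad \<phi> (x, t) \<noteq> 0"
  obtains f D where "orthogonal_transformation f"
    "trace D = laplacian (\<lambda>y. \<phi> (y, t)) x"
    "D $ k $ k = infinity_laplacian_n (\<lambda>y. \<phi> (y, t)) x"
    "\<And>\<delta>. 0 < \<delta> \<Longrightarrow> \<forall>\<^sub>F \<epsilon> in at_right 0. \<forall>w\<in>unit_heat_ball.
      \<bar>(\<phi> (blow_up f (x, t) \<epsilon> w) - \<phi> (x, t) - \<epsilon> * (norm (space_grad \<phi> (x, t)) * fst w $ k)) / \<epsilon>\<^sup>2
        - heat_quadratic D (time_deriv \<phi> (x, t)) w\<bar> \<le> \<delta>"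
    "\<forall>\<^sub>F \<epsilon> in at_right 0. continuous_on (heat_ball \<epsilon> (x, t)) \<phi>"
proof -
  let ?v = "space_grad \<phi> (x, t)"
  let ?H = "hess (\<lambda>y. \<phi> (y, t)) x"
  define b where "b = norm ?v"
  have b: "0 < b" using g by (simp add: b_def)
  have vg: "?v = grad (\<lambda>y. \<phi> (y, t)) x" by (simp add: space_grad_def)
  have "norm (?v /\<^sub>R b) = 1" using b by (simp add: b_def)
  then obtain A where A: "orthogonal_matrix A" "A *v (axis k 1) = ?v /\<^sub>R b"
    using orthogonal_matrix_exists_basis by metis
  define f where "f y = A *v y" for y
  have f: "orthogonal_transformation f"
    unfolding f_def using A(1) by (simp add: orthogonal_transformation_matrix)
  define D where "D = transpose A ** ?H ** A"
  have trD: "trace D = laplacian (\<lambda>y. \<phi> (y, t)) x"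
  proof -
    have "trace D = trace (A ** (transpose A ** ?H))" unfolding D_def by (rule trace_mul_sym)
    also have "A ** (transpose A ** ?H) = ?H"
      using A(1) by (simp add: matrix_mul_assoc orthogonal_matrix_def)
    finally show ?thesis by (simp add: laplacian_def)
  qed
  have quad: "y \<bullet> (D *v y) = f y \<bullet> (?H *v f y)" for y
  proof -
    have "y \<bullet> (D *v y) = y \<bullet> (transpose A *v (?H *v f y))"
      by (simp only: D_def f_def matrix_vector_mul_assoc matrix_mul_assoc)
    also have "\<dots> = ((?H *v f y) v* A) \<bullet> y"
      by (subst transpose_matrix_vector) (rule inner_commute)
    also have "\<dots> = (?H *v f y) \<bullet> f y" by (simp only: dot_lmul_matrix f_def)
    finally show ?thesis by (simp only: inner_commute[of "f y"])
  qed
  have lin: "f y \<bullet> ?v = b * y $ k" for y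
  proof -
    have "?v = b *\<^sub>R f (axis k 1)" using b by (simp add: f_def A(2))
    moreover have "f y \<bullet> f (axis k 1) = y \<bullet> axis k 1"
      using f by (simp add: orthogonal_transformation_def)
    ultimately show ?thesis by (simp add: inner_axis)
  qed
  have Dkk: "D $ k $ k = infinity_laplacian_n (\<lambda>y. \<phi> (y, t)) x"
  proof -
    have "D $ k $ k = axis k 1 \<bullet> (D *v axis k 1)"
      by (simp add: inner_axis' matrix_vector_mul_component inner_axis)
    also have "\<dots> = (?v /\<^sub>R b) \<bullet> (?H *v (?v /\<^sub>R b))" by (simp only: quad) (simp add: f_def A(2))
    also have "\<dots> = ((?H *v ?v) \<bullet> ?v) / b\<^sup>2"
      by (simp add: matrix_vector_mult_scaleR inner_commute power2_eq_square field_simps)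
    finally show ?thesis by (simp add: infinity_laplacian_n_def vg b_def)
  qed
  show thesis
  proof (rule that[OF f trD Dkk])
    fix \<delta> :: real assume \<delta>: "0 < \<delta>"
    have pos: "\<forall>\<^sub>F \<epsilon> in at_right (0::real). 0 < \<epsilon>" by (simp add: eventually_at_right_less)
    show "\<forall>\<^sub>F \<epsilon> in at_right 0. \<forall>w\<in>unit_heat_ball.
      \<bar>(\<phi> (blow_up f (x, t) \<epsilon> w) - \<phi> (x, t) - \<epsilon> * (norm ?v * fst w $ k)) / \<epsilon>\<^sup>2
        - heat_quadratic D (time_deriv \<phi> (x, t)) w\<bar> \<le> \<delta>"
      using heat_expansion[OF C2 f \<delta>] pos
    proof eventually_elim
      case (elim \<epsilon>)
      show ?case
      proof
        fix w :: "(real^'n) \<times> real" assume w: "w \<in> unit_heat_ball"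
        let ?X = "\<phi> (blow_up f (x, t) \<epsilon> w) - \<phi> (x, t) - \<epsilon> * (norm ?v * fst w $ k)"
        let ?h = "heat_quadratic D (time_deriv \<phi> (x, t)) w"
        have "\<bar>?X - \<epsilon>\<^sup>2 * ?h\<bar> \<le> \<delta> * \<epsilon>\<^sup>2"
          using elim(1)[rule_format, OF w] lin[of "fst w"] quad[of "fst w"]
          by (simp add: case_prod_beta blow_up_def heat_quadratic_def b_def inner_commute algebra_simps)
        then have "\<bar>?X - \<epsilon>\<^sup>2 * ?h\<bar> / \<epsilon>\<^sup>2 \<le> \<delta>" using elim(2) by (simp add: divide_le_eq)
        moreover have "?X / \<epsilon>\<^sup>2 - ?h = (?X - \<epsilon>\<^sup>2 * ?h) / \<epsilon>\<^sup>2" using elim(2) by (simp add: diff_divide_distrib)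
        ultimately show "\<bar>?X / \<epsilon>\<^sup>2 - ?h\<bar> \<le> \<delta>" by simp
      qed
    qed
  next
    obtain U f' where U: "open U" "(x, t) \<in> U"
      and f': "\<And>w. w \<in> U \<Longrightarrow> (\<phi> has_derivative blinfun_apply (f' w)) (at w)"
      using C2 unfolding C2_near_def by blast
    have cont: "continuous_on U \<phi>"
      using f' by (meson continuous_at_imp_continuous_on has_derivative_continuous)
    obtain r where r: "0 < r" "ball (x, t) r \<subseteq> U" using U open_contains_ball by blast
    define M where "M = real CARD('n) + 1"
    have M: "1 \<le> M" by (simp add: M_def)
    \<comment> \<open>The heat ball shrinks to its vertex: its points lie within \<epsilon> M of (x,
      t), the extra 1 in M absorbing the time component.\<close>
    have "heat_ball \<epsilon> (x, t) \<subseteq> U" if e: "0 < \<epsilon>" "\<epsilon> < min 1 (r / M)" for \<epsilon>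
    proof
      fix v assume "v \<in> heat_ball \<epsilon> (x, t)"
      then obtain w where w: "w \<in> unit_heat_ball" "v = blow_up f (x, t) \<epsilon> w"
        using blow_up_heat_ball(2)[OF e(1) f] by auto
      have n: "norm (fst w) \<le> real CARD('n)" "0 < snd w" "snd w < 1"
        using unit_heat_ball_norm(2)[of "fst w" "snd w"] unit_heat_ball_time[of "fst w" "snd w"] w(1) by simp_all
      have "dist v (x, t) \<le> norm (\<epsilon> *\<^sub>R f (fst w)) + norm (\<epsilon>\<^sup>2 * snd w)"
        using norm_Pair_le[of "\<epsilon> *\<^sub>R f (fst w)" "- (\<epsilon>\<^sup>2 * snd w)"] by (simp add: w(2) blow_up_def dist_norm)
      also have "\<dots> \<le> \<epsilon> * real CARD('n) + \<epsilon> * 1"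
      proof (rule add_mono)
        show "norm (\<epsilon> *\<^sub>R f (fst w)) \<le> \<epsilon> * real CARD('n)"
          using e n orthogonal_transformation_norm[OF f, of "fst w"] by simp
        have "\<epsilon> * snd w \<le> 1" using e n by (intro mult_le_one) auto
        then show "norm (\<epsilon>\<^sup>2 * snd w) \<le> \<epsilon> * 1"
          using e n by (simp add: abs_mult power2_eq_square)
      qed
      also have "\<dots> = \<epsilon> * M" by (simp add: M_def distrib_left)
      also have "\<dots> < r" using e M by (simp add: pos_less_divide_eq)
      finally show "v \<in> U" using r by (auto simp: dist_commute)
    qed
    then have "continuous_on (heat_ball \<epsilon> (x, t)) \<phi>" if "0 < \<epsilon>" "\<epsilon> < min 1 (r / M)" for \<epsilon>
      using that continuous_on_subset[OF cont] by blast
    moreover have "0 < min 1 (r / M)" using r M by simp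
    ultimately show "\<forall>\<^sub>F \<epsilon> in at_right 0. continuous_on (heat_ball \<epsilon> (x, t)) \<phi>"
      unfolding eventually_at_right_field by blast
  qed
qed

section \<open>Finite exponents\<close>

text \<open>Since s < 1 on the ball, the positive moment of s is a lower bound.\<close>

lemma limit_integral_one_pos:
  fixes k :: "'n::finite"
  assumes N: "CARD('n) \<ge> 2" and q: "1 \<le> q"
  shows "0 < limit_integral q k (\<lambda>_. 1)"
proof -
  have "limit_integral q k snd \<le> limit_integral q k (\<lambda>_. 1)"
    unfolding limit_integral_def
  proof (rule integral_mono)
    show "integrable lborel (\<lambda>w. coord_weight q k (fst w) * (heat_weight (st_proj q k w) * snd (st_proj q k w)))"
      by (rule limit_integrable[OF N q, where C=1]) (use unit_heat_ball_time in force)+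
    show "integrable lborel (\<lambda>w. coord_weight q k (fst w) * (heat_weight (st_proj q k w) * 1))"
      by (rule limit_integrable[OF N q, where C=1]) auto
    fix w :: "(real^'n) \<times> real"
    have "heat_weight (st_proj q k w) * snd (st_proj q k w) \<le> heat_weight (st_proj q k w) * 1"
    proof (cases "st_proj q k w \<in> unit_heat_ball")
      case True
      then have "snd (st_proj q k w) \<le> 1"
        using unit_heat_ball_time(3)[of "fst (st_proj q k w)" "snd (st_proj q k w)"] unfolding prod.collapse by simp
      then show ?thesis by (rule mult_left_mono[OF _ heat_weight_bounds(1)])
    qed (simp add: heat_weight_def)
    then show "coord_weight q k (fst w) * (heat_weight (st_proj q k w) * snd (st_proj q k w)) \<le>
      coord_weight q k (fst w) * (heat_weight (st_proj q k w) * 1)"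
      by (rule mult_left_mono[OF _ coord_weight_nonneg])
  qed
  with limit_integral_snd_pos[OF N q, of k] show ?thesis by simp
qed

lemma heat_quadratic_continuous: "continuous_on S (heat_quadratic D c)"
proof -
  have "bounded_linear ((*v) D)" by (simp add: linear_conv_bounded_linear[symmetric])
  then have "continuous_on S (\<lambda>w. D *v fst w)"
    by (rule bounded_linear.continuous_on) (intro continuous_intros)
  then show ?thesis unfolding heat_quadratic_def[abs_def] by (intro continuous_intros) auto
qed

lemma bounded_on_unit_heat_ball:
  fixes h :: "(real^'n) \<times> real \<Rightarrow> real"
  assumes "continuous_on UNIV h"
  obtains C where "\<And>w. w \<in> unit_heat_ball \<Longrightarrow> \<bar>h w\<bar> \<le> C"
proof -
  let ?S = "cball (0::real^'n) (real CARD('n)) \<times> {0..1::real}"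
  have "compact (h ` ?S)"
    by (intro compact_continuous_image continuous_on_subset[OF assms] compact_Times) auto
  then have "bounded (h ` ?S)" by (rule compact_imp_bounded)
  then obtain C where "\<forall>x\<in>h ` ?S. norm x \<le> C" unfolding bounded_iff by (elim exE)
  then have C: "\<bar>h w\<bar> \<le> C" if "w \<in> ?S" for w using that by (cases w) simp
  have "w \<in> ?S" if "w \<in> unit_heat_ball" for w
    using that unit_heat_ball_norm(2)[of "fst w" "snd w"] unit_heat_ball_time[of "fst w" "snd w"]
    by (cases w) simp
  with C show thesis by (intro that[of C]) blast
qed

text \<open>What is kept of a test function: its expansion on the blown-up ball, where b stands for
  the length of the gradient, c for the time derivative and D for the rotated Hessian. Finite and
  infinite exponents both start from here.\<close>

locale heat_test_function =
  fixes \<phi> :: "(real ^ 'n) \<times> real \<Rightarrow> real" and z :: "(real ^ 'n) \<times> real"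
    and f :: "real ^ 'n \<Rightarrow> real ^ 'n" and D :: "real ^ 'n ^ 'n" and k :: 'n and b c :: real
  assumes dim: "CARD('n) \<ge> 2" and b: "0 < b" and f: "orthogonal_transformation f"
    and expansion: "\<And>\<delta>. 0 < \<delta> \<Longrightarrow> \<forall>\<^sub>F \<epsilon> in at_right 0. \<forall>w\<in>unit_heat_ball.
      \<bar>(\<phi> (blow_up f z \<epsilon> w) - \<phi> z - \<epsilon> * (b * fst w $ k)) / \<epsilon>\<^sup>2 - heat_quadratic D c w\<bar> \<le> \<delta>"
    and continuous: "\<forall>\<^sub>F \<epsilon> in at_right 0. continuous_on (heat_ball \<epsilon> z) \<phi>"
begin

definition rest :: "real \<Rightarrow> (real ^ 'n) \<times> real \<Rightarrow> real" where
  "rest \<epsilon> w = (\<phi> (blow_up f z \<epsilon> w) - \<phi> z - \<epsilon> * (b * fst w $ k)) / \<epsilon>\<^sup>2"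

text \<open>The tolerance 1 is arbitrary; it bounds \<open>rest\<close> uniformly on the ball, and
  with it the test function on the heat ball.\<close>

definition small :: "real \<Rightarrow> bool" where
  "small \<epsilon> \<longleftrightarrow> 0 < \<epsilon> \<and> \<epsilon> \<le> 1 \<and> continuous_on (heat_ball \<epsilon> z) \<phi> \<and>
    (\<forall>w\<in>unit_heat_ball. \<bar>rest \<epsilon> w - heat_quadratic D c w\<bar> \<le> 1)"

lemma eventually_small: "\<forall>\<^sub>F \<epsilon> in at_right 0. small \<epsilon>"
proof -
  have "\<forall>\<^sub>F \<epsilon> in at_right (0::real). 0 < \<epsilon> \<and> \<epsilon> \<le> 1"
    unfolding eventually_at_right_field by (intro exI[of _ 1]) auto
  then show ?thesis
    using continuous expansion[of 1, OF zero_less_one] unfolding small_def rest_def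
    by eventually_elim auto
qed

lemma blow_up_eq: "0 < \<epsilon> \<Longrightarrow> \<phi> (blow_up f z \<epsilon> w) = \<phi> z + \<epsilon> * (b * fst w $ k + \<epsilon> * rest \<epsilon> w)"
  by (simp add: rest_def power2_eq_square field_simps)

lemma blow_up_continuous_on:
  assumes "small \<epsilon>"
  shows "continuous_on unit_heat_ball (\<lambda>w. \<phi> (blow_up f z \<epsilon> w))"
proof (rule continuous_on_compose2[where g=\<phi> and t="heat_ball \<epsilon> z"])
  show "blow_up f z \<epsilon> ` unit_heat_ball \<subseteq> heat_ball \<epsilon> z"
    using assms blow_up_heat_ball(2)[OF _ f, of \<epsilon> z] by (simp add: small_def)
qed (use assms f in \<open>auto simp: small_def intro: blow_up_continuous\<close>)

lemma rest_continuous_on: "small \<epsilon> \<Longrightarrow> continuous_on unit_heat_ball (rest \<epsilon>)"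
  unfolding rest_def[abs_def]
  by (intro continuous_intros blow_up_continuous_on) (auto simp: small_def)

end

locale heat_test_exponent = heat_test_function \<phi> z f D k b c
  for \<phi> :: "(real ^ 'n) \<times> real \<Rightarrow> real" and z f D k b c +
  fixes q :: real
  assumes q: "1 \<le> q"
begin

text \<open>Up to a positive factor the signed integral at the level \<phi>(z) + \<epsilon>^2
  \<kappa> in blown-up variables. The inner indicator makes the perturbation measurable on the whole
  space although \<phi> is continuous only on the heat ball.\<close>

definition balance :: "real \<Rightarrow> real \<Rightarrow> real" where
  "balance \<kappa> \<epsilon> = (\<integral>w. heat_weight w *
    signed_powr (q - 1) (b * fst w $ k + \<epsilon> * (indicator unit_heat_ball w * (rest \<epsilon> w - \<kappa>))) \<partial>lborel)"

lemma balance_limit: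
  assumes e: "\<And>n. small (e n)" "e \<longlonglongrightarrow> 0"
  shows "\<exists>C>0. (\<lambda>n. balance \<kappa> (e n) / e n) \<longlonglongrightarrow> C * limit_integral q k (\<lambda>w. heat_quadratic D c w - \<kappa>)"
proof -
  obtain C where C: "\<And>w. w \<in> unit_heat_ball \<Longrightarrow> \<bar>heat_quadratic D c w\<bar> \<le> C"
    using bounded_on_unit_heat_ball[OF heat_quadratic_continuous] by blast
  have "perturbation q b (C + 1 + \<bar>\<kappa>\<bar>) (\<lambda>w. heat_quadratic D c w - \<kappa>)
    (\<lambda>n w. indicator unit_heat_ball w * (rest (e n) w - \<kappa>)) e"
  proof
    show "continuous_on UNIV (\<lambda>w. heat_quadratic D c w - \<kappa>)"
      by (intro continuous_intros heat_quadratic_continuous)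
    show "(\<lambda>w. indicator unit_heat_ball w * (rest (e n) w - \<kappa>)) \<in> borel_measurable borel" for n
      using borel_measurable_continuous_on_indicator[OF unit_heat_ball_borel, of "\<lambda>w. rest (e n) w - \<kappa>"]
      by (simp add: continuous_on_diff rest_continuous_on e)
    fix w :: "(real^'n) \<times> real" assume w: "w \<in> unit_heat_ball"
    show "\<bar>heat_quadratic D c w - \<kappa>\<bar> \<le> C + 1 + \<bar>\<kappa>\<bar>" using C[OF w] by linarith
    fix n
    have "\<bar>rest (e n) w - heat_quadratic D c w\<bar> \<le> 1" using e(1)[of n] w by (simp add: small_def)
    then show "\<bar>indicator unit_heat_ball w * (rest (e n) w - \<kappa>)\<bar> \<le> C + 1 + \<bar>\<kappa>\<bar>"
      using C[OF w] w by simp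
  next
    fix \<delta> :: real assume \<delta>: "0 < \<delta>"
    have "0 < e n" for n using e(1)[of n] by (simp add: small_def)
    then have "filterlim e (at_right 0) sequentially"
      unfolding filterlim_at using e(2) by (simp add: less_imp_neq[symmetric])
    with expansion[OF \<delta>]
    have "\<forall>\<^sub>F n in sequentially. \<forall>w\<in>unit_heat_ball. \<bar>rest (e n) w - heat_quadratic D c w\<bar> \<le> \<delta>"
      unfolding rest_def by (rule eventually_compose_filterlim)
    then show "\<forall>\<^sub>F n in sequentially. \<forall>w\<in>unit_heat_ball.
      \<bar>indicator unit_heat_ball w * (rest (e n) w - \<kappa>) - (heat_quadratic D c w - \<kappa>)\<bar> \<le> \<delta>"
      by eventually_elim simp
  qed (use dim q b e in \<open>auto simp: small_def\<close>)
  then interpret perturbation k q b "C + 1 + \<bar>\<kappa>\<bar>" "\<lambda>w. heat_quadratic D c w - \<kappa>"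
    "\<lambda>n w. indicator unit_heat_ball w * (rest (e n) w - \<kappa>)" e .
  show ?thesis using limit_signed unfolding balance_def .
qed

text \<open>The way back from null sequences, on which dominated convergence operates, to the filter
  \<epsilon> \<rightarrow> 0.\<close>

lemma eventually_of_small_sequences:
  assumes P: "\<And>e. (\<And>n. small (e n)) \<Longrightarrow> e \<longlonglongrightarrow> 0 \<Longrightarrow> \<forall>\<^sub>F n in sequentially. P (e n)"
  shows "\<forall>\<^sub>F \<epsilon> in at_right 0. P \<epsilon>"
proof -
  obtain r where r: "0 < r" "\<And>\<epsilon>. 0 < \<epsilon> \<Longrightarrow> \<epsilon> < r \<Longrightarrow> small \<epsilon>"
    using eventually_small unfolding eventually_at_right_field by blast
  show ?thesis
    by (rule sequentially_imp_eventually_at_right[OF r(1)]) (use P r in auto)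
qed

lemma eventually_balance_neg:
  assumes "limit_integral q k (\<lambda>w. heat_quadratic D c w - \<kappa>) < 0"
  shows "\<forall>\<^sub>F \<epsilon> in at_right 0. balance \<kappa> \<epsilon> < 0"
proof (rule eventually_of_small_sequences)
  fix e :: "nat \<Rightarrow> real" assume e: "\<And>n. small (e n)" "e \<longlonglongrightarrow> 0"
  obtain C where C: "0 < C" "(\<lambda>n. balance \<kappa> (e n) / e n) \<longlonglongrightarrow> C * limit_integral q k (\<lambda>w. heat_quadratic D c w - \<kappa>)"
    using balance_limit[OF e] by blast
  have "C * limit_integral q k (\<lambda>w. heat_quadratic D c w - \<kappa>) < 0" using C(1) assms by (rule mult_pos_neg)
  with C(2) have "\<forall>\<^sub>F n in sequentially. balance \<kappa> (e n) / e n < 0" by (rule order_tendstoD)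
  then show "\<forall>\<^sub>F n in sequentially. balance \<kappa> (e n) < 0"
    by eventually_elim (use e(1) in \<open>auto simp: small_def divide_less_0_iff dest: order.asym\<close>)
qed

lemma eventually_balance_pos:
  assumes "0 < limit_integral q k (\<lambda>w. heat_quadratic D c w - \<kappa>)"
  shows "\<forall>\<^sub>F \<epsilon> in at_right 0. 0 < balance \<kappa> \<epsilon>"
proof (rule eventually_of_small_sequences)
  fix e :: "nat \<Rightarrow> real" assume e: "\<And>n. small (e n)" "e \<longlonglongrightarrow> 0"
  obtain C where C: "0 < C" "(\<lambda>n. balance \<kappa> (e n) / e n) \<longlonglongrightarrow> C * limit_integral q k (\<lambda>w. heat_quadratic D c w - \<kappa>)"
    using balance_limit[OF e] by blast
  have "0 < C * limit_integral q k (\<lambda>w. heat_quadratic D c w - \<kappa>)" using C(1) assms by simp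
  with C(2) have "\<forall>\<^sub>F n in sequentially. 0 < balance \<kappa> (e n) / e n" by (rule order_tendstoD)
  then show "\<forall>\<^sub>F n in sequentially. 0 < balance \<kappa> (e n)"
    by eventually_elim (use e(1) in \<open>auto simp: small_def zero_less_divide_iff dest: order.asym\<close>)
qed

lemma heat_measure_unsplit:
  assumes "small \<epsilon>"
  shows "\<exists>B. unsplit_function (heat_measure \<epsilon> z) \<phi> B q"
proof -
  have e: "0 < \<epsilon>" "\<epsilon> \<le> 1" and cont: "continuous_on (heat_ball \<epsilon> z) \<phi>"
    and r: "\<And>w. w \<in> unit_heat_ball \<Longrightarrow> \<bar>rest \<epsilon> w - heat_quadratic D c w\<bar> \<le> 1"
    using assms by (auto simp: small_def)
  obtain C where C: "\<And>w. w \<in> unit_heat_ball \<Longrightarrow> \<bar>heat_quadratic D c w\<bar> \<le> C"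
    using bounded_on_unit_heat_ball[OF heat_quadratic_continuous] by blast
  have "continuous_on UNIV (\<lambda>w::(real^'n) \<times> real. b * fst w $ k)" by (intro continuous_intros)
  then obtain C' where C': "\<And>w. w \<in> unit_heat_ball \<Longrightarrow> \<bar>b * fst w $ k\<bar> \<le> C'"
    by (rule bounded_on_unit_heat_ball) (rule that)
  have nonempty: "heat_ball \<epsilon> z \<noteq> {}"
    unfolding blow_up_heat_ball(2)[OF e(1) f] using unit_heat_ball_nonempty by blast
  have AEne: "\<not> (AE w in heat_measure \<epsilon> z. False)"
  proof
    assume "AE w in heat_measure \<epsilon> z. False"
    then have "AE w in heat_measure \<epsilon> z. w \<notin> heat_ball \<epsilon> z" by eventually_elim simp
    with nonempty show False
      using heat_measure_charges_open[OF e(1) heat_ball_open[OF e(1)] subset_refl] by blast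
  qed
  interpret finite_measure "heat_measure \<epsilon> z" by (rule heat_measure_finite[OF dim e(1)])
  have "unsplit_function (heat_measure \<epsilon> z) \<phi> (\<bar>\<phi> z\<bar> + (C' + (C + 1))) q"
  proof
    show "emeasure (heat_measure \<epsilon> z) (space (heat_measure \<epsilon> z)) \<noteq> 0"
      using AEne ae_filter_eq_bot_iff[of "heat_measure \<epsilon> z"] by (auto simp: eventually_False)
    show "\<phi> \<in> borel_measurable (heat_measure \<epsilon> z)"
      by (rule heat_measure_continuous_measurable[OF cont])
    fix v assume "v \<in> space (heat_measure \<epsilon> z)"
    then obtain w where w: "w \<in> unit_heat_ball" "v = blow_up f z \<epsilon> w"
      using blow_up_heat_ball(2)[OF e(1) f, of z] by auto
    have "\<bar>\<epsilon> * rest \<epsilon> w\<bar> \<le> 1 * (C + 1)"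
      unfolding abs_mult using e r[OF w(1)] C[OF w(1)] by (intro mult_mono) auto
    then have "\<bar>b * fst w $ k + \<epsilon> * rest \<epsilon> w\<bar> \<le> C' + (C + 1)"
      by (intro order_trans[OF abs_triangle_ineq add_mono[OF C'[OF w(1)]]]) simp
    then have "\<bar>\<epsilon> * (b * fst w $ k + \<epsilon> * rest \<epsilon> w)\<bar> \<le> 1 * (C' + (C + 1))"
      unfolding abs_mult using e by (intro mult_mono) auto
    then show "\<bar>\<phi> v\<bar> \<le> \<bar>\<phi> z\<bar> + (C' + (C + 1))"
      unfolding w(2) blow_up_eq[OF e(1)] by (intro order_trans[OF abs_triangle_ineq add_left_mono]) simp
  next
    fix a b' :: real assume ab: "a < b'"
    show "(AE w in heat_measure \<epsilon> z. \<phi> w \<le> a) \<or> (AE w in heat_measure \<epsilon> z. b' \<le> \<phi> w) \<or>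
      \<not> (AE w in heat_measure \<epsilon> z. \<not> (a < \<phi> w \<and> \<phi> w < b'))"
      using heat_ball_unsplit[OF e(1) cont ab] by (auto intro!: AE_I2)
  qed (rule q)
  then show ?thesis by blast
qed

text \<open>In blown-up variables the argument of \<open>signed_powr\<close> has the common factor
  \<epsilon>, and homogeneity pulls it out as the positive constant \<epsilon>^(q-1).\<close>

lemma balance_integral:
  assumes "small \<epsilon>"
  shows "\<exists>K>0. (\<integral>w. signed_powr (q - 1) (\<phi> w - (\<phi> z + \<epsilon>\<^sup>2 * \<kappa>)) \<partial>heat_measure \<epsilon> z) = K * balance \<kappa> \<epsilon>"
proof -
  have e: "0 < \<epsilon>" and cont: "continuous_on (heat_ball \<epsilon> z) \<phi>" using assms by (auto simp: small_def)
  let ?F = "\<lambda>w. signed_powr (q - 1) (\<phi> w - (\<phi> z + \<epsilon>\<^sup>2 * \<kappa>))"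
  obtain K where K: "0 < K" "\<And>F. (\<lambda>w. indicator (heat_ball \<epsilon> z) w * F w) \<in> borel_measurable borel \<Longrightarrow>
      (\<integral>w. F w \<partial>heat_measure \<epsilon> z) = K * (\<integral>w. heat_weight w * F (blow_up f z \<epsilon> w) \<partial>lborel)"
    using heat_measure_integral[OF e f, of z] by blast
  have E: "heat_ball \<epsilon> z \<in> sets borel" using heat_ball_open[OF e] by (rule borel_open)
  have "(\<lambda>w. indicator (heat_ball \<epsilon> z) w * \<phi> w) \<in> borel_measurable borel"
    using borel_measurable_continuous_on_indicator[OF E cont] by simp
  then have "(\<lambda>w. indicator (heat_ball \<epsilon> z) w * signed_powr (q - 1) (indicator (heat_ball \<epsilon> z) w * \<phi> w - (\<phi> z + \<epsilon>\<^sup>2 * \<kappa>))) \<in> borel_measurable borel"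
    using E by measurable
  also have "(\<lambda>w. indicator (heat_ball \<epsilon> z) w * signed_powr (q - 1) (indicator (heat_ball \<epsilon> z) w * \<phi> w - (\<phi> z + \<epsilon>\<^sup>2 * \<kappa>))) =
    (\<lambda>w. indicator (heat_ball \<epsilon> z) w * ?F w)" by (auto simp: indicator_def)
  finally have "(\<integral>w. ?F w \<partial>heat_measure \<epsilon> z) = K * (\<integral>w. heat_weight w * ?F (blow_up f z \<epsilon> w) \<partial>lborel)"
    by (rule K(2))
  also have "(\<lambda>w. heat_weight w * ?F (blow_up f z \<epsilon> w)) =
    (\<lambda>w. \<epsilon> powr (q - 1) * (heat_weight w * signed_powr (q - 1) (b * fst w $ k + \<epsilon> * (indicator unit_heat_ball w * (rest \<epsilon> w - \<kappa>)))))"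
  proof
    fix w
    have "?F (blow_up f z \<epsilon> w) = signed_powr (q - 1) (\<epsilon> * (b * fst w $ k + \<epsilon> * (rest \<epsilon> w - \<kappa>)))"
      unfolding blow_up_eq[OF e] by (simp add: power2_eq_square algebra_simps)
    also have "\<dots> = \<epsilon> powr (q - 1) * signed_powr (q - 1) (b * fst w $ k + \<epsilon> * (rest \<epsilon> w - \<kappa>))"
      unfolding signed_powr_def abs_mult sgn_mult using e by (simp add: powr_mult del: distrib_left)
    finally show "heat_weight w * ?F (blow_up f z \<epsilon> w) =
      \<epsilon> powr (q - 1) * (heat_weight w * signed_powr (q - 1) (b * fst w $ k + \<epsilon> * (indicator unit_heat_ball w * (rest \<epsilon> w - \<kappa>))))"
      by (simp add: heat_weight_def indicator_def)
  qed
  finally have "(\<integral>w. ?F w \<partial>heat_measure \<epsilon> z) = (K * \<epsilon> powr (q - 1)) * balance \<kappa> \<epsilon>"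
    by (simp add: balance_def)
  moreover have "0 < K * \<epsilon> powr (q - 1)" using K(1) e by simp
  ultimately show ?thesis by blast
qed

lemma heat_mean_eq_Lp_mean: "heat_mean p \<epsilon> \<phi> z = Lp_mean (heat_measure \<epsilon> z) p \<phi>"
  by (simp add: heat_mean_def Lp_mean_def)

lemma heat_mean_le:
  assumes s: "small \<epsilon>" and "balance \<kappa> \<epsilon> < 0"
  shows "heat_mean (ereal q) \<epsilon> \<phi> z \<le> \<phi> z + \<epsilon>\<^sup>2 * \<kappa>"
proof -
  obtain K where K: "0 < K" "(\<integral>w. signed_powr (q - 1) (\<phi> w - (\<phi> z + \<epsilon>\<^sup>2 * \<kappa>)) \<partial>heat_measure \<epsilon> z) = K * balance \<kappa> \<epsilon>"
    using balance_integral[OF s] by blast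
  obtain B where "unsplit_function (heat_measure \<epsilon> z) \<phi> B q" using heat_measure_unsplit[OF s] by blast
  then show ?thesis
    unfolding heat_mean_eq_Lp_mean
    by (rule unsplit_function.Lp_mean_le) (use K assms in \<open>simp add: mult_pos_neg\<close>)
qed

lemma heat_mean_ge:
  assumes s: "small \<epsilon>" and "0 < balance \<kappa> \<epsilon>"
  shows "\<phi> z + \<epsilon>\<^sup>2 * \<kappa> \<le> heat_mean (ereal q) \<epsilon> \<phi> z"
proof -
  obtain K where K: "0 < K" "(\<integral>w. signed_powr (q - 1) (\<phi> w - (\<phi> z + \<epsilon>\<^sup>2 * \<kappa>)) \<partial>heat_measure \<epsilon> z) = K * balance \<kappa> \<epsilon>"
    using balance_integral[OF s] by blast
  obtain B where "unsplit_function (heat_measure \<epsilon> z) \<phi> B q" using heat_measure_unsplit[OF s] by blast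
  then show ?thesis
    unfolding heat_mean_eq_Lp_mean
    by (rule unsplit_function.Lp_mean_ge) (use K assms in simp)
qed

text \<open>The limit functional at the level \<kappa> is affine in \<kappa> with negative slope and
  its zero at the claimed limit. A \<kappa> below the zero makes \<open>balance\<close> positive and
  puts the mean above the level, a \<kappa> above it does the opposite. C is the ratio of the
  moments of s and 1.\<close>

lemma heat_mean_limit:
  "\<exists>C>0. ((\<lambda>\<epsilon>. (heat_mean (ereal q) \<epsilon> \<phi> z - \<phi> z) / \<epsilon>\<^sup>2) \<longlongrightarrow>
    C * (real CARD('n) / (real CARD('n) + q - 2) * (trace D + (q - 2) * D $ k $ k) - c)) (at_right 0)"
proof -
  define C where "C = limit_integral q k snd / limit_integral q k (\<lambda>_. 1)"
  let ?\<Lambda> = "real CARD('n) / (real CARD('n) + q - 2) * (trace D + (q - 2) * D $ k $ k) - c"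
  have one: "0 < limit_integral q k (\<lambda>_. 1)" by (rule limit_integral_one_pos[OF dim q])
  then have C: "0 < C" unfolding C_def using limit_integral_snd_pos[OF dim q, of k] by simp
  have L: "limit_integral q k (\<lambda>w. heat_quadratic D c w - \<kappa>) = limit_integral q k (\<lambda>_. 1) * (C * ?\<Lambda> - \<kappa>)" for \<kappa>
    unfolding limit_integral_quadratic[OF dim q] C_def right_diff_distrib[of _ _ \<kappa>] using one by simp
  have "((\<lambda>\<epsilon>. (heat_mean (ereal q) \<epsilon> \<phi> z - \<phi> z) / \<epsilon>\<^sup>2) \<longlongrightarrow> C * ?\<Lambda>) (at_right 0)"
  proof (rule order_tendstoI)
    fix a assume a: "a < C * ?\<Lambda>"
    then obtain \<kappa> where \<kappa>: "a < \<kappa>" "\<kappa> < C * ?\<Lambda>" using dense by blast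
    have "0 < limit_integral q k (\<lambda>w. heat_quadratic D c w - \<kappa>)" unfolding L using one \<kappa> by simp
    from eventually_balance_pos[OF this] eventually_small
    show "\<forall>\<^sub>F \<epsilon> in at_right 0. a < (heat_mean (ereal q) \<epsilon> \<phi> z - \<phi> z) / \<epsilon>\<^sup>2"
    proof eventually_elim
      case (elim \<epsilon>)
      then have "\<epsilon>\<^sup>2 * \<kappa> \<le> heat_mean (ereal q) \<epsilon> \<phi> z - \<phi> z" using heat_mean_ge[of \<epsilon> \<kappa>] by simp
      then have "\<kappa> \<le> (heat_mean (ereal q) \<epsilon> \<phi> z - \<phi> z) / \<epsilon>\<^sup>2"
        using elim by (simp add: small_def pos_le_divide_eq mult.commute)
      with \<kappa> show ?case by simp
    qed
  next
    fix a assume a: "C * ?\<Lambda> < a"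
    then obtain \<kappa> where \<kappa>: "C * ?\<Lambda> < \<kappa>" "\<kappa> < a" using dense by blast
    have "limit_integral q k (\<lambda>w. heat_quadratic D c w - \<kappa>) < 0" unfolding L using one \<kappa> by (simp add: mult_pos_neg)
    from eventually_balance_neg[OF this] eventually_small
    show "\<forall>\<^sub>F \<epsilon> in at_right 0. (heat_mean (ereal q) \<epsilon> \<phi> z - \<phi> z) / \<epsilon>\<^sup>2 < a"
    proof eventually_elim
      case (elim \<epsilon>)
      then have "heat_mean (ereal q) \<epsilon> \<phi> z - \<phi> z \<le> \<epsilon>\<^sup>2 * \<kappa>" using heat_mean_le[of \<epsilon> \<kappa>] by simp
      then have "(heat_mean (ereal q) \<epsilon> \<phi> z - \<phi> z) / \<epsilon>\<^sup>2 \<le> \<kappa>"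
        using elim by (simp add: small_def pos_divide_le_eq mult.commute)
      with \<kappa> show ?case by simp
    qed
  qed
  with C show ?thesis by blast
qed

end

section \<open>The infinite exponent\<close>

lemma heat_radius_sq_quantitative:
  fixes N s :: real
  assumes N: "0 \<le> N" and s: "0 < s"
  shows "heat_radius_sq N s \<le> N / (2 * pi * exp 1) * (1 - (1 - sqrt (4 * pi * exp 1 * s))\<^sup>2)"
proof -
  \<comment> \<open>In this variable \<open>ln x \<le> x - 1\<close> at x = 1 / v turns the loss
    from the maximal squared radius into the exact square (1 - v)^2.\<close>
  define v where "v = sqrt (4 * pi * exp 1 * s)"
  have v: "0 < v" "v\<^sup>2 = 4 * pi * exp 1 * s" using s by (simp_all add: v_def)
  have "ln (1 / v) \<le> 1 / v - 1" using v by (intro ln_le_minus_one) simp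
  then have lv: "- ln v \<le> 1 / v - 1" using v by (simp add: ln_div)
  have "4 * pi * s = v\<^sup>2 / exp 1" using v(2) by simp
  then have l: "ln (4 * pi * s) = 2 * ln v - 1" using v(1) by (simp add: ln_div ln_realpow)
  have s': "v\<^sup>2 / (4 * pi * exp 1) = s" using v(2) by simp
  have "heat_radius_sq N s = - 2 * N * (v\<^sup>2 / (4 * pi * exp 1)) * (2 * ln v - 1)"
    unfolding heat_radius_sq_def l s' ..
  also have "\<dots> = N / (2 * pi * exp 1) * (v\<^sup>2 * (1 - 2 * ln v))"
    by (simp add: field_simps)
  also have "\<dots> \<le> N / (2 * pi * exp 1) * (v\<^sup>2 * (1 + 2 * (1 / v - 1)))"
    using lv N by (intro mult_left_mono) auto
  also have "v\<^sup>2 * (1 + 2 * (1 / v - 1)) = 1 - (1 - v)\<^sup>2"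
    using v(1) by (simp add: power2_eq_square field_simps)
  finally show ?thesis by (simp add: v_def)
qed

text \<open>The largest slice radius, attained at s = 1 / (4 pi e).\<close>

definition tip_radius :: "real \<Rightarrow> real" where
  "tip_radius N = sqrt (N / (2 * pi * exp 1))"

text \<open>The boundary point of the unit heat ball at which the coordinate \<open>y\<^sub>k\<close> is maximal.\<close>

definition tip :: "'n \<Rightarrow> (real ^ 'n) \<times> real" where
  "tip k = (tip_radius (real CARD('n)) *\<^sub>R axis k 1, 1 / (4 * pi * exp 1))"

lemma tip_radius_pos: "0 < tip_radius (real CARD('n::finite))"
  by (simp add: tip_radius_def)

text \<open>A nearly maximal y_k leaves no freedom. As |y| cannot exceed the maximal radius R, |y -
  R e_k|^2 is at most 2 R times the defect; and the slice radius must be close to R, which pins the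
  time by \<open>heat_radius_sq_quantitative\<close>.\<close>

lemma unit_heat_ball_near_tip:
  fixes k :: "'n::finite" and w :: "nat \<Rightarrow> (real ^ 'n) \<times> real"
  assumes w: "\<And>n. w n \<in> unit_heat_ball"
    and lim: "\<And>n. tip_radius (real CARD('n)) - e n \<le> fst (w n) $ k" "e \<longlonglongrightarrow> 0"
  shows "w \<longlonglongrightarrow> tip k"
proof -
  let ?N = "real CARD('n)"
  define R where "R = tip_radius ?N"
  define y where "y n = fst (w n)" for n
  define s where "s n = snd (w n)" for n
  have R: "0 < R" "R\<^sup>2 = ?N / (2 * pi * exp 1)" using tip_radius_pos[where 'n='n] by (simp_all add: R_def tip_radius_def)
  have s: "0 < s n" for n using w[of n] by (simp add: s_def unit_heat_ball_snd_pos)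
  have ys: "(norm (y n))\<^sup>2 < heat_radius_sq ?N (s n)" for n
    using w[of n] by (simp add: y_def s_def unit_heat_ball_def case_prod_beta)
  have yR: "(norm (y n))\<^sup>2 \<le> R\<^sup>2" for n
    using ys[of n] heat_radius_sq_le[of ?N "s n"] s[of n] by (simp add: R)
  have yk: "R - e n \<le> y n $ k" for n using lim(1)[of n] by (simp add: R_def y_def)
  have ybound: "(norm (y n - R *\<^sub>R axis k 1))\<^sup>2 \<le> 2 * R * e n" for n
  proof -
    have "(norm (y n - R *\<^sub>R axis k 1))\<^sup>2 = (norm (y n))\<^sup>2 - 2 * R * y n $ k + R\<^sup>2"
      by (simp add: power2_norm_eq_inner inner_diff_left inner_diff_right inner_axis inner_axis' axis_nth_same power2_eq_square[of R] right_diff_distrib)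
    also have "\<dots> \<le> R\<^sup>2 - 2 * R * (R - e n) + R\<^sup>2"
    proof -
      have "2 * R * (R - e n) \<le> 2 * R * y n $ k" by (rule mult_left_mono[OF yk]) (use R(1) in simp)
      then show ?thesis using yR[of n] by linarith
    qed
    finally show ?thesis by (simp add: power2_eq_square algebra_simps)
  qed
  have "(\<lambda>n. 2 * R * e n) \<longlonglongrightarrow> 0" using tendsto_mult_right_zero[OF lim(2), of "2 * R"] .
  then have "(\<lambda>n. (norm (y n - R *\<^sub>R axis k 1))\<^sup>2) \<longlonglongrightarrow> 0"
    by (rule tendsto_sandwich[OF _ _ tendsto_const, rotated 2])
      (rule always_eventually, simp, rule always_eventually, rule allI, rule ybound)
  then have "(\<lambda>n. sqrt ((norm (y n - R *\<^sub>R axis k 1))\<^sup>2)) \<longlonglongrightarrow> sqrt 0" by (rule tendsto_real_sqrt)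
  then have ylim: "y \<longlonglongrightarrow> R *\<^sub>R axis k 1"
    by (simp add: tendsto_norm_zero_iff LIM_zero_iff)
  define v where "v n = sqrt (4 * pi * exp 1 * s n)" for n
  have ynorm: "(R - \<bar>e n\<bar>) * R \<le> (norm (y n)) * R" for n
    using component_le_norm_cart[of "y n" k] yk[of n] R(1) by (intro mult_right_mono) auto
  have vbound: "(1 - v n)\<^sup>2 \<le> 2 * \<bar>e n\<bar> / R" for n
  proof -
    have "R\<^sup>2 - 2 * R * \<bar>e n\<bar> \<le> (norm (y n))\<^sup>2"
    proof -
      have "0 \<le> (R - norm (y n))\<^sup>2" by simp
      then have "2 * (norm (y n) * R) - R\<^sup>2 \<le> (norm (y n))\<^sup>2" by (simp add: power2_eq_square algebra_simps)
      moreover have "R\<^sup>2 - R * \<bar>e n\<bar> \<le> norm (y n) * R" using ynorm[of n] by (simp add: power2_eq_square algebra_simps)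
      ultimately show ?thesis by linarith
    qed
    also have "\<dots> \<le> R\<^sup>2 * (1 - (1 - v n)\<^sup>2)"
      using ys[of n] heat_radius_sq_quantitative[of ?N "s n"] s[of n] unfolding R(2) v_def by simp
    finally have "R\<^sup>2 * (1 - v n)\<^sup>2 \<le> 2 * R * \<bar>e n\<bar>" by (simp add: algebra_simps)
    then have "R * (R * (1 - v n)\<^sup>2) \<le> R * (2 * \<bar>e n\<bar>)" by (simp add: power2_eq_square mult_ac)
    then have "R * (1 - v n)\<^sup>2 \<le> 2 * \<bar>e n\<bar>" using R(1) by (rule mult_left_le_imp_le)
    then show ?thesis using R(1) by (simp add: pos_le_divide_eq mult.commute)
  qed
  have "(\<lambda>n. 2 * \<bar>e n\<bar> / R) \<longlonglongrightarrow> 0"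
    using tendsto_mult_right_zero[OF tendsto_rabs_zero[OF lim(2)], of "2 / R"] by simp
  then have "(\<lambda>n. (1 - v n)\<^sup>2) \<longlonglongrightarrow> 0"
    by (rule tendsto_sandwich[OF _ _ tendsto_const, rotated 2])
      (rule always_eventually, simp, rule always_eventually, rule allI, rule vbound)
  then have "(\<lambda>n. sqrt ((1 - v n)\<^sup>2)) \<longlonglongrightarrow> sqrt 0" by (rule tendsto_real_sqrt)
  then have "(\<lambda>n. 1 - v n) \<longlonglongrightarrow> 0" by (simp add: tendsto_rabs_zero_iff)
  from tendsto_diff[OF tendsto_const[of 1] this] have "v \<longlonglongrightarrow> 1" by simp
  from tendsto_divide[OF tendsto_power[OF this, of 2] tendsto_const[of "4 * pi * exp 1"]]
  have "(\<lambda>n. (v n)\<^sup>2 / (4 * pi * exp 1)) \<longlonglongrightarrow> 1 / (4 * pi * exp 1)" by simp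
  then have slim: "s \<longlonglongrightarrow> 1 / (4 * pi * exp 1)"
    using s by (simp add: v_def less_imp_le)
  have "(\<lambda>n. (y n, s n)) \<longlonglongrightarrow> tip k" unfolding tip_def R_def[symmetric] by (rule tendsto_Pair[OF ylim slim])
  then show ?thesis by (simp add: y_def s_def)
qed

text \<open>A uniform gap away from the tip: without one, points with defects 1 / (n + 1) would
  converge to the tip while keeping their distance from it.\<close>

lemma unit_heat_ball_tip_gap:
  fixes k :: "'n::finite"
  assumes "0 < r"
  obtains \<eta> where "0 < \<eta>" "\<And>w. w \<in> unit_heat_ball \<Longrightarrow> r \<le> dist w (tip k) \<Longrightarrow> fst w $ k < tip_radius (real CARD('n)) - \<eta>"
proof (rule ccontr)
  let ?R = "tip_radius (real CARD('n))"
  assume "\<not> thesis"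
  then have "\<exists>w\<in>unit_heat_ball. r \<le> dist w (tip k) \<and> ?R - inverse (real (Suc n)) \<le> fst w $ k" for n
    using that[of "inverse (real (Suc n))"] by (force simp: not_less)
  then obtain w where w: "\<And>n. w n \<in> unit_heat_ball" "\<And>n. r \<le> dist (w n) (tip k)"
    "\<And>n. ?R - inverse (real (Suc n)) \<le> fst (w n) $ k" by metis
  have "w \<longlonglongrightarrow> tip k"
    by (rule unit_heat_ball_near_tip[OF w(1,3) LIMSEQ_inverse_real_of_nat])
  then have "\<forall>\<^sub>F n in sequentially. dist (w n) (tip k) < r" using assms by (rule tendstoD)
  then show False using w(2) by (auto simp: eventually_sequentially not_less[symmetric])
qed

text \<open>The supremum of b y_k + \<epsilon> G to first order in \<epsilon>, phrased through upper
  bounds. Away from the tip the linear term loses a fixed b \<eta>, more than a perturbation of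
  order \<epsilon> can regain; near the tip continuity of \<open>g\<close> applies.\<close>

lemma unit_heat_ball_sup:
  fixes k :: "'n::finite" and g :: "(real ^ 'n) \<times> real \<Rightarrow> real"
  assumes b: "0 < b" and g: "continuous_on UNIV g" and \<delta>: "0 < \<delta>"
    and G: "\<And>\<delta>. 0 < \<delta> \<Longrightarrow> \<forall>\<^sub>F \<epsilon> in at_right 0. \<forall>w\<in>unit_heat_ball. \<bar>G \<epsilon> w - g w\<bar> \<le> \<delta>"
  shows "\<forall>\<^sub>F \<epsilon> in at_right 0.
    (\<forall>w\<in>unit_heat_ball. b * fst w $ k + \<epsilon> * G \<epsilon> w \<le> b * tip_radius (real CARD('n)) + \<epsilon> * (g (tip k) + \<delta>)) \<and>
    (\<forall>X. (\<forall>w\<in>unit_heat_ball. b * fst w $ k + \<epsilon> * G \<epsilon> w \<le> X) \<longrightarrow>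
      b * tip_radius (real CARD('n)) + \<epsilon> * (g (tip k) - \<delta>) \<le> X)"
proof -
  let ?R = "tip_radius (real CARD('n))"
  have R: "0 < ?R" "?R\<^sup>2 = real CARD('n) / (2 * pi * exp 1)"
    using tip_radius_pos[where 'n='n] by (simp_all add: tip_radius_def)
  have comp: "fst w $ k \<le> ?R" if "w \<in> unit_heat_ball" for w
  proof -
    have "(norm (fst w))\<^sup>2 < heat_radius_sq (real CARD('n)) (snd w)" "0 < snd w"
      using that by (auto simp: unit_heat_ball_def)
    then have "(norm (fst w))\<^sup>2 \<le> ?R\<^sup>2" using heat_radius_sq_le[of "real CARD('n)" "snd w"] by (simp add: R)
    then have "norm (fst w) \<le> ?R" by (rule power2_le_imp_le) (use R in simp)
    then show ?thesis using component_le_norm_cart[of "fst w" k] by linarith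
  qed
  have "isCont g (tip k)" using g by (simp only: continuous_on_eq_continuous_at[OF open_UNIV] UNIV_I)
  then obtain r where r: "0 < r" "\<And>w. dist w (tip k) < r \<Longrightarrow> dist (g w) (g (tip k)) < \<delta> / 2"
    using \<delta> unfolding continuous_at_eps_delta by (metis half_gt_zero)
  obtain \<eta> where \<eta>: "0 < \<eta>" "\<And>w. w \<in> unit_heat_ball \<Longrightarrow> r \<le> dist w (tip k) \<Longrightarrow> fst w $ k < ?R - \<eta>"
    using unit_heat_ball_tip_gap[OF r(1)] by blast
  obtain C where C: "\<And>w. w \<in> unit_heat_ball \<Longrightarrow> \<bar>g w\<bar> \<le> C"
    using bounded_on_unit_heat_ball[OF g] by blast
  \<comment> \<open>A bound for \<open>G\<close> on the ball enlarged by |g(tip)|, so that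
    \<epsilon> C' \<le> b \<eta> lets the loss of the linear term also cover a negative value at the
    tip.\<close>
  define C' where "C' = \<bar>C\<bar> + \<delta> / 2 + \<bar>g (tip k)\<bar>"
  have C': "0 < C'" using \<delta> by (simp add: C'_def)
  have "0 < b * \<eta> / C'" using b \<eta> C' by simp
  then have "\<forall>\<^sub>F \<epsilon> in at_right 0. 0 < \<epsilon> \<and> \<epsilon> < b * \<eta> / C'"
    unfolding eventually_at_right_field by blast
  moreover have "\<forall>\<^sub>F \<epsilon> in at_right 0. \<forall>w\<in>unit_heat_ball. \<bar>G \<epsilon> w - g w\<bar> \<le> \<delta> / 2"
    using \<delta> by (intro G) simp
  ultimately show ?thesis
  proof eventually_elim
    case (elim \<epsilon>)
    have e: "0 < \<epsilon>" "\<epsilon> * C' \<le> b * \<eta>" using elim(1) C' by (auto simp: pos_less_divide_eq)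
    show ?case
    proof (intro conjI ballI allI impI)
      fix w :: "(real^'n) \<times> real" assume w: "w \<in> unit_heat_ball"
      have "\<bar>G \<epsilon> w - g w\<bar> \<le> \<delta> / 2" using elim(2) w by blast
      then have Gw: "G \<epsilon> w \<le> g w + \<delta> / 2" by linarith
      show "b * fst w $ k + \<epsilon> * G \<epsilon> w \<le> b * ?R + \<epsilon> * (g (tip k) + \<delta>)"
      proof (cases "dist w (tip k) < r")
        case True
        have "\<bar>g w - g (tip k)\<bar> < \<delta> / 2" using r(2)[OF True] by (simp only: dist_real_def)
        then have "G \<epsilon> w \<le> g (tip k) + \<delta>" using Gw by linarith
        then show ?thesis using comp[OF w] b e by (intro add_mono mult_left_mono) auto
      next
        case False
        have "b * fst w $ k \<le> b * (?R - \<eta>)" using \<eta>(2)[OF w] False b by (intro mult_left_mono) auto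
        moreover have "\<epsilon> * G \<epsilon> w \<le> \<epsilon> * (C' - \<bar>g (tip k)\<bar>)"
          using Gw C[OF w] e by (intro mult_left_mono) (auto simp: C'_def)
        moreover have "\<epsilon> * (C' - \<bar>g (tip k)\<bar>) = \<epsilon> * C' + \<epsilon> * (- \<bar>g (tip k)\<bar>)" by (simp add: algebra_simps)
        moreover have "\<epsilon> * (- \<bar>g (tip k)\<bar>) \<le> \<epsilon> * (g (tip k) + \<delta>)"
          using e \<delta> by (intro mult_left_mono) auto
        ultimately show ?thesis using e(2) by (simp add: right_diff_distrib)
      qed
    next
      fix X assume X: "\<forall>w\<in>unit_heat_ball. b * fst w $ k + \<epsilon> * G \<epsilon> w \<le> X"
      define l where "l n = 1 - inverse (real (Suc n))" for n
      \<comment> \<open>The tip is a boundary point of the open ball, so the lower bound is reached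
        along interior points on the segment towards it.\<close>
      define v :: "nat \<Rightarrow> (real^'n) \<times> real" where "v n = (l n *\<^sub>R (?R *\<^sub>R axis k 1), 1 / (4 * pi * exp 1))" for n
      have l: "0 \<le> l n" "l n < 1" for n by (simp_all add: l_def field_simps)
      have vH: "v n \<in> (unit_heat_ball :: ((real^'n) \<times> real) set)" for n
      proof -
        have "(l n)\<^sup>2 * ?R\<^sup>2 < 1 * ?R\<^sup>2"
          using l[of n] R by (intro mult_strict_right_mono) (auto simp: power_less_one_iff abs_square_less_1)
        then show ?thesis
          using l[of n] R by (simp add: v_def unit_heat_ball_def heat_radius_sq_max power_mult_distrib norm_axis_1)
      qed
      have llim: "l \<longlonglongrightarrow> 1"
        unfolding l_def using tendsto_diff[OF tendsto_const[of 1] LIMSEQ_inverse_real_of_nat] by simp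
      have "v \<longlonglongrightarrow> (1 *\<^sub>R (?R *\<^sub>R axis k 1), 1 / (4 * pi * exp 1))"
        unfolding v_def by (intro tendsto_intros llim)
      then have vlim: "v \<longlonglongrightarrow> tip k" by (simp add: tip_def)
      have "(\<lambda>n. g (v n)) \<longlonglongrightarrow> g (tip k)" by (rule isCont_tendsto_compose[OF \<open>isCont g (tip k)\<close> vlim])
      then have "(\<lambda>n. b * (l n * ?R) + \<epsilon> * (g (v n) - \<delta> / 2)) \<longlonglongrightarrow> b * (1 * ?R) + \<epsilon> * (g (tip k) - \<delta> / 2)"
        by (intro tendsto_intros llim)
      moreover have "b * (l n * ?R) + \<epsilon> * (g (v n) - \<delta> / 2) \<le> X" for n
      proof -
        have "\<bar>G \<epsilon> (v n) - g (v n)\<bar> \<le> \<delta> / 2" using elim(2) vH[of n] by blast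
        then have "g (v n) - \<delta> / 2 \<le> G \<epsilon> (v n)" by linarith
        then have "\<epsilon> * (g (v n) - \<delta> / 2) \<le> \<epsilon> * G \<epsilon> (v n)" using e by (intro mult_left_mono) auto
        moreover have "fst (v n) $ k = l n * ?R" by (simp add: v_def axis_nth_same)
        ultimately show ?thesis using bspec[OF X vH[of n]] by simp
      qed
      ultimately have "b * (1 * ?R) + \<epsilon> * (g (tip k) - \<delta> / 2) \<le> X"
        by (intro LIMSEQ_le_const2) auto
      moreover have "\<epsilon> * (g (tip k) - \<delta>) \<le> \<epsilon> * (g (tip k) - \<delta> / 2)"
        using e \<delta> by (intro mult_left_mono) auto
      ultimately show "b * ?R + \<epsilon> * (g (tip k) - \<delta>) \<le> X" by simp
    qed
  qed
qed

text \<open>Continuity and the charging of open sets turn the essential supremum into a supremum,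
  and the farthest value from m is then one of the two extremes.\<close>

lemma Lp_norm_infinity:
  fixes z :: "(real^'n) \<times> real" and \<phi> :: "(real^'n) \<times> real \<Rightarrow> real"
  assumes e: "0 < \<epsilon>" and \<phi>: "continuous_on (heat_ball \<epsilon> z) \<phi>" and ne: "heat_ball \<epsilon> z \<noteq> {}"
    and bdd: "bdd_above (\<phi> ` heat_ball \<epsilon> z)" "bdd_below (\<phi> ` heat_ball \<epsilon> z)"
  shows "Lp_norm (heat_measure \<epsilon> z) \<infinity> (\<lambda>w. \<phi> w - m) =
    ennreal (max ((SUP w\<in>heat_ball \<epsilon> z. \<phi> w) - m) (m - (INF w\<in>heat_ball \<epsilon> z. \<phi> w)))" (is "_ = ennreal ?B")
proof -
  let ?E = "heat_ball \<epsilon> z" and ?M = "heat_measure \<epsilon> z"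
  have [measurable]: "\<phi> \<in> borel_measurable ?M" by (rule heat_measure_continuous_measurable[OF \<phi>])
  have "Lp_norm ?M \<infinity> (\<lambda>w. \<phi> w - m) = esssup ?M (\<lambda>w. ennreal \<bar>\<phi> w - m\<bar>)" by (simp add: Lp_norm_def)
  also have "\<dots> = ennreal ?B"
  proof (rule antisym)
    show "esssup ?M (\<lambda>w. ennreal \<bar>\<phi> w - m\<bar>) \<le> ennreal ?B"
    proof (rule esssup_I)
      show "AE w in ?M. ennreal \<bar>\<phi> w - m\<bar> \<le> ennreal ?B"
      proof (rule AE_I2)
        fix w assume "w \<in> space ?M"
        then have "\<phi> w \<le> (SUP w\<in>?E. \<phi> w)" "(INF w\<in>?E. \<phi> w) \<le> \<phi> w"
          using bdd by (auto intro: cSUP_upper cINF_lower)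
        then show "ennreal \<bar>\<phi> w - m\<bar> \<le> ennreal ?B" by (intro ennreal_leI) (auto simp: abs_if max_def)
      qed
    qed measurable
    show "ennreal ?B \<le> esssup ?M (\<lambda>w. ennreal \<bar>\<phi> w - m\<bar>)"
    proof (rule ccontr)
      assume "\<not> ?thesis"
      then have less: "esssup ?M (\<lambda>w. ennreal \<bar>\<phi> w - m\<bar>) < ennreal ?B" by simp
      then obtain r where r: "esssup ?M (\<lambda>w. ennreal \<bar>\<phi> w - m\<bar>) = ennreal r" "0 \<le> r"
        by (cases "esssup ?M (\<lambda>w. ennreal \<bar>\<phi> w - m\<bar>)") auto
      have rB: "r < ?B" using less r by (simp add: ennreal_less_iff)
      have "AE w in ?M. ennreal \<bar>\<phi> w - m\<bar> \<le> ennreal r" using esssup_AE[of "\<lambda>w. ennreal \<bar>\<phi> w - m\<bar>" ?M] r by simp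
      then have ae: "AE w in ?M. \<bar>\<phi> w - m\<bar> \<le> r" using r(2) by (simp add: ennreal_le_iff)
      have "open (?E \<inter> (\<lambda>w. \<bar>\<phi> w - m\<bar>) -` {r<..})"
        by (rule continuous_open_preimage[OF _ heat_ball_open[OF e]]) (auto intro!: continuous_intros \<phi>)
      moreover have "AE w in ?M. w \<notin> ?E \<inter> (\<lambda>w. \<bar>\<phi> w - m\<bar>) -` {r<..}"
        using ae by eventually_elim auto
      ultimately have "?E \<inter> (\<lambda>w. \<bar>\<phi> w - m\<bar>) -` {r<..} = {}"
        by (intro heat_measure_charges_open[OF e]) auto
      then have "\<bar>\<phi> w - m\<bar> \<le> r" if "w \<in> ?E" for w using that by (force simp: not_less)
      then have "\<phi> w \<le> m + r" "m - r \<le> \<phi> w" if "w \<in> ?E" for w using that by (auto simp: abs_le_iff algebra_simps)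
      then have "(SUP w\<in>?E. \<phi> w) \<le> m + r" "m - r \<le> (INF w\<in>?E. \<phi> w)"
        using ne by (auto intro: cSUP_least cINF_greatest)
      then show False using rB by (auto simp: max_def split: if_splits)
    qed
  qed
  finally show ?thesis .
qed

lemma heat_mean_infinity:
  fixes z :: "(real^'n) \<times> real" and \<phi> :: "(real^'n) \<times> real \<Rightarrow> real"
  assumes e: "0 < \<epsilon>" and \<phi>: "continuous_on (heat_ball \<epsilon> z) \<phi>" and ne: "heat_ball \<epsilon> z \<noteq> {}"
    and bdd: "bdd_above (\<phi> ` heat_ball \<epsilon> z)" "bdd_below (\<phi> ` heat_ball \<epsilon> z)"
  shows "heat_mean \<infinity> \<epsilon> \<phi> z = ((SUP w\<in>heat_ball \<epsilon> z. \<phi> w) + (INF w\<in>heat_ball \<epsilon> z. \<phi> w)) / 2"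
proof -
  let ?S = "SUP w\<in>heat_ball \<epsilon> z. \<phi> w" and ?I = "INF w\<in>heat_ball \<epsilon> z. \<phi> w"
  obtain v where "v \<in> heat_ball \<epsilon> z" using ne by blast
  then have SI: "?I \<le> ?S" using bdd by (intro order_trans[OF cINF_lower cSUP_upper])
  have le: "Lp_norm (heat_measure \<epsilon> z) \<infinity> (\<lambda>w. \<phi> w - m) \<le> Lp_norm (heat_measure \<epsilon> z) \<infinity> (\<lambda>w. \<phi> w - l) \<longleftrightarrow>
    max (?S - m) (m - ?I) \<le> max (?S - l) (l - ?I)" for m l
    unfolding Lp_norm_infinity[OF assms] using SI by (subst ennreal_le_iff) (auto simp: max_def)
  show ?thesis
    unfolding heat_mean_def le
  proof (rule the_equality)
    show "\<forall>l. max (?S - (?S + ?I) / 2) ((?S + ?I) / 2 - ?I) \<le> max (?S - l) (l - ?I)"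
      by (auto simp: max_def field_simps)
    fix m assume "\<forall>l. max (?S - m) (m - ?I) \<le> max (?S - l) (l - ?I)"
    then have "max (?S - m) (m - ?I) \<le> max (?S - (?S + ?I) / 2) ((?S + ?I) / 2 - ?I)" by blast
    then show "m = (?S + ?I) / 2" by (auto simp: max_def field_simps split: if_splits)
  qed
qed

text \<open>The infimum is handled as a supremum, after reflecting y_k and changing the sign. In the
  midrange the contributions b R and - b R of the two tips cancel, leaving the common value of the
  quadratic part: its coefficient of D_kk is R^2 / 2 = N / (4 pi e), and its time is 1 / (4 pi
  e).\<close>

lemma (in heat_test_function) heat_mean_infinity_limit:
  "((\<lambda>\<epsilon>. (heat_mean \<infinity> \<epsilon> \<phi> z - \<phi> z) / \<epsilon>\<^sup>2) \<longlongrightarrow>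
    1 / (4 * pi * exp 1) * (real CARD('n) * D $ k $ k - c)) (at_right 0)"
proof (rule tendstoI)
  fix \<delta>' :: real assume "0 < \<delta>'"
  define \<delta> where "\<delta> = \<delta>' / 2"
  have \<delta>: "0 < \<delta>" "\<delta> < \<delta>'" using \<open>0 < \<delta>'\<close> by (simp_all add: \<delta>_def)
  let ?h = "heat_quadratic D c"
  define \<Lambda> where "\<Lambda> = 1 / (4 * pi * exp 1) * (real CARD('n) * D $ k $ k - c)"
  let ?T = "scale_coord k (- 1)"
  let ?R = "tip_radius (real CARD('n))"
  have Dkk: "axis k 1 \<bullet> (D *v axis k 1) = D $ k $ k"
    by (simp add: inner_axis' matrix_vector_mul_component inner_axis)
  have R2: "?R * ?R = real CARD('n) / (2 * pi * exp 1)" by (simp add: tip_radius_def)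
  have "?h (tip k) = (?R * ?R) * D $ k $ k / 2 - c * (1 / (4 * pi * exp 1))"
    by (simp add: heat_quadratic_def tip_def matrix_vector_mult_scaleR Dkk mult.assoc)
  then have tip: "?h (tip k) = \<Lambda>"
    unfolding R2 \<Lambda>_def by (simp add: right_diff_distrib)
  \<comment> \<open>The reflected tip has the opposite space component, and the quadratic form is
    even.\<close>
  have "fst (?T (tip k)) = - fst (tip k)"
    by (simp add: vec_eq_iff fst_scale_coord_nth tip_def axis_def)
  then have Ttip: "?h (?T (tip k)) = \<Lambda>"
    using tip matrix_vector_mult_scaleR[of D "-1" "fst (tip k)"] by (simp add: heat_quadratic_def)
  have TH: "?T w \<in> unit_heat_ball" if "w \<in> unit_heat_ball" for w
    using that norm_scale_coord[of k "- 1" w] by (simp add: unit_heat_ball_def case_prod_beta)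
  have TT: "?T (?T w) = w" for w :: "(real^'n) \<times> real"
    by (simp add: prod_eq_iff vec_eq_iff fst_scale_coord_nth)
  have up: "\<forall>\<^sub>F \<epsilon> in at_right 0.
    (\<forall>w\<in>unit_heat_ball. b * fst w $ k + \<epsilon> * rest \<epsilon> w \<le> b * ?R + \<epsilon> * (?h (tip k) + \<delta>)) \<and>
    (\<forall>X. (\<forall>w\<in>unit_heat_ball. b * fst w $ k + \<epsilon> * rest \<epsilon> w \<le> X) \<longrightarrow> b * ?R + \<epsilon> * (?h (tip k) - \<delta>) \<le> X)"
    by (rule unit_heat_ball_sup[OF b heat_quadratic_continuous \<delta>(1)]) (use expansion in \<open>simp add: rest_def\<close>)
  have "continuous_on UNIV (\<lambda>w. - ?h (?T w))"
    unfolding scale_coord_def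
    by (intro continuous_on_minus continuous_on_compose2[OF heat_quadratic_continuous[of UNIV D c]] continuous_intros) auto
  then have down: "\<forall>\<^sub>F \<epsilon> in at_right 0.
    (\<forall>w\<in>unit_heat_ball. b * fst w $ k + \<epsilon> * (- rest \<epsilon> (?T w)) \<le> b * ?R + \<epsilon> * (- ?h (?T (tip k)) + \<delta>)) \<and>
    (\<forall>X. (\<forall>w\<in>unit_heat_ball. b * fst w $ k + \<epsilon> * (- rest \<epsilon> (?T w)) \<le> X) \<longrightarrow> b * ?R + \<epsilon> * (- ?h (?T (tip k)) - \<delta>) \<le> X)"
  proof (rule unit_heat_ball_sup[OF b _ \<delta>(1)])
    fix \<delta> :: real assume "0 < \<delta>"
    from expansion[OF this] show "\<forall>\<^sub>F \<epsilon> in at_right 0. \<forall>w\<in>unit_heat_ball. \<bar>- rest \<epsilon> (?T w) - - ?h (?T w)\<bar> \<le> \<delta>"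
      by eventually_elim (use TH in \<open>auto simp: rest_def abs_minus_commute\<close>)
  qed
  show "\<forall>\<^sub>F \<epsilon> in at_right 0. dist ((heat_mean \<infinity> \<epsilon> \<phi> z - \<phi> z) / \<epsilon>\<^sup>2)
    (1 / (4 * pi * exp 1) * (real CARD('n) * D $ k $ k - c)) < \<delta>'"
    unfolding \<Lambda>_def[symmetric] using up down eventually_small
  proof eventually_elim
    case (elim \<epsilon>)
    have e: "0 < \<epsilon>" and cont: "continuous_on (heat_ball \<epsilon> z) \<phi>" using elim(3) by (auto simp: small_def)
    let ?E = "heat_ball \<epsilon> z"
    let ?S = "SUP w\<in>?E. \<phi> w" and ?I = "INF w\<in>?E. \<phi> w"
    note E = blow_up_heat_ball(2)[OF e f, of z]
    have ne: "?E \<noteq> {}" unfolding E using unit_heat_ball_nonempty by blast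
    have upper: "\<phi> v \<le> \<phi> z + \<epsilon> * (b * ?R + \<epsilon> * (\<Lambda> + \<delta>))" if v: "v \<in> ?E" for v
    proof -
      obtain w where w: "w \<in> unit_heat_ball" "v = blow_up f z \<epsilon> w" using v unfolding E by blast
      have "b * fst w $ k + \<epsilon> * rest \<epsilon> w \<le> b * ?R + \<epsilon> * (\<Lambda> + \<delta>)"
        using elim(1) w(1) unfolding tip by blast
      then show ?thesis unfolding w(2) blow_up_eq[OF e] using e by (intro add_left_mono mult_left_mono) auto
    qed
    have lower: "\<phi> z - \<epsilon> * (b * ?R + \<epsilon> * (- \<Lambda> + \<delta>)) \<le> \<phi> v" if v: "v \<in> ?E" for v
    proof -
      obtain w where w: "w \<in> unit_heat_ball" "v = blow_up f z \<epsilon> w" using v unfolding E by blast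
      have "b * fst (?T w) $ k + \<epsilon> * (- rest \<epsilon> (?T (?T w))) \<le> b * ?R + \<epsilon> * (- \<Lambda> + \<delta>)"
        using elim(2) TH[OF w(1)] unfolding Ttip by blast
      then have "\<epsilon> * (- (b * fst w $ k + \<epsilon> * rest \<epsilon> w)) \<le> \<epsilon> * (b * ?R + \<epsilon> * (- \<Lambda> + \<delta>))"
        unfolding TT using e by (intro mult_left_mono) (simp_all add: fst_scale_coord_nth)
      then show ?thesis unfolding w(2) blow_up_eq[OF e] mult_minus_right by linarith
    qed
    have bdd: "bdd_above (\<phi> ` ?E)" "bdd_below (\<phi> ` ?E)"
      using upper lower by (auto intro!: bdd_aboveI bdd_belowI)
    have S1: "?S \<le> \<phi> z + \<epsilon> * (b * ?R + \<epsilon> * (\<Lambda> + \<delta>))" by (rule cSUP_least[OF ne upper])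
    have I1: "\<phi> z - \<epsilon> * (b * ?R + \<epsilon> * (- \<Lambda> + \<delta>)) \<le> ?I" by (rule cINF_greatest[OF ne lower])
    have "b * fst w $ k + \<epsilon> * rest \<epsilon> w \<le> (?S - \<phi> z) / \<epsilon>" if w: "w \<in> unit_heat_ball" for w
    proof -
      have "\<phi> (blow_up f z \<epsilon> w) \<le> ?S" using w E bdd by (intro cSUP_upper) auto
      then show ?thesis unfolding blow_up_eq[OF e] using e by (simp add: pos_le_divide_eq mult.commute)
    qed
    then have "b * ?R + \<epsilon> * (\<Lambda> - \<delta>) \<le> (?S - \<phi> z) / \<epsilon>" using elim(1) unfolding tip by blast
    then have S2: "\<epsilon> * (b * ?R + \<epsilon> * (\<Lambda> - \<delta>)) \<le> ?S - \<phi> z" using e by (simp add: pos_le_divide_eq mult.commute)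
    have "b * fst w $ k + \<epsilon> * (- rest \<epsilon> (?T w)) \<le> (\<phi> z - ?I) / \<epsilon>" if w: "w \<in> unit_heat_ball" for w
    proof -
      have "?I \<le> \<phi> (blow_up f z \<epsilon> (?T w))" using TH[OF w] E bdd by (intro cINF_lower) auto
      then have "\<epsilon> * (- (b * fst (?T w) $ k + \<epsilon> * rest \<epsilon> (?T w))) \<le> \<phi> z - ?I"
        unfolding blow_up_eq[OF e] mult_minus_right by linarith
      then have "- (b * fst (?T w) $ k + \<epsilon> * rest \<epsilon> (?T w)) * \<epsilon> \<le> \<phi> z - ?I" by (subst mult.commute)
      then have "- (b * fst (?T w) $ k + \<epsilon> * rest \<epsilon> (?T w)) \<le> (\<phi> z - ?I) / \<epsilon>" using e by (simp only: pos_le_divide_eq)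
      then show ?thesis by (simp add: fst_scale_coord_nth)
    qed
    then have "b * ?R + \<epsilon> * (- \<Lambda> - \<delta>) \<le> (\<phi> z - ?I) / \<epsilon>" using elim(2) unfolding Ttip by blast
    then have I2: "\<epsilon> * (b * ?R + \<epsilon> * (- \<Lambda> - \<delta>)) \<le> \<phi> z - ?I" using e by (simp add: pos_le_divide_eq mult.commute)
    define m where "m = heat_mean \<infinity> \<epsilon> \<phi> z"
    have m: "m = (?S + ?I) / 2" unfolding m_def by (rule heat_mean_infinity[OF e cont ne bdd])
    \<comment> \<open>With the three monomials named, the four bounds are linear, and X drops out of
      the sum of supremum and infimum.\<close>
    define X Y d where "X = \<epsilon> * (b * ?R)" and "Y = \<epsilon>\<^sup>2 * \<Lambda>" and "d = \<epsilon>\<^sup>2 * \<delta>"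
    note defs = X_def Y_def d_def
    have "?S - \<phi> z \<le> X + Y + d" using S1 by (simp add: defs power2_eq_square algebra_simps)
    moreover have "X + Y - d \<le> ?S - \<phi> z" using S2 by (simp add: defs power2_eq_square algebra_simps)
    moreover have "\<phi> z - ?I \<le> X - Y + d" using I1 by (simp add: defs power2_eq_square algebra_simps)
    moreover have "X - Y - d \<le> \<phi> z - ?I" using I2 by (simp add: defs power2_eq_square algebra_simps)
    moreover have "2 * m = ?S + ?I" using m by simp
    ultimately have "m - \<phi> z - Y \<le> d" "- d \<le> m - \<phi> z - Y" by linarith+
    then have "m - \<phi> z - \<epsilon>\<^sup>2 * \<Lambda> \<le> \<epsilon>\<^sup>2 * \<delta>" "- (\<epsilon>\<^sup>2 * \<delta>) \<le> m - \<phi> z - \<epsilon>\<^sup>2 * \<Lambda>"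
      unfolding defs .
    then have "\<bar>m - \<phi> z - \<epsilon>\<^sup>2 * \<Lambda>\<bar> \<le> \<delta> * \<epsilon>\<^sup>2" by (simp add: abs_le_iff mult.commute)
    then have "\<bar>m - \<phi> z - \<epsilon>\<^sup>2 * \<Lambda>\<bar> / \<epsilon>\<^sup>2 \<le> \<delta>" using e by (simp add: pos_divide_le_eq)
    moreover have "(m - \<phi> z) / \<epsilon>\<^sup>2 - \<Lambda> = (m - \<phi> z - \<epsilon>\<^sup>2 * \<Lambda>) / \<epsilon>\<^sup>2"
      using e by (simp add: diff_divide_distrib)
    ultimately show "dist ((heat_mean \<infinity> \<epsilon> \<phi> z - \<phi> z) / \<epsilon>\<^sup>2) \<Lambda> < \<delta>'"
      using \<delta>(2) by (simp only: m_def[symmetric] dist_real_def abs_divide abs_power2)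
  qed
qed

section \<open>Asymptotic expansion of the heat mean\<close>

theorem heat_mean_asymptotics:
  fixes \<phi> :: "(real ^ 'n) \<times> real \<Rightarrow> real"
  assumes N: "CARD('n) \<ge> 2" and p: "1 \<le> p"
    and C2: "C2_near \<phi> z" and g: "space_grad \<phi> z \<noteq> 0"
  shows "\<exists>C>0. ((\<lambda>\<epsilon>. (heat_mean p \<epsilon> \<phi> z - \<phi> z) / \<epsilon>\<^sup>2) \<longlongrightarrow>
    C * (scaled_p_laplacian_n p \<phi> z - time_deriv \<phi> z)) (at_right 0)"
proof -
  \<comment> \<open>Any coordinate axis will do; the rotation aligns it with the gradient.\<close>
  fix k :: 'n
  obtain x t where z: "z = (x, t)" by (cases z)
  obtain f D where f: "orthogonal_transformation f"
    and D: "trace D = laplacian (\<lambda>y. \<phi> (y, t)) x" "D $ k $ k = infinity_laplacian_n (\<lambda>y. \<phi> (y, t)) x"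
    and exp: "\<And>\<delta>. 0 < \<delta> \<Longrightarrow> \<forall>\<^sub>F \<epsilon> in at_right 0. \<forall>w\<in>unit_heat_ball.
      \<bar>(\<phi> (blow_up f z \<epsilon> w) - \<phi> z - \<epsilon> * (norm (space_grad \<phi> z) * fst w $ k)) / \<epsilon>\<^sup>2
        - heat_quadratic D (time_deriv \<phi> z) w\<bar> \<le> \<delta>"
    and cont: "\<forall>\<^sub>F \<epsilon> in at_right 0. continuous_on (heat_ball \<epsilon> z) \<phi>"
    using heat_blow_up_limit[OF C2[unfolded z] g[unfolded z], of k] unfolding z[symmetric] by blast
  interpret heat_test_function \<phi> z f D k "norm (space_grad \<phi> z)" "time_deriv \<phi> z"
    by standard (use N f exp cont g in auto)
  show ?thesis
  proof (cases "p = \<infinity>")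
    case True
    have "scaled_p_laplacian_n p \<phi> z = real CARD('n) * D $ k $ k"
      by (simp add: scaled_p_laplacian_n_def p_laplacian_n_def z True D)
    with heat_mean_infinity_limit True show ?thesis
      by (intro exI[of _ "1 / (4 * pi * exp 1)"]) simp
  next
    case False
    then obtain q where pq: "p = ereal q" "1 \<le> q" using p by (cases p) auto
    interpret heat_test_exponent \<phi> z f D k "norm (space_grad \<phi> z)" "time_deriv \<phi> z" q
      by standard (rule pq(2))
    have "scaled_p_laplacian_n p \<phi> z = real CARD('n) / (real CARD('n) + q - 2) * (trace D + (q - 2) * D $ k $ k)"
      by (simp add: scaled_p_laplacian_n_def p_laplacian_n_def infinity_laplacian_n_def z pq(1) D)
    with heat_mean_limit pq(1) show ?thesis by simp
  qed
qed

lemma up_to_o_sq_iff: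
  assumes lim: "((\<lambda>\<epsilon>. (m \<epsilon> - a) / \<epsilon>\<^sup>2) \<longlongrightarrow> L) (at_right 0)"
  shows "ge_up_to_o_sq (\<lambda>_. a) m \<longleftrightarrow> L \<le> 0" and "le_up_to_o_sq (\<lambda>_. a) m \<longleftrightarrow> 0 \<le> L"
proof -
  have pos: "\<forall>\<^sub>F \<epsilon> in at_right (0::real). 0 < \<epsilon>" by (simp add: eventually_at_right_less)
  \<comment> \<open>The canonical witness: m + r equals a + \<epsilon>^2 L exactly, and r is
    o(\<epsilon>^2) by the limit hypothesis, so both inequalities reduce to the sign of L.\<close>
  define r where "r \<epsilon> = \<epsilon>\<^sup>2 * L - (m \<epsilon> - a)" for \<epsilon>
  have "((\<lambda>\<epsilon>. L - (m \<epsilon> - a) / \<epsilon>\<^sup>2) \<longlongrightarrow> L - L) (at_right 0)" by (intro tendsto_intros lim)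
  moreover have "\<forall>\<^sub>F \<epsilon> in at_right 0. L - (m \<epsilon> - a) / \<epsilon>\<^sup>2 = r \<epsilon> / \<epsilon>\<^sup>2"
    using pos by eventually_elim (simp add: r_def diff_divide_distrib)
  ultimately have r: "((\<lambda>\<epsilon>. r \<epsilon> / \<epsilon>\<^sup>2) \<longlongrightarrow> 0) (at_right 0)"
    using Lim_transform_eventually by force
  show "ge_up_to_o_sq (\<lambda>_. a) m \<longleftrightarrow> L \<le> 0"
  proof
    assume "ge_up_to_o_sq (\<lambda>_. a) m"
    then obtain s where s: "((\<lambda>\<epsilon>. s \<epsilon> / \<epsilon>\<^sup>2) \<longlongrightarrow> 0) (at_right 0)" "\<forall>\<^sub>F \<epsilon> in at_right 0. m \<epsilon> + s \<epsilon> \<le> a"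
      unfolding ge_up_to_o_sq_def by blast
    have "\<forall>\<^sub>F \<epsilon> in at_right 0. (m \<epsilon> - a) / \<epsilon>\<^sup>2 + s \<epsilon> / \<epsilon>\<^sup>2 \<le> 0"
      using s(2) pos by eventually_elim (simp add: add_divide_distrib[symmetric] divide_le_0_iff)
    from tendsto_upperbound[OF tendsto_add[OF lim s(1)] this] show "L \<le> 0" by simp
  next
    assume "L \<le> 0"
    then have "m \<epsilon> + r \<epsilon> \<le> a" for \<epsilon> by (simp add: r_def mult_nonneg_nonpos)
    with r show "ge_up_to_o_sq (\<lambda>_. a) m"
      unfolding ge_up_to_o_sq_def by (intro exI[of _ r]) simp
  qed
  show "le_up_to_o_sq (\<lambda>_. a) m \<longleftrightarrow> 0 \<le> L"
  proof
    assume "le_up_to_o_sq (\<lambda>_. a) m"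
    then obtain s where s: "((\<lambda>\<epsilon>. s \<epsilon> / \<epsilon>\<^sup>2) \<longlongrightarrow> 0) (at_right 0)" "\<forall>\<^sub>F \<epsilon> in at_right 0. a \<le> m \<epsilon> + s \<epsilon>"
      unfolding le_up_to_o_sq_def by blast
    have "\<forall>\<^sub>F \<epsilon> in at_right 0. 0 \<le> (m \<epsilon> - a) / \<epsilon>\<^sup>2 + s \<epsilon> / \<epsilon>\<^sup>2"
      using s(2) pos by eventually_elim (simp add: add_divide_distrib[symmetric])
    from tendsto_lowerbound[OF tendsto_add[OF lim s(1)] this] show "0 \<le> L" by simp
  next
    assume "0 \<le> L"
    then have "a \<le> m \<epsilon> + r \<epsilon>" for \<epsilon> by (simp add: r_def)
    with r show "le_up_to_o_sq (\<lambda>_. a) m"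
      unfolding le_up_to_o_sq_def by (intro exI[of _ r]) simp
  qed
qed

theorem theorem1p2:
  fixes p :: ereal
    and \<Omega> :: "(real ^ 'n) set"
    and T :: real
    and u :: "(real ^ 'n) \<times> real \<Rightarrow> real"
  assumes "CARD('n) \<ge> 2"
    and "1 \<le> p"
    and "open \<Omega>"
    and "T > 0"
    and "continuous_on (\<Omega> \<times> {0<..<T}) u"
  shows "viscosity_solution p (\<Omega> \<times> {0<..<T}) u \<longleftrightarrow>
         (\<forall>z \<in> \<Omega> \<times> {0<..<T}. viscosity_mean_value p u z)"
proof -
  have iff: "(ge_up_to_o_sq (\<lambda>_. \<phi> z) (\<lambda>\<epsilon>. heat_mean p \<epsilon> \<phi> z) \<longleftrightarrow> scaled_p_laplacian_n p \<phi> z \<le> time_deriv \<phi> z) \<and>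
    (le_up_to_o_sq (\<lambda>_. \<phi> z) (\<lambda>\<epsilon>. heat_mean p \<epsilon> \<phi> z) \<longleftrightarrow> time_deriv \<phi> z \<le> scaled_p_laplacian_n p \<phi> z)"
    if \<phi>: "C2_near \<phi> z" "space_grad \<phi> z \<noteq> 0" for \<phi> :: "(real ^ 'n) \<times> real \<Rightarrow> real" and z
  proof -
    obtain C where C: "0 < C" "((\<lambda>\<epsilon>. (heat_mean p \<epsilon> \<phi> z - \<phi> z) / \<epsilon>\<^sup>2) \<longlongrightarrow>
      C * (scaled_p_laplacian_n p \<phi> z - time_deriv \<phi> z)) (at_right 0)"
      using heat_mean_asymptotics[OF assms(1,2) \<phi>] by blast
    show ?thesis
      unfolding up_to_o_sq_iff[OF C(2)] using C(1) by (simp add: mult_le_0_iff zero_le_mult_iff)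
  qed
  show ?thesis
    unfolding viscosity_solution_def viscosity_mean_value_def
    using iff by (auto simp: touches_below_def touches_above_def)
qed

end
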